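(* For every $\varepsilon>0$ there is a constant $c_\varepsilon>0$, depending only on $\varepsilon$, such that the following holds. Let $k$ be a field, and let $p$ be its characteristic if positive and $p=\infty$ if $k$ has characteristic zero. For every finite nonempty $A\subset k$ with $|A|\le p^{1/3}$, $$\max\{|A+A|,|AA|\}\ge c_\varepsilon\,|A|^{49/38-\varepsilon}.$$ In characteristic zero there is no restriction on $|A|$.
   Context: $A+A:=\{a+b:a,b\in A\}$ and $AA:=\{ab:a,b\in A\}$. *)

theory Defs
  imports Complex_Main "HOL-Algebra.Algebra"
begin

definition ring_char :: "('a, 'm) ring_scheme \<Rightarrow> nat" where
  "ring_char R =
    (if \<exists>n::nat. n > 0 \<and> [n] \<cdot>\<^bsub>R\<^esub> \<one>\<^bsub>R\<^esub> = \<zero>\<^bsub>R\<^esub>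
     then (LEAST n::nat. n > 0 \<and> [n] \<cdot>\<^bsub>R\<^esub> \<one>\<^bsub>R\<^esub> = \<zero>\<^bsub>R\<^esub>)
     else 0)"

text \<open>
  The convention that the characteristic bound is infinite in characteristic zero is rendered
  by the disjunct \<open>ring_char k = 0\<close>.  The sets \<open>A <+>\<^bsub>k\<^esub> A\<close> and \<open>A <#>\<^bsub>k\<^esub> A\<close> are the sum set and
  the product set of \<open>A\<close>.
\<close>

definition sum_product_bound :: "('a, 'm) ring_scheme \<Rightarrow> real \<Rightarrow> real \<Rightarrow> bool" where
  "sum_product_bound k \<epsilon> c \<longleftrightarrow>
    (\<forall>A. A \<subseteq> carrier k \<longrightarrow> finite A \<longrightarrow> A \<noteq> {} \<longrightarrow>
      ring_char k = 0 \<or> real (card A) \<le> real (ring_char k) powr (1 / 3) \<longrightarrow>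
      real (max (card (A <+>\<^bsub>k\<^esub> A)) (card (A <#>\<^bsub>k\<^esub> A))) \<ge> c * real (card A) powr (49 / 38 - \<epsilon>))"

text \<open>
  The constant must depend on \<open>\<epsilon>\<close> alone, but a formula cannot quantify over types, so under an
  existential quantifier inside a theorem about fields with elements in \<open>'a\<close> the constant could
  depend on \<open>'a\<close>.  Here it is a closed function of \<open>\<epsilon>\<close> with no type variable, hence the same for
  fields over all types.  It is some positive constant that works for all fields with elements in
  \<open>nat\<close>, if there is one, and otherwise unspecified.  That it exists, and that it also works for
  all other fields, is not part of the definition and has to be proved.  Nothing is lost by the
  choice of \<open>nat\<close>: the subfield generated by a finite set is countable and so has an isomorphic
  copy with elements in \<open>nat\<close>.
\<close>

definition sum_product_const :: "real \<Rightarrow> real" where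
  "sum_product_const \<epsilon> =
    (SOME c. c > 0 \<and> (\<forall>k :: nat ring. field k \<longrightarrow> sum_product_bound k \<epsilon> c))"

end

theory Submission
  imports Defs "HOL-Analysis.Harmonic_Numbers" "HOL-Real_Asymp.Real_Asymp"
    "Berlekamp_Zassenhaus.Unique_Factorization_Poly" "Subresultants.Subresultant_Gcd"
begin

text \<open>
  Incidences.  For finitely many points in the plane over a field, interpolate a nonzero polynomial
  \<open>G(x, y, m)\<close> of degree less than \<open>k\<close> in the slope variable \<open>m\<close> that vanishes to order \<open>k\<close> at
  every point along every line through it.  Counting zeros, \<open>G\<close> vanishes along every rich line, and
  then so does its derivative \<open>G\<^sub>x + m G\<^sub>y\<close> along the lines.  By a resultant bound, up to few lines
  one may replace \<open>G\<close> by a factor \<open>H\<close> whose derivative along lines is zero.  If \<open>k\<close>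
  of these lines meet in a point, then \<open>H\<close> vanishes along all lines through that point, so
  there are few such points, and the rich lines are counted by double counting.  This is a
  Szemeredi-Trotter type bound for rich lines, valid as long as the characteristic is large.

  Energies.  Let \<open>n = |A|\<close> and let the third-order energy \<open>E(A, B)\<close> be the sum of the cubes of the
  representation counts \<open>a + b\<close> (or \<open>a b\<close>).  If \<open>E(A, B) > \<Delta> |A| |B|\<^sup>2\<close> for some \<open>B\<close>, the bound on rich
  lines provides a subset of \<open>A\<close> whose multiplicative energies are small, with parameter at most
  \<open>n / \<Delta>\<close>.  Collecting such subsets, at least half of \<open>A\<close> has small additive energies
  (parameter \<open>\<Delta>\<close>) or small multiplicative ones (parameter \<open>n / \<Delta>\<close>), up to logarithms.  In an abelian
  group, energies with parameter \<open>d\<close> force \<open>|A|\<^sup>3\<^sup>0 \<le> d\<^sup>1\<^sup>1 |A + A|\<^sup>1\<^sup>9\<close> up to logarithms, by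
  considering popular sums and popular differences.  The choice \<open>\<Delta> = sqrt n\<close> gives the
  exponent \<open>(30 - 11/2) / 19 = 49/38\<close>.
\<close>

section \<open>Polynomials along lines\<close>

text \<open>Third moments are the natural ones here: in the main range the number of lines with at
  least \<open>s\<close> points decays like \<open>s^-3\<close>, so that sums of cubes of counts are
  controlled up to a logarithm. The characteristic matters at one point only: a polynomial with zero
  derivative has to be constant, which needs its degree below \<open>p\<close>. The degree along a
  line is at most about \<open>|C| |X|\<close>, where \<open>X\<close> is a set of popular sums with
  \<open>|X|^2 <= |A|^2 |B|\<close> up to logarithms. As \<open>|B|\<close> and \<open>|C|\<close>
  are at most \<open>32 W\<close> with \<open>W < n^(49/38)\<close>, the square of the degree is
  about \<open>n^2 W^3 < n^(6 - 5/38)\<close>. Hence \<open>n^3 <= p\<close> suffices, and the spare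
  power pays for constants and logarithms. The polynomial tools live in type classes, while the
  theorem is about records over any type, with one constant. So the size beyond which the estimate
  holds is made to depend on \<open>\<epsilon>\<close> alone, a hypothetical counterexample on
  \<open>nat\<close> is turned into a type, and all other fields are reached through countable
  subfields.\<close>

lemma homogeneous_system_solution:
  fixes M :: "'w \<Rightarrow> 'u \<Rightarrow> 'f::field"
  assumes "finite W" "finite U" "card W < card U"
  shows "\<exists>g. (\<exists>u\<in>U. g u \<noteq> 0) \<and> (\<forall>w\<in>W. (\<Sum>u\<in>U. M w u * g u) = 0)"
  using assms
proof (induction W arbitrary: U M rule: finite_induct)
  case empty
  then obtain u where "u \<in> U" by fastforce
  then show ?case by (intro exI[of _ "\<lambda>_. 1"]) auto
next
  case (insert w W)
  show ?case
  proof (cases "\<forall>u\<in>U. M w u = 0")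
    case True
    from insert have "card W < card U" by simp
    from insert.IH[OF insert.prems(1) this, of M] True show ?thesis by auto
  next
    case False
    then obtain v where v: "v \<in> U" "M w v \<noteq> 0" by auto
    have "card W < card (U - {v})" using insert v by simp
    \<comment> \<open>One step of Gaussian elimination: equation \<open>w\<close> is solved for the
      unknown \<open>v\<close> and inserted into the others.\<close>
    from insert.IH[OF _ this, of "\<lambda>w' u. M w' u - M w' v * M w u / M w v"] insert.prems
    obtain g u where u: "u \<in> U - {v}" "g u \<noteq> 0"
      and g: "\<And>w'. w' \<in> W \<Longrightarrow> (\<Sum>u\<in>U - {v}. (M w' u - M w' v * M w u / M w v) * g u) = 0" by auto
    define h where "h = g(v := - (\<Sum>u\<in>U - {v}. M w u * g u) / M w v)"
    have sum_h: "(\<Sum>u\<in>U. M w' u * h u) = M w' v * h v + (\<Sum>u\<in>U - {v}. M w' u * g u)" for w'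
      using v insert.prems by (subst sum.remove[of U v]) (auto simp: h_def intro!: sum.cong)
    have "(\<Sum>u\<in>U. M w' u * h u) = 0" if "w' \<in> insert w W" for w'
    proof (cases "w' = w")
      case True
      then show ?thesis unfolding sum_h using v by (simp add: h_def)
    next
      case False
      with that have "(\<Sum>u\<in>U - {v}. (M w' u - M w' v * M w u / M w v) * g u) = 0" by (intro g) auto
      also have "(\<Sum>u\<in>U - {v}. (M w' u - M w' v * M w u / M w v) * g u)
        = (\<Sum>u\<in>U - {v}. M w' u * g u) - (\<Sum>u\<in>U - {v}. M w' v / M w v * (M w u * g u))"
        unfolding sum_subtractf[symmetric] by (intro sum.cong) (auto simp: algebra_simps)
      also have "\<dots> = (\<Sum>u\<in>U - {v}. M w' u * g u) + M w' v * h v"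
        by (simp add: sum_distrib_left[symmetric] sum_divide_distrib[symmetric] h_def)
      finally show ?thesis unfolding sum_h by (simp only: add.commute)
    qed
    moreover have "h u \<noteq> 0" using u by (auto simp: h_def)
    ultimately show ?thesis using u by blast
  qed
qed

text \<open>
  The type of \<open>G\<close> encodes \<open>k[x][y][m]\<close>, the slope \<open>m\<close> being the outermost variable; the line
  \<open>y = m x + c\<close> is written \<open>(m, c)\<close> and parametrised by \<open>x\<close>.
\<close>

definition line_eval :: "'a::comm_ring_1 \<Rightarrow> 'a \<Rightarrow> 'a poly poly poly \<Rightarrow> 'a poly" where
  "line_eval m c G = poly (poly G [:[:m:]:]) [:c, m:]"

lemma line_eval_mult: "line_eval m c (G * H) = line_eval m c G * line_eval m c H"
  by (simp add: line_eval_def)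

lemma line_eval_dvd: "G dvd H \<Longrightarrow> line_eval m c G dvd line_eval m c H"
  by (auto simp: line_eval_mult elim!: dvdE)

text \<open>
  \<open>flow G = G\<^sub>x + m G\<^sub>y\<close> is the derivative along the line of slope \<open>m\<close>; this is \<open>pderiv_line_eval\<close>.
\<close>

definition flow :: "'a::idom poly poly poly \<Rightarrow> 'a poly poly poly" where
  "flow G = map_poly (map_poly pderiv) G + [:0, 1:] * map_poly pderiv G"

lemma pderiv_poly_chain:
  fixes q :: "'a::idom poly poly"
  shows "pderiv (poly q Y) = poly (map_poly pderiv q) Y + pderiv Y * poly (pderiv q) Y"
proof (induction q)
  case (pCons a q)
  then show ?case
    by (simp add: map_poly_pCons pderiv_add pderiv_mult pderiv_pCons algebra_simps)
qed simp

lemma pderiv_line_eval: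
  fixes G :: "'a::idom poly poly poly"
  shows "pderiv (line_eval m c G) = line_eval m c (flow G)"
proof -
  define Y where "Y = [:c, m:]"
  have Y': "pderiv Y = [:m:]" by (simp add: Y_def pderiv_pCons)
  define M where "M = [:[:m:]:]"
  have "map_poly pderiv M = 0"
    by (rule poly_eqI) (simp add: M_def coeff_map_poly coeff_pCons pderiv_pCons split: nat.split)
  then have M: "poly (map_poly pderiv M) Y = 0" "pderiv M = 0" "poly M Y = [:m:]"
    by (simp_all add: M_def pderiv_pCons)
  have "pderiv (poly (poly G M) Y)
    = poly (poly (map_poly (map_poly pderiv) G) M) Y + [:m:] * poly (poly (map_poly pderiv G) M) Y"
  proof (induction G)
    case (pCons a G)
    have m: "pderiv [:m:] = 0" by (simp add: pderiv_pCons)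
    have "pderiv (poly (poly (pCons a G) M) Y)
      = pderiv (poly a Y) + [:m:] * pderiv (poly (poly G M) Y)"
      unfolding poly_pCons poly_add poly_mult pderiv_add pderiv_mult M m by (simp only: mult_zero_right add_0_right)
    also have "\<dots> = poly (poly (map_poly (map_poly pderiv) (pCons a G)) M) Y
      + [:m:] * poly (poly (map_poly pderiv (pCons a G)) M) Y"
      unfolding pCons.IH pderiv_poly_chain[of a] Y'
      using pCons.hyps by (simp add: map_poly_pCons M algebra_simps del: mult_pCons_left mult_pCons_right)
    finally show ?case .
  qed simp
  then show ?thesis by (simp add: line_eval_def flow_def Y_def M_def)
qed

lemma infinite_roots_imp_zero:
  fixes p :: "'a::idom poly"
  assumes "infinite Xs" "\<And>x. x \<in> Xs \<Longrightarrow> poly p x = 0"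
  shows "p = 0"
  using assms poly_roots_finite[of p] by (meson finite_subset mem_Collect_eq subsetI)

lemma line_eval_all_zero:
  fixes F :: "'a::idom poly poly poly"
  assumes inf: "infinite (UNIV :: 'a set)" and z: "\<And>m c. line_eval m c F = 0"
  shows "F = 0"
proof -
  have "poly F [:[:m:]:] = 0" for m
  proof (rule infinite_roots_imp_zero)
    show "infinite (range (\<lambda>c. [:c, m:]))"
      using inf by (subst finite_image_iff) (auto simp: inj_on_def)
  qed (use z in \<open>auto simp: line_eval_def\<close>)
  then show ?thesis
    using inf by (intro infinite_roots_imp_zero[of "range (\<lambda>m. [:[:m:]:])"])
      (auto simp: finite_image_iff inj_on_def)
qed

text \<open>On every line the derivative of \<open>G\<close> is a multiple of \<open>G\<close> of
  smaller degree, hence zero; and over an infinite field a polynomial that vanishes along all lines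
  is zero.\<close>

lemma dvd_flow_imp_flow_eq_0:
  fixes G :: "'a::idom_divide poly poly poly"
  assumes inf: "infinite (UNIV :: 'a set)" and dvd: "G dvd flow G"
  shows "flow G = 0"
proof (rule line_eval_all_zero[OF inf])
  fix m c
  have "line_eval m c G dvd pderiv (line_eval m c G)"
    unfolding pderiv_line_eval by (rule line_eval_dvd[OF dvd])
  then have "pderiv (line_eval m c G) = 0"
    using dvd_imp_degree_le[of "line_eval m c G" "pderiv (line_eval m c G)"] degree_pderiv_le[of "line_eval m c G"]
    by (cases "degree (line_eval m c G) = 0")
      (force elim!: degree_eq_zeroE simp: pderiv_pCons, linarith)
  then show "line_eval m c (flow G) = 0" by (simp add: pderiv_line_eval)
qed

text \<open>For \<open>G\<close> in \<open>k[x][y][m]\<close> this is the degree in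
  \<open>y\<close>, whereas \<open>degree\<close> is the degree in \<open>m\<close>; for a
  polynomial in \<open>k[x][y]\<close> it is the degree in \<open>x\<close>. It is 0 for the zero
  polynomial.\<close>

definition inner_degree :: "'a::zero poly poly \<Rightarrow> nat" where
  "inner_degree p = Max ((\<lambda>j. degree (coeff p j)) ` {..degree p})"

lemma degree_coeff_le_inner_degree: "degree (coeff p j) \<le> inner_degree p"
proof (cases "j \<le> degree p")
  case True
  then show ?thesis by (simp add: inner_degree_def)
next
  case False
  then show ?thesis by (simp add: coeff_eq_0)
qed

lemma inner_degree_leI: "(\<And>j. degree (coeff p j) \<le> n) \<Longrightarrow> inner_degree p \<le> n"
  unfolding inner_degree_def by (subst Max_le_iff) auto

lemma inner_degree_attained: "\<exists>j. degree (coeff p j) = inner_degree p"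
proof -
  have "inner_degree p \<in> (\<lambda>j. degree (coeff p j)) ` {..degree p}"
    unfolding inner_degree_def by (rule Max_in) auto
  then show ?thesis by auto
qed

lemma inner_degree_add_le: "inner_degree (p + q) \<le> max (inner_degree p) (inner_degree q)"
  by (rule inner_degree_leI, unfold coeff_add, rule degree_add_le)
    (meson degree_coeff_le_inner_degree max.coboundedI1 max.coboundedI2)+

lemma inner_degree_mult_le:
  fixes p q :: "'a::comm_semiring_0 poly poly"
  shows "inner_degree (p * q) \<le> inner_degree p + inner_degree q"
proof (rule inner_degree_leI)
  fix j
  show "degree (coeff (p * q) j) \<le> inner_degree p + inner_degree q"
    unfolding coeff_mult
  proof (rule degree_sum_le)
    fix i
    show "degree (coeff p i * coeff q (j - i)) \<le> inner_degree p + inner_degree q"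
      by (meson add_mono degree_coeff_le_inner_degree degree_mult_le order_trans)
  qed simp
qed

lemma coeff_mult_le_degrees:
  fixes r s :: "'a::comm_semiring_0 poly"
  assumes "degree r \<le> a" "degree s \<le> b"
  shows "coeff (r * s) (a + b) = coeff r a * coeff s b"
proof (cases "degree r = a \<and> degree s = b")
  case True
  then show ?thesis using coeff_mult_degree_sum[of r s] by auto
next
  case False
  then have lt: "degree r < a \<or> degree s < b" using assms by linarith
  have "degree (r * s) \<le> degree r + degree s" by (rule degree_mult_le)
  then have "degree (r * s) < a + b" using lt assms by linarith
  with lt show ?thesis by (auto simp: coeff_eq_0)
qed

text \<open>\<open>p'\<close> and \<open>q'\<close> are the leading coefficients with respect to the
  inner variable, as polynomials in the outer one; in a domain their product is nonzero. Additivity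
  lets degree bounds survive division by a gcd.\<close>

lemma inner_degree_mult:
  fixes p q :: "'a::idom poly poly"
  assumes "p \<noteq> 0" "q \<noteq> 0"
  shows "inner_degree (p * q) = inner_degree p + inner_degree q"
proof (rule antisym[OF inner_degree_mult_le])
  define a b where "a = inner_degree p" and "b = inner_degree q"
  define p' q' where "p' = map_poly (\<lambda>r. coeff r a) p" and "q' = map_poly (\<lambda>r. coeff r b) q"
  have c: "coeff p' i = coeff (coeff p i) a" "coeff q' i = coeff (coeff q i) b" for i
    by (simp_all add: p'_def q'_def coeff_map_poly)
  have nz: "\<exists>i. coeff (coeff r i) (inner_degree r) \<noteq> 0" if r: "r \<noteq> 0" for r :: "'a poly poly"
  proof -
    obtain j where j: "degree (coeff r j) = inner_degree r" using inner_degree_attained by blast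
    show ?thesis
    proof (cases "coeff r j = 0")
      case True
      then have "inner_degree r = 0" using j by simp
      then have "degree (lead_coeff r) = 0" using degree_coeff_le_inner_degree[of r "degree r"] by simp
      then have "coeff (coeff r (degree r)) 0 \<noteq> 0"
        using r by (metis leading_coeff_0_iff)
      with \<open>inner_degree r = 0\<close> show ?thesis by auto
    next
      case False
      then show ?thesis using j by (metis leading_coeff_0_iff)
    qed
  qed
  have "p' \<noteq> 0" "q' \<noteq> 0" using nz[OF assms(1)] nz[OF assms(2)]
    by (metis a_def b_def c coeff_0)+
  then obtain n where n: "coeff (p' * q') n \<noteq> 0" by (metis leading_coeff_0_iff mult_eq_0_iff)
  have "coeff (coeff (p * q) n) (a + b) = coeff (p' * q') n"
    unfolding coeff_mult[of p q] coeff_mult[of p' q'] coeff_sum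
    by (intro sum.cong refl, subst coeff_mult_le_degrees)
      (simp_all add: a_def b_def degree_coeff_le_inner_degree c[unfolded a_def b_def])
  with n have "a + b \<le> degree (coeff (p * q) n)" by (intro le_degree) simp
  also have "\<dots> \<le> inner_degree (p * q)" by (rule degree_coeff_le_inner_degree)
  finally show "inner_degree p + inner_degree q \<le> inner_degree (p * q)" by (simp add: a_def b_def)
qed

lemma degree_poly_le_inner_degree:
  fixes p :: "'a::comm_ring_1 poly poly"
  shows "degree (poly p [:a:]) \<le> inner_degree p"
  unfolding poly_altdef
proof (rule degree_sum_le)
  fix i
  have "degree (coeff p i * [:a:] ^ i) \<le> degree (coeff p i) + degree ([:a:] ^ i)" by (rule degree_mult_le)
  also have "degree ([:a:] ^ i) \<le> 0" using degree_power_le[of "[:a:]" i] by simp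
  finally show "degree (coeff p i * [:a:] ^ i) \<le> inner_degree p"
    using degree_coeff_le_inner_degree[of p i] by linarith
qed simp

section \<open>Resultants, and lines common to two polynomials\<close>

lemma degree_det_le:
  fixes A :: "'a::comm_ring_1 poly mat"
  assumes A: "A \<in> carrier_mat n n" and b: "\<And>i j. i < n \<Longrightarrow> j < n \<Longrightarrow> degree (A $$ (i, j)) \<le> b i"
  shows "degree (det A) \<le> (\<Sum>i<n. b i)"
  unfolding det_def'[OF A]
proof (rule degree_sum_le)
  fix p assume "p \<in> {p. p permutes {0..<n}}"
  then have p: "p i < n" if "i < n" for i using that permutes_in_image[of p "{0..<n}" i] by auto
  have "degree (signof p * (\<Prod>i = 0..<n. A $$ (i, p i))) \<le> degree (\<Prod>i = 0..<n. A $$ (i, p i))"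
    by (auto simp: sign_def)
  also have "\<dots> \<le> (\<Sum>i = 0..<n. degree (A $$ (i, p i)))"
      using degree_prod_sum_le[of "{0..<n}" "\<lambda>i. A $$ (i, p i)"] by (simp add: o_def)
  also have "\<dots> \<le> (\<Sum>i<n. b i)" using p b by (auto simp: lessThan_atLeast0 intro!: sum_mono)
  finally show "degree (signof p * (\<Prod>i = 0..<n. A $$ (i, p i))) \<le> (\<Sum>i<n. b i)" .
qed (simp add: finite_permutations)

text \<open>The first \<open>degree q\<close> rows of the Sylvester matrix consist of coefficients
  of \<open>p\<close>, the other \<open>degree p\<close> rows of coefficients of
  \<open>q\<close>.\<close>

lemma degree_resultant_le:
  fixes p q :: "'a::comm_ring_1 poly poly"
  shows "degree (resultant p q) \<le> degree q * inner_degree p + degree p * inner_degree q"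
proof -
  define b where "b i = (if i < degree q then inner_degree p else inner_degree q)" for i
  have "degree (resultant p q) \<le> (\<Sum>i<degree p + degree q. b i)"
    unfolding resultant_def
    by (rule degree_det_le[OF sylvester_carrier_mat])
      (auto simp: sylvester_index_mat b_def degree_coeff_le_inner_degree)
  also have "\<dots> = (\<Sum>i<degree q. b i) + (\<Sum>i=degree q..<degree p + degree q. b i)"
    by (subst sum.union_disjoint[symmetric]) (auto intro!: sum.cong)
  also have "\<dots> = degree q * inner_degree p + degree p * inner_degree q"
    by (simp add: b_def)
  finally show ?thesis .
qed

text \<open>The powers of the common root form a nonzero kernel vector. The sizes \<open>m\<close>
  and \<open>n\<close> are only upper bounds for the degrees, because substituting a line may lower
  the degrees.\<close>

lemma resultant_common_root:
  fixes p q :: "'a::idom poly"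
  assumes mn: "degree p \<le> m" "degree q \<le> n" "0 < m + n"
    and "poly p a = 0" "poly q a = 0"
  shows "det (sylvester_mat_sub m n p q) = 0"
proof -
  define S where "S = sylvester_mat_sub m n p q"
  have S: "S \<in> carrier_mat (m + n) (m + n)" by (simp add: S_def sylvester_mat_sub_carrier)
  define v where "v = vec (m + n) (\<lambda>j. a ^ (m + n - 1 - j))"
  have v: "v \<in> carrier_vec (m + n)" by (simp add: v_def)
  have "v $ (m + n - 1) = 1" using mn by (simp add: v_def)
  then have v0: "v \<noteq> 0\<^sub>v (m + n)" using mn by auto
  \<comment> \<open>A row holds the coefficients of \<open>f\<close> moved by \<open>k\<close>, so
    its product with the vector is \<open>poly f a\<close> times a power of
    \<open>a\<close>.\<close>
  have shift: "(\<Sum>j<m + n. (if k \<le> j \<and> j - k \<le> d then coeff f (d + k - j) else 0) * a ^ (m + n - 1 - j))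
      = a ^ (m + n - 1 - k - d) * poly f a"
    if "degree f \<le> d" "k + d < m + n" for f :: "'a poly" and d k
  proof -
    have "(\<Sum>j<m + n. (if k \<le> j \<and> j - k \<le> d then coeff f (d + k - j) else 0) * a ^ (m + n - 1 - j))
      = (\<Sum>j\<in>{k..k + d}. coeff f (d + k - j) * a ^ (m + n - 1 - j))"
      using that by (intro sum.mono_neutral_cong_right) auto
    also have "\<dots> = (\<Sum>i\<le>d. coeff f i * a ^ (m + n - 1 - k - d + i))"
      using that by (intro sum.reindex_bij_witness[of _ "\<lambda>i. d + k - i" "\<lambda>j. d + k - j"])
         (auto intro!: arg_cong2[where f="(*)"] arg_cong[where f="\<lambda>e. a ^ e"])
    also have "\<dots> = a ^ (m + n - 1 - k - d) * (\<Sum>i\<le>d. coeff f i * a ^ i)"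
      by (simp add: sum_distrib_left power_add algebra_simps)
    also have "(\<Sum>i\<le>d. coeff f i * a ^ i) = poly f a"
      unfolding poly_altdef using that(1)
      by (intro sum.mono_neutral_right) (auto simp: coeff_eq_0)
    finally show ?thesis .
  qed
  have "S *\<^sub>v v = 0\<^sub>v (m + n)"
  proof (rule eq_vecI)
    fix i assume "i < dim_vec (0\<^sub>v (m + n) :: 'a vec)"
    then have i: "i < m + n" by simp
    have "(S *\<^sub>v v) $ i = (\<Sum>j<m + n. S $$ (i, j) * a ^ (m + n - 1 - j))"
      using i S by (simp add: scalar_prod_def v_def lessThan_atLeast0)
    also have "\<dots> = 0"
    proof (cases "i < n")
      case True
      have "(\<Sum>j<m + n. S $$ (i, j) * a ^ (m + n - 1 - j))
        = (\<Sum>j<m + n. (if i \<le> j \<and> j - i \<le> m then coeff p (m + i - j) else 0) * a ^ (m + n - 1 - j))"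
        using i True by (intro sum.cong refl) (simp add: S_def sylvester_mat_sub_index)
      with shift[of p m i] True mn assms show ?thesis by simp
    next
      case False
      have "(\<Sum>j<m + n. S $$ (i, j) * a ^ (m + n - 1 - j))
        = (\<Sum>j<m + n. (if i - n \<le> j \<and> j - (i - n) \<le> n then coeff q (n + (i - n) - j) else 0) * a ^ (m + n - 1 - j))"
        using i False by (intro sum.cong refl) (auto simp add: S_def sylvester_mat_sub_index)
      with shift[of q n "i - n"] False mn assms i show ?thesis by simp
    qed
    finally show "(S *\<^sub>v v) $ i = 0\<^sub>v (m + n) $ i" using i by simp
  qed (use S in auto)
  with v v0 S show ?thesis unfolding S_def[symmetric] by (subst det_0_iff_vec_prod_zero[OF S]) blast
qed

text \<open>A line is read as the element \<open>[:c, m:]\<close> of the domain \<open>k[x]\<close>,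
  over which \<open>r\<close> is a polynomial in \<open>y\<close>; distinct lines are distinct
  roots.\<close>

lemma card_lines_le_degree:
  fixes r :: "'a::idom poly poly"
  assumes "r \<noteq> 0" "\<And>m c. (m, c) \<in> L \<Longrightarrow> poly r [:c, m:] = 0"
  shows "card L \<le> degree r"
proof -
  have "card L = card ((\<lambda>(m, c). [:c, m:]) ` L)"
    by (rule card_image[symmetric]) (auto simp: inj_on_def)
  also have "\<dots> \<le> card {x. poly r x = 0}"
    using assms by (intro card_mono poly_roots_finite) auto
  also have "\<dots> \<le> degree r" by (rule card_poly_roots_bound[OF assms(1)])
  finally show ?thesis .
qed

text \<open>The resultant eliminates the slope variable. After substitution of the line for
  \<open>y\<close>, a ring homomorphism, both polynomials have the common root \<open>[:m:]\<close>.
  Positive degree of \<open>G\<close> makes the Sylvester matrix nonempty.\<close>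

lemma resultant_on_common_line:
  fixes F G :: "'a::idom poly poly poly"
  assumes "0 < degree G" "line_eval m c G = 0" "line_eval m c F = 0"
  shows "poly (resultant G F) [:c, m:] = 0"
proof -
  define h where "h = (\<lambda>q :: 'a poly poly. poly q [:c, m:])"
  interpret h: comm_ring_hom h by unfold_locales (auto simp: h_def)
  have hm: "h [:[:m:]:] = [:m:]" by (simp add: h_def)
  have ev: "poly (map_poly h K) [:m:] = line_eval m c K" for K
    using h.poly_map_poly[of K "[:[:m:]:]"] by (simp add: hm line_eval_def h_def)
  have "h (resultant G F) = det (map_mat h (sylvester_mat G F))"
    unfolding resultant_def by (rule h.hom_det[symmetric])
  also have "\<dots> = 0"
    unfolding sylvester_mat_def sylvester_mat_sub_map[of h, OF h.hom_zero]
    by (rule resultant_common_root[of _ _ _ _ "[:m:]"])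
      (use assms in \<open>auto simp: ev degree_map_poly_le\<close>)
  finally show ?thesis by (simp add: h_def)
qed

text \<open>Coprime polynomials have a nonzero resultant in \<open>k[x][y]\<close>, and its degree
  in \<open>y\<close> bounds the number of its lines. The degree hypotheses are those that
  \<open>G\<close> and \<open>flow G\<close> still satisfy after cancelling their gcd. For
  \<open>degree G = 0\<close> the lines are roots of \<open>G\<close> itself.\<close>

lemma card_common_lines:
  fixes F G :: "'a::field_gcd poly poly poly"
  assumes "gcd G F = 1" "G \<noteq> 0" "degree F \<le> degree G + 1" "inner_degree F \<le> inner_degree G"
    and L: "\<And>m c. (m, c) \<in> L \<Longrightarrow> line_eval m c G = 0 \<and> line_eval m c F = 0"
  shows "card L \<le> inner_degree G * (2 * degree G + 1)"
proof (cases "degree G = 0")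
  case True
  then obtain g where g: "G = [:g:]" by (elim degree_eq_zeroE)
  have "card L \<le> degree g"
    using assms(2) L by (intro card_lines_le_degree) (auto simp: g line_eval_def)
  then show ?thesis using True degree_coeff_le_inner_degree[of G 0] by (simp add: g)
next
  case False
  have "resultant G F \<noteq> 0"
    using div_exp_Lazard_gcd.resultant_0_gcd[of G F] assms(1) by simp
  then have "card L \<le> degree (resultant G F)"
    using False L by (intro card_lines_le_degree resultant_on_common_line) auto
  also have "\<dots> \<le> degree F * inner_degree G + degree G * inner_degree F" by (rule degree_resultant_le)
  also have "\<dots> \<le> (degree G + 1) * inner_degree G + degree G * inner_degree G"
    using assms by (intro add_mono mult_mono) auto
  finally show ?thesis by (simp add: algebra_simps)
qed

lemma degree_flow_le: "degree (flow G) \<le> degree G + 1"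
  unfolding flow_def
  by (intro degree_add_le) (auto intro: order_trans[OF degree_mult_le] order_trans[OF degree_map_poly_le])

lemma inner_degree_flow_le: "inner_degree (flow G) \<le> inner_degree G"
proof (rule inner_degree_leI)
  fix j
  have d: "degree (pderiv (coeff G i)) \<le> inner_degree G" for i
    using degree_pderiv_le[of "coeff G i"] degree_coeff_le_inner_degree[of G i] by linarith
  have "degree (map_poly pderiv (coeff G j)) \<le> inner_degree G"
    by (meson degree_coeff_le_inner_degree degree_map_poly_le order_trans)
  moreover have "degree (coeff ([:0, 1:] * map_poly pderiv G) j) \<le> inner_degree G"
    by (cases j) (auto simp: coeff_map_poly d)
  ultimately show "degree (coeff (flow G) j) \<le> inner_degree G"
    by (auto simp: flow_def coeff_map_poly intro: degree_add_le)
qed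

text \<open>
  Let \<open>g = gcd G (flow G)\<close>.  The cofactors of \<open>g\<close> in \<open>G\<close> and in \<open>flow G\<close> are coprime and share few
  lines; all other lines of \<open>G\<close> are lines of \<open>g\<close>, and one descends from \<open>G\<close> to \<open>g\<close>.
\<close>

lemma flow_invariant_factor:
  fixes G :: "'a::field_gcd poly poly poly"
  assumes inf: "infinite (UNIV :: 'a set)" and "G \<noteq> 0" and fin: "finite L"
  shows "\<exists>H. H dvd G \<and> flow H = 0 \<and>
    card {(m, c) \<in> L. line_eval m c G = 0 \<and> line_eval m c H \<noteq> 0} \<le> inner_degree G * (2 * degree G + 1)"
  using \<open>G \<noteq> 0\<close>
proof (induction "size (prime_factorization G)" arbitrary: G rule: less_induct)
  case less
  show ?case
  proof (cases "flow G = 0")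
    case True
    then show ?thesis by (intro exI[of _ G]) simp
  next
    case False
    define g where "g = gcd G (flow G)"
    have "g \<noteq> 0" using less.prems by (simp add: g_def)
    from gcd_coprime_exists[of G "flow G", folded g_def, OF \<open>g \<noteq> 0\<close>, unfolded coprime_iff_gcd_eq_1]
    obtain G1 F1 where *: "G = G1 * g" "flow G = F1 * g" and cop: "gcd G1 F1 = 1"
      by (elim exE conjE)
    have G1: "G = g * G1" and F1: "flow G = g * F1"
      unfolding mult.commute[of g] by (rule *)+
    have nz: "G1 \<noteq> 0" "F1 \<noteq> 0" using less.prems False G1 F1 by auto
    \<comment> \<open>Here the descent makes progress: if \<open>G\<close> divided \<open>g\<close>,
      it would divide \<open>flow G\<close>, which would then be zero.\<close>
    have "\<not> G dvd g"
      using dvd_flow_imp_flow_eq_0[OF inf, of G] False F1 by (metis dvd_mult2)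
    then have "prime_factorization g \<subset># prime_factorization G"
      using \<open>g \<noteq> 0\<close> less.prems G1
      by (metis dvd_triv_left prime_factorization_subset_iff_dvd subset_mset.less_le_not_le)
    then have "size (prime_factorization g) < size (prime_factorization G)"
      by (rule mset_subset_size)
    from less.hyps[OF this \<open>g \<noteq> 0\<close>] obtain H where H: "H dvd g" "flow H = 0"
      and cH: "card {(m, c) \<in> L. line_eval m c g = 0 \<and> line_eval m c H \<noteq> 0}
          \<le> inner_degree g * (2 * degree g + 1)" by blast
    have dG: "degree G = degree g + degree G1" "inner_degree G = inner_degree g + inner_degree G1"
      using \<open>g \<noteq> 0\<close> nz by (simp_all add: G1 degree_mult_eq inner_degree_mult)
    have dF: "degree (flow G) = degree g + degree F1" "inner_degree (flow G) = inner_degree g + inner_degree F1"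
      using \<open>g \<noteq> 0\<close> nz by (simp_all add: F1 degree_mult_eq inner_degree_mult)
    let ?L1 = "{(m, c) \<in> L. line_eval m c G1 = 0 \<and> line_eval m c F1 = 0}"
    have "card ?L1 \<le> inner_degree G1 * (2 * degree G1 + 1)"
      using cop nz dG dF degree_flow_le[of G] inner_degree_flow_le[of G]
      by (intro card_common_lines) auto
    moreover have "{(m, c) \<in> L. line_eval m c G = 0 \<and> line_eval m c H \<noteq> 0}
        \<subseteq> {(m, c) \<in> L. line_eval m c g = 0 \<and> line_eval m c H \<noteq> 0} \<union> ?L1"
    proof clarify
      fix m c assume *: "(m, c) \<in> L" "line_eval m c G = 0" "line_eval m c H \<noteq> 0"
        "\<not> (line_eval m c G1 = 0 \<and> line_eval m c F1 = 0)"
      \<comment> \<open>\<open>G\<close> vanishes along the line, hence so does its derivative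
        \<open>flow G = g * F1\<close>.\<close>
      have "line_eval m c g * line_eval m c F1 = 0"
        using *(2) pderiv_line_eval[of m c G] unfolding F1 by (simp add: line_eval_mult)
      moreover have "line_eval m c g * line_eval m c G1 = 0"
        using *(2) unfolding G1 by (simp add: line_eval_mult)
      ultimately show "line_eval m c g = 0" using * by auto
    qed
    then have "card {(m, c) \<in> L. line_eval m c G = 0 \<and> line_eval m c H \<noteq> 0}
        \<le> card {(m, c) \<in> L. line_eval m c g = 0 \<and> line_eval m c H \<noteq> 0} + card ?L1"
      using fin by (intro order_trans[OF card_mono card_Un_le]) (auto intro: finite_subset[OF _ fin])
    \<comment> \<open>The bound is superadditive in the pair of degrees, so the losses of all steps
      of the descent together stay below the bound for the initial polynomial.\<close>
    moreover have "inner_degree g * (2 * degree g + 1) + inner_degree G1 * (2 * degree G1 + 1)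
        \<le> inner_degree G * (2 * degree G + 1)"
      by (simp add: dG algebra_simps)
    ultimately have "card {(m, c) \<in> L. line_eval m c G = 0 \<and> line_eval m c H \<noteq> 0}
        \<le> inner_degree G * (2 * degree G + 1)" using cH by linarith
    moreover have "H dvd G" using H G1 by auto
    ultimately show ?thesis using H by blast
  qed
qed

section \<open>Interpolation with multiplicities\<close>

lemma degree_coeff_poly_const_le:
  fixes G :: "'a::comm_ring_1 poly poly poly"
  assumes "\<And>j i. degree (coeff (coeff G j) i) \<le> d"
  shows "degree (coeff (poly G [:[:m:]:]) i) \<le> d"
proof -
  have "coeff (poly G [:[:m:]:]) i = (\<Sum>j\<le>degree G. coeff (coeff G j * [:[:m ^ j:]:]) i)"
    unfolding poly_altdef coeff_sum by (simp add: poly_const_pow)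
  also have "degree \<dots> \<le> d"
    by (rule degree_sum_le) (auto intro: order_trans[OF degree_smult_le] assms)
  finally show ?thesis .
qed

lemma degree_linear_power_le: "degree ([:a, b:] ^ n) \<le> n"
proof -
  have "degree ([:a, b:] ^ n) \<le> degree [:a, b:] * n" by (rule degree_power_le)
  also have "\<dots> \<le> 1 * n" by (intro mult_right_mono) auto
  finally show ?thesis by simp
qed

lemma degree_line_eval_le:
  assumes "inner_degree G \<le> e" "\<And>j i. degree (coeff (coeff G j) i) \<le> d"
  shows "degree (line_eval m c G) \<le> d + e"
proof -
  define q where "q = poly G [:[:m:]:]"
  have "degree q \<le> e"
    unfolding q_def using degree_poly_le_inner_degree[of G "[:m:]"] assms(1) by simp
  have "degree (coeff q i) \<le> d" for i
    unfolding q_def using assms(2) by (rule degree_coeff_poly_const_le)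
  moreover have "degree ([:c, m:] ^ i) \<le> i" for i by (rule degree_linear_power_le)
  ultimately have "degree (coeff q i) + degree ([:c, m:] ^ i) \<le> d + e" if "i \<le> degree q" for i
    using that \<open>degree q \<le> e\<close> by (meson add_mono le_trans)
  then have "degree (coeff q i * [:c, m:] ^ i) \<le> d + e" if "i \<le> degree q" for i
    using that degree_mult_le[of "coeff q i" "[:c, m:] ^ i"] by (meson le_trans)
  then show ?thesis
    unfolding line_eval_def q_def[symmetric] poly_altdef[of q] by (intro degree_sum_le) auto
qed

lemma power_dvd_of_shift:
  fixes p :: "'a::comm_ring_1 poly"
  assumes "\<And>i. i < k \<Longrightarrow> coeff (pcompose p [:a, 1:]) i = 0"
  shows "[:-a, 1:] ^ k dvd p"
proof -
  obtain r where "pcompose p [:a, 1:] = monom 1 k * r"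
    using assms monom_1_dvd_iff'[of k "pcompose p [:a, 1:]"] by (auto elim: dvdE)
  then have "pcompose (pcompose p [:a, 1:]) [:-a, 1:] = pcompose (monom 1 k) [:-a, 1:] * pcompose r [:-a, 1:]"
    by (simp add: pcompose_mult)
  moreover have "pcompose [:a, 1:] [:-a, 1:] = [:0, 1:]" by (simp add: pcompose_pCons)
  then have "pcompose (pcompose p [:a, 1:]) [:-a, 1:] = p"
    by (simp only: pcompose_assoc[symmetric] pcompose_idR)
  moreover have "pcompose (monom 1 k) [:-a, 1:] = [:-a, 1:] ^ k"
    by (simp add: pcompose_altdef map_poly_monom poly_monom one_pCons[symmetric])
  ultimately show ?thesis by (metis dvd_triv_left)
qed

text \<open>A point imposes \<open>k + (k + 1) + ... + (2 k - 1) = (3 k^2 - k) / 2\<close>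
  conditions, against \<open>k (d + 1)^2\<close> free coefficients in all; the term
  \<open>-k\<close> makes the inequality strict.\<close>

lemma card_vanishing_conditions:
  fixes P :: "'p set" assumes "finite P" "3 * card P * k \<le> 2 * (d + 1)^2" "0 < k"
  shows "card (P \<times> (SIGMA i:{..<k}. {..<i + k})) < k * (d + 1)^2"
proof -
  have "2 * (\<Sum>i<n. i + k) + n = n * n + 2 * k * n" for n by (induction n) auto
  from this[of k] have *: "2 * (\<Sum>i<k. i + k) + k = 3 * k * k" by simp
  have "2 * (card P * (\<Sum>i<k. i + k)) + card P * k = card P * (3 * k * k)"
    unfolding *[symmetric] by (simp add: algebra_simps)
  also have "\<dots> = k * (3 * card P * k)" by simp
  also have "\<dots> \<le> k * (2 * (d + 1)^2)" using assms by (intro mult_left_mono) auto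
  finally have "2 * (card P * (\<Sum>i<k. i + k)) + card P * k \<le> 2 * (k * (d + 1)^2)" by simp
  moreover have "card (P \<times> (SIGMA i:{..<k}. {..<i + k})) = card P * (\<Sum>i<k. i + k)"
    by (simp add: card_cartesian_product)
  moreover have "0 < card P * k \<or> card P * (\<Sum>i<k. i + k) = 0" using assms by (cases "card P = 0") auto
  moreover have "0 < k * (d + 1)^2" using assms by simp
  ultimately show ?thesis by linarith
qed

text \<open>
  The \<open>i\<close>-th Taylor coefficient at a point of \<open>P\<close> is a polynomial in \<open>m\<close> of degree less than \<open>i + k\<close>,
  so that its vanishing for all \<open>m\<close> amounts to \<open>i + k\<close> linear conditions on \<open>G\<close>.
\<close>

lemma exists_interpolant:
  fixes P :: "('a::field \<times> 'a) set"
  assumes fin: "finite P" and k: "0 < k" and dim: "3 * card P * k \<le> 2 * (d + 1)^2"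
  shows "\<exists>G. G \<noteq> 0 \<and> degree G < k \<and> inner_degree G \<le> d \<and>
    (\<forall>j b. degree (coeff (coeff G j) b) \<le> d) \<and>
    (\<forall>(x, y)\<in>P. \<forall>m. [:-x, 1:] ^ k dvd line_eval m (y - m * x) G)"
proof -
  define U :: "(nat \<times> nat \<times> nat) set" where "U = {..d} \<times> {..d} \<times> {..<k}"
  define W where "W = P \<times> (SIGMA i:{..<k}. {..<i + k})"
  \<comment> \<open>\<open>e y b v * m ^ v\<close> is the coefficient of \<open>t ^ v\<close> in
    \<open>(y + m t) ^ b\<close>. Thus \<open>M\<close> is the coefficient of \<open>m ^ w\<close>
    in the \<open>i\<close>-th Taylor coefficient of the monomial \<open>x^a y^b m^j\<close> at the
    point.\<close>
  define e where "e y b v = (if v \<le> b then of_nat (b choose v) * y ^ (b - v) else 0)" for y :: 'a and b v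
  define M where "M = (\<lambda>((x, y), i, w) (a, b, j).
    if j \<le> w \<and> w \<le> i + j then coeff ([:x, 1:] ^ a) (i - (w - j)) * e y b (w - j) else 0)"
  have "card U = k * (d + 1)^2"
    by (simp add: U_def card_cartesian_product power2_eq_square algebra_simps)
  then have "card W < card U"
    using card_vanishing_conditions[OF fin dim k] unfolding W_def by simp
  moreover have "finite W" "finite U" using fin by (auto simp: W_def U_def)
  ultimately obtain g u where u: "u \<in> U" "g u \<noteq> 0"
    and g: "\<And>w. w \<in> W \<Longrightarrow> (\<Sum>u\<in>U. M w u * g u) = 0"
    using homogeneous_system_solution[of W U M] by blast
  define G where "G = (\<Sum>j<k. monom (\<Sum>b\<le>d. monom (\<Sum>a\<le>d. monom (g (a, b, j)) a) b) j)"
  have cG: "coeff (coeff (coeff G j) b) a = (if j < k \<and> b \<le> d \<and> a \<le> d then g (a, b, j) else 0)" for a b j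
    by (simp add: G_def coeff_sum if_distrib[of "\<lambda>p. coeff p _"] sum.delta cong: if_cong)
  have "G \<noteq> 0" using u cG[of "snd (snd u)" "fst (snd u)" "fst u"] by (auto simp: U_def)
  have "degree G < k"
    using k cG by (intro degree_lessI) (auto simp: poly_eq_iff)
  have "degree (coeff G j) \<le> d" for j
    using cG by (intro degree_le) (auto simp: poly_eq_iff)
  then have "inner_degree G \<le> d" by (rule inner_degree_leI)
  have "degree (coeff (coeff G j) b) \<le> d" for j b
    using cG by (intro degree_le) (auto simp: poly_eq_iff)
  have ev: "line_eval m c G = (\<Sum>(a, b, j)\<in>U. smult (g (a, b, j) * m ^ j) ([:0, 1:] ^ a * [:c, m:] ^ b))" for m c
  proof -
    have "line_eval m c G = (\<Sum>j<k. \<Sum>b\<le>d. \<Sum>a\<le>d. smult (g (a, b, j) * m ^ j) ([:0, 1:] ^ a * [:c, m:] ^ b))"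
      unfolding line_eval_def G_def poly_sum poly_monom poly_mult sum_distrib_right
      by (intro sum.cong refl) (simp add: monom_altdef poly_const_pow mult_ac)
    also have "\<dots> = (\<Sum>(a, b, j)\<in>U. smult (g (a, b, j) * m ^ j) ([:0, 1:] ^ a * [:c, m:] ^ b))"
      unfolding U_def sum.cartesian_product[symmetric]
      by (subst sum.swap, subst (2) sum.swap, subst sum.swap, rule refl)
    finally show ?thesis .
  qed
  have "[:-x, 1:] ^ k dvd line_eval m (y - m * x) G" if p: "(x, y) \<in> P" for x y m
  proof (rule power_dvd_of_shift)
    fix i assume i: "i < k"
    \<comment> \<open>Moving the origin of the line to the point turns the intercept
      \<open>y - m * x\<close> into \<open>y\<close>.\<close>
    have "pcompose (line_eval m (y - m * x) G) [:x, 1:]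
      = (\<Sum>(a, b, j)\<in>U. smult (g (a, b, j) * m ^ j) ([:x, 1:] ^ a * [:y, m:] ^ b))"
      by (simp add: ev pcompose_sum pcompose_smult pcompose_mult pcompose_hom.hom_power pcompose_pCons split_def)
    then have "coeff (pcompose (line_eval m (y - m * x) G) [:x, 1:]) i
      = (\<Sum>(a, b, j)\<in>U. g (a, b, j) * (m ^ j * coeff ([:x, 1:] ^ a * [:y, m:] ^ b) i))"
      by (simp add: coeff_sum split_def mult_ac)
    also have "\<dots> = (\<Sum>u\<in>U. g u * (\<Sum>w<i + k. m ^ w * M ((x, y), i, w) u))"
    proof (intro sum.cong refl, clarify)
      fix a b j assume "(a, b, j) \<in> U"
      then have j: "j < k" by (simp add: U_def)
      have cy: "coeff ([:y, m:] ^ b) v = m ^ v * e y b v" for v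
      proof (cases "v \<le> b")
        case True
        then show ?thesis by (simp add: e_def coeff_linear_poly_power mult_ac)
      next
        case False
        moreover have "degree ([:y, m:] ^ b) \<le> b" by (rule degree_linear_power_le)
        ultimately show ?thesis by (simp add: e_def coeff_eq_0)
      qed
      have "(\<Sum>w<i + k. m ^ w * M ((x, y), i, w) (a, b, j))
        = (\<Sum>w\<in>{j..i + j}. m ^ w * (coeff ([:x, 1:] ^ a) (i - (w - j)) * e y b (w - j)))"
        using j by (intro sum.mono_neutral_cong_right) (auto simp: M_def)
      also have "\<dots> = (\<Sum>v\<le>i. m ^ (v + j) * (coeff ([:x, 1:] ^ a) (i - v) * e y b v))"
        by (rule sum.reindex_bij_witness[of _ "\<lambda>v. v + j" "\<lambda>w. w - j"]) auto
      also have "\<dots> = m ^ j * coeff ([:y, m:] ^ b * [:x, 1:] ^ a) i"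
        unfolding coeff_mult cy sum_distrib_left
        by (intro sum.cong refl) (simp add: power_add mult_ac)
      finally show "g (a, b, j) * (m ^ j * coeff ([:x, 1:] ^ a * [:y, m:] ^ b) i)
        = g (a, b, j) * (\<Sum>w<i + k. m ^ w * M ((x, y), i, w) (a, b, j))"
        by (simp add: mult.commute)
    qed
    also have "\<dots> = (\<Sum>w<i + k. m ^ w * (\<Sum>u\<in>U. M ((x, y), i, w) u * g u))"
      by (simp add: sum_distrib_left sum.swap[of _ _ U] mult_ac)
    also have "\<dots> = 0"
      using g p i by (intro sum.neutral) (auto simp: W_def)
    finally show "coeff (pcompose (line_eval m (y - m * x) G) [:x, 1:]) i = 0" .
  qed
  with \<open>G \<noteq> 0\<close> \<open>degree G < k\<close> \<open>inner_degree G \<le> d\<close>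
    \<open>\<And>j b. degree (coeff (coeff G j) b) \<le> d\<close>
  show ?thesis by (intro exI[of _ G]) auto
qed

section \<open>Points where an invariant polynomial vanishes for many slopes\<close>

lemma poly_poly_eq:
  fixes q :: "'a::comm_ring_1 poly poly"
  assumes "poly Y x = poly Z x"
  shows "poly (poly q Y) x = poly (poly q Z) x"
  using assms by (induction q) auto

text \<open>The composition is the shear that replaces \<open>y\<close> by \<open>y + m x\<close>;
  each factor \<open>y\<close> raises the degree in \<open>x\<close> by at most one.\<close>

lemma inner_degree_shear_le:
  fixes q :: "'a::comm_ring_1 poly poly"
  assumes "\<And>i. degree (coeff q i) \<le> d"
  shows "inner_degree (pcompose q [:[:0, m:], 1:]) \<le> d + degree q"
  using assms
proof (induction q)
  case 0
  then show ?case by (simp add: inner_degree_def)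
next
  case (pCons a q)
  have a: "inner_degree [:a:] \<le> d"
    using pCons.prems[of 0] by (intro inner_degree_leI) (simp add: coeff_pCons split: nat.split)
  show ?case
  proof (cases "q = 0")
    case True
    then show ?thesis using a by simp
  next
    case False
    have "inner_degree [:[:0, m:], 1:] \<le> 1"
      by (rule inner_degree_leI) (simp add: coeff_pCons split: nat.split)
    moreover have "inner_degree (pcompose q [:[:0, m:], 1:]) \<le> d + degree q"
      using pCons.prems[of "Suc _"] by (intro pCons.IH) simp
    ultimately have "inner_degree ([:[:0, m:], 1:] * pcompose q [:[:0, m:], 1:]) \<le> d + degree (pCons a q)"
      using inner_degree_mult_le[of "[:[:0, m:], 1:]" "pcompose q [:[:0, m:], 1:]"] False by simp
    then show ?thesis
      unfolding pcompose_pCons using a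
      by (intro order_trans[OF inner_degree_add_le]) simp
  qed
qed

text \<open>A shear makes the lines of slope \<open>m\<close> horizontal, so that the degree along
  them is at most the degree in \<open>x\<close>. That degree is additive, so a factor cannot exceed
  the product, provided that \<open>G\<close> does not vanish at the slope \<open>m\<close>.\<close>

lemma degree_line_eval_factor_le:
  fixes G H :: "'a::field poly poly poly"
  assumes "inner_degree G \<le> e" "\<And>j i. degree (coeff (coeff G j) i) \<le> d"
    and "H dvd G" "poly G [:[:m:]:] \<noteq> 0"
  shows "degree (line_eval m c H) \<le> d + e"
proof -
  let ?T = "\<lambda>q. pcompose q [:[:0, m:], 1:]"
  obtain R where R: "G = H * R" using assms(3) unfolding dvd_def by blast
  let ?q = "poly H [:[:m:]:]" and ?r = "poly R [:[:m:]:]"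
  have G: "poly G [:[:m:]:] = ?q * ?r" by (simp add: R)
  then have "?T ?q \<noteq> 0" "?T ?r \<noteq> 0"
    using assms(4) by (auto simp: pcompose_eq_0_iff)
  have "poly ?q [:c, m:] = poly (?T ?q) [:c:]" by (simp add: poly_pcompose)
  then have "degree (line_eval m c H) \<le> inner_degree (?T ?q)"
    unfolding line_eval_def using degree_poly_le_inner_degree[of "?T ?q" c] by simp
  also have "\<dots> \<le> inner_degree (?T ?q * ?T ?r)"
    using \<open>?T ?q \<noteq> 0\<close> \<open>?T ?r \<noteq> 0\<close> by (simp add: inner_degree_mult)
  also have "?T ?q * ?T ?r = ?T (poly G [:[:m:]:])" by (simp add: G pcompose_mult)
  also have "inner_degree \<dots> \<le> d + degree (poly G [:[:m:]:])"
    by (intro inner_degree_shear_le degree_coeff_poly_const_le assms)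
  also have "\<dots> \<le> d + e"
    using degree_poly_le_inner_degree[of G "[:m:]"] assms(1) by simp
  finally show ?thesis .
qed

lemma pderiv_eq_0_imp_constant:
  fixes p :: "'a::idom poly"
  assumes "pderiv p = 0" "degree p \<le> n" "\<And>i. 0 < i \<Longrightarrow> i \<le> n \<Longrightarrow> of_nat i \<noteq> (0::'a)"
  shows "degree p = 0"
proof (rule ccontr)
  assume d: "degree p \<noteq> 0"
  have "of_nat (degree p) * lead_coeff p = coeff (pderiv p) (degree p - 1)"
    using d by (simp add: coeff_pderiv)
  then have "of_nat (degree p) = (0::'a)" using assms(1) d by auto
  then show False using assms d by auto
qed

text \<open>
  A \<open>flow\<close>-invariant \<open>H\<close> is constant along lines.  At a point of \<open>V\<close> it vanishes for at least \<open>k\<close>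
  slopes, hence for all of them, and so along every line through the point.  For a generic slope the
  points of \<open>V\<close> lie on distinct lines.
\<close>

lemma card_heavy_points:
  fixes G H :: "'a::field poly poly poly"
  assumes inf: "infinite (UNIV :: 'a set)" and G: "G \<noteq> 0" "degree G < k" "inner_degree G \<le> d"
    "\<And>j i. degree (coeff (coeff G j) i) \<le> d"
    and H: "H dvd G" "flow H = 0" and char: "\<And>i. 0 < i \<Longrightarrow> i \<le> 2 * d \<Longrightarrow> of_nat i \<noteq> (0::'a)"
    and fin: "finite V"
    and V: "\<And>x y. (x, y) \<in> V \<Longrightarrow> \<exists>S. k \<le> card S \<and> (\<forall>m\<in>S. line_eval m (y - m * x) H = 0)"
  shows "card V \<le> d"
proof -
  have "H \<noteq> 0" using G H by auto
  define B where "B = (\<lambda>((x, y), (x', y')). (y - y') / (x - x')) ` (V \<times> V)"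
  have "finite {q. poly G q = 0}" using G by (simp add: poly_roots_finite)
  then have "finite ((\<lambda>m. [:[:m:]:]) -` {q. poly G q = 0})"
    by (rule finite_vimageI) (simp add: inj_on_def)
  moreover have "finite B" using fin by (simp add: B_def)
  \<comment> \<open>The slope avoids the finitely many zeros of \<open>G\<close> in the slope
    variable and all slopes of joins of two points of \<open>V\<close>.\<close>
  ultimately obtain m where m: "poly G [:[:m:]:] \<noteq> 0" "m \<notin> B"
    using inf ex_new_if_finite[of "(\<lambda>m. [:[:m:]:]) -` {q. poly G q = 0} \<union> B"] by auto
  have "line_eval m (y - m * x) H = 0" if p: "(x, y) \<in> V" for x y
  proof -
    \<comment> \<open>Evaluation at the point leaves a polynomial in the slope, of degree less than
      \<open>k\<close>; by \<open>ev\<close> its value at \<open>m'\<close> is that of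
      \<open>H\<close> at the point along the line of slope \<open>m'\<close>.\<close>
    define f where "f = (\<lambda>q. poly (poly q [:y:]) x)"
    interpret f: comm_ring_hom f by unfold_locales (simp_all add: f_def)
    have ev: "poly (map_poly f H) m' = poly (line_eval m' (y - m' * x) H) x" for m'
    proof -
      have "poly (map_poly f H) (f [:[:m':]:]) = f (poly H [:[:m':]:])" by (rule f.poly_map_poly)
      also have "\<dots> = poly (poly (poly H [:[:m':]:]) [:y - m' * x, m':]) x"
        unfolding f_def by (rule poly_poly_eq) (simp add: algebra_simps)
      finally show ?thesis by (simp add: f_def line_eval_def)
    qed
    have "map_poly f H = 0"
    proof (rule ccontr)
      assume nz: "map_poly f H \<noteq> 0"
      obtain S where kS: "k \<le> card S" and S: "\<forall>m\<in>S. line_eval m (y - m * x) H = 0" using V[OF p] by blast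
      have "k \<le> card S" by (rule kS)
      also have "\<dots> \<le> card {m. poly (map_poly f H) m = 0}"
        using poly_roots_finite[OF nz] S by (intro card_mono) (auto simp: ev)
      also have "\<dots> \<le> degree (map_poly f H)" by (rule card_poly_roots_bound[OF nz])
      also have "\<dots> \<le> degree H" by (rule degree_map_poly_le)
      also have "\<dots> \<le> degree G" using G H by (intro dvd_imp_degree_le) auto
      finally show False using G by simp
    qed
    then have "poly (line_eval m (y - m * x) H) x = 0" by (simp flip: ev)
    moreover have "degree (line_eval m (y - m * x) H) = 0"
    proof (rule pderiv_eq_0_imp_constant)
      show "pderiv (line_eval m (y - m * x) H) = 0"
        unfolding pderiv_line_eval H(2) by (simp add: line_eval_def)
      show "degree (line_eval m (y - m * x) H) \<le> 2 * d"
        using degree_line_eval_factor_le[OF G(3,4) H(1) m(1), of "y - m * x"] by (simp add: mult_2)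
    qed (rule char)
    ultimately show ?thesis by (elim degree_eq_zeroE) simp
  qed
  then have "card ((\<lambda>(x, y). (m, y - m * x)) ` V) \<le> degree (poly H [:[:m:]:])"
    using m H(1) by (intro card_lines_le_degree) (auto simp: line_eval_def)
  moreover have "inj_on (\<lambda>(x, y). (m, y - m * x)) V"
  proof (rule inj_onI, clarify)
    fix x y x' y'
    assume *: "(x, y) \<in> V" "(x', y') \<in> V" "y - m * x = y' - m * x'"
    have "x = x'"
    proof (rule ccontr)
      assume "x \<noteq> x'"
      with * have "m = (y - y') / (x - x')" by (simp add: field_simps)
      then have "m \<in> B" using * unfolding B_def by (intro image_eqI[of _ _ "((x, y), (x', y'))"]) auto
      then show False using m by simp
    qed
    then show "x = x' \<and> y = y'" using * by simp
  qed
  ultimately have "card V \<le> degree (poly H [:[:m:]:])" by (simp add: card_image)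
  also have "\<dots> \<le> degree (poly G [:[:m:]:])"
    using m H(1) by (intro dvd_imp_degree_le) auto
  also have "\<dots> \<le> d" using degree_poly_le_inner_degree[of G "[:m:]"] G(3) by simp
  finally show ?thesis .
qed

section \<open>Rich lines\<close>

definition on_line :: "('a::comm_ring_1 \<times> 'a) set \<Rightarrow> 'a \<times> 'a \<Rightarrow> ('a \<times> 'a) set" where
  "on_line P l = {p \<in> P. snd p = fst l * fst p + snd l}"

lemma on_line_subset: "on_line P l \<subseteq> P"
  by (auto simp: on_line_def)

lemma finite_on_line: "finite P \<Longrightarrow> finite (on_line P l)"
  by (simp add: on_line_def)

lemma two_points_determine_line:
  fixes l l' :: "'a::idom \<times> 'a"
  assumes "p \<in> on_line P l" "q \<in> on_line P l" "p \<in> on_line P l'" "q \<in> on_line P l'" "p \<noteq> q"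
  shows "l = l'"
proof -
  obtain m c m' c' x y x' y' where [simp]: "l = (m, c)" "l' = (m', c')" "p = (x, y)" "q = (x', y')"
    by (metis surj_pair)
  have eqs: "y = m * x + c" "y' = m * x' + c" "y = m' * x + c'" "y' = m' * x' + c'"
    using assms by (auto simp: on_line_def)
  have "x \<noteq> x'" using assms(5) eqs by auto
  have "(m - m') * (x - x') = (m * x + c) - (m * x' + c) - ((m' * x + c') - (m' * x' + c'))"
    by (simp add: algebra_simps)
  also have "\<dots> = 0" using eqs by simp
  finally have "(m - m') * (x - x') = 0" .
  then have "m = m'" using \<open>x \<noteq> x'\<close> by simp
  with eqs show ?thesis by simp
qed

lemma card_on_line_Int_le:
  fixes P :: "('a::idom \<times> 'a) set"
  assumes "l \<noteq> l'"
  shows "card (on_line P l \<inter> on_line P l') \<le> 1"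
proof -
  have "p = q" if "p \<in> on_line P l \<inter> on_line P l'" "q \<in> on_line P l \<inter> on_line P l'" for p q
    using two_points_determine_line[of p P l q l'] assms that by auto
  then show ?thesis
    by (cases "finite (on_line P l \<inter> on_line P l')") (auto simp: card_le_Suc0_iff_eq)
qed

text \<open>The \<open>i\<close>-th line meets each of the \<open>i - 1\<close> lines before it in
  at most one point, hence adds at least \<open>s - (i - 1)\<close> points; the inequality is twice
  the sum of these.\<close>

lemma card_union_of_rich_lines:
  fixes P :: "('a::idom \<times> 'a) set"
  assumes "finite L" "finite P" "\<And>l. l \<in> L \<Longrightarrow> s \<le> card (on_line P l)"
  shows "2 * card L * s + card L \<le> 2 * card (\<Union>l\<in>L. on_line P l) + card L * card L"
  using assms(1,3)
proof (induction L rule: finite_induct)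
  case (insert l L)
  let ?U = "\<Union>l\<in>L. on_line P l"
  have fin: "finite ?U" using insert assms by (auto simp: finite_on_line)
  have "card (on_line P l \<inter> ?U) \<le> (\<Sum>l'\<in>L. card (on_line P l \<inter> on_line P l'))"
    using card_UN_le[OF insert.hyps(1), of "\<lambda>l'. on_line P l \<inter> on_line P l'"] unfolding Int_UN_distrib .
  also have "\<dots> \<le> (\<Sum>l'\<in>L. 1)"
    using insert.hyps by (intro sum_mono card_on_line_Int_le) auto
  finally have "card (on_line P l \<inter> ?U) \<le> card L" by simp
  moreover have "card (on_line P l \<union> ?U) + card (on_line P l \<inter> ?U) = card (on_line P l) + card ?U"
    using fin by (intro card_Un_Int[symmetric]) (auto simp: assms finite_on_line)
  moreover have "s \<le> card (on_line P l)" using insert.prems by simp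
  ultimately have "s + card ?U \<le> card (on_line P l \<union> ?U) + card L" by linarith
  then have "2 * s + (2 * card L * s + card L) \<le> 2 * card (on_line P l \<union> ?U) + 2 * card L + card L * card L"
    using insert by simp
  then show ?case using insert.hyps by (simp add: algebra_simps)
qed simp

text \<open>Two distinct points lie on at most one line, so the sets of ordered pairs of distinct
  points on a line are disjoint; a line with \<open>r\<close> points has at least
  \<open>r - 1\<close> such pairs.\<close>

lemma sum_card_on_line_le:
  fixes V :: "('a::idom \<times> 'a) set"
  assumes "finite L" "finite V"
  shows "(\<Sum>l\<in>L. card (on_line V l)) \<le> card L + card V ^ 2"
proof -
  define pairs where "pairs l = on_line V l \<times> on_line V l - Id" for l
  have "card (on_line V l) \<le> 1 + card (pairs l)" for l
  proof -
    have fin: "finite (on_line V l)" using assms by (simp add: finite_on_line)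
    have "card (on_line V l \<times> on_line V l) \<le> card (pairs l) + card (Id_on (on_line V l))"
      using fin by (intro order_trans[OF card_mono card_Un_le]) (auto simp: pairs_def Id_on_def)
    also have "card (Id_on (on_line V l)) \<le> card (on_line V l)"
      using fin card_image_le[of "on_line V l" "\<lambda>x. (x, x)"] by (simp add: Id_on_def UNION_singleton_eq_range)
    finally have "card (on_line V l) * card (on_line V l) \<le> card (pairs l) + card (on_line V l)"
      by (simp add: card_cartesian_product)
    then show ?thesis
      using mult_le_mono1[of 2 "card (on_line V l)" "card (on_line V l)"]
      by (cases "card (on_line V l) \<le> 1") linarith+
  qed
  then have "(\<Sum>l\<in>L. card (on_line V l)) \<le> (\<Sum>l\<in>L. 1 + card (pairs l))" by (rule sum_mono)
  also have "\<dots> = card L + (\<Sum>l\<in>L. card (pairs l))" unfolding sum.distrib by simp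
  also have "(\<Sum>l\<in>L. card (pairs l)) = card (\<Union>l\<in>L. pairs l)"
  proof (rule card_UN_disjoint[symmetric])
    show "\<forall>l\<in>L. \<forall>l'\<in>L. l \<noteq> l' \<longrightarrow> pairs l \<inter> pairs l' = {}"
    proof (intro ballI impI)
      fix l l' :: "'a \<times> 'a" assume "l \<noteq> l'"
      have "l = l'" if "z \<in> pairs l" "z \<in> pairs l'" for z
        using that two_points_determine_line[of "fst z" V l "snd z" l']
        unfolding pairs_def by (cases z) simp
      with \<open>l \<noteq> l'\<close> show "pairs l \<inter> pairs l' = {}" by auto
    qed
  qed (auto simp: assms pairs_def finite_on_line)
  also have "\<dots> \<le> card (V \<times> V)"
    using assms on_line_subset[of V] by (intro card_mono) (auto simp: pairs_def)
  finally show ?thesis by (simp add: card_cartesian_product power2_eq_square)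
qed

text \<open>Otherwise take only \<open>n\<close> lines, where \<open>n\<close> is the first number
  with \<open>n * s > 2 * card P\<close>. Then \<open>n\<close> is at most about
  \<open>s / 3\<close>, the lines overlap little, and their union would exceed
  \<open>P\<close>.\<close>

lemma rich_lines_few_points:
  fixes P :: "('a::idom \<times> 'a) set"
  assumes "finite L" "finite P" "\<And>l. l \<in> L \<Longrightarrow> s \<le> card (on_line P l)" "6 * card P < s ^ 2"
  shows "card L * s \<le> 2 * card P"
proof (rule ccontr)
  assume *: "\<not> card L * s \<le> 2 * card P"
  have s: "0 < s" using assms(4) by (cases "s = 0") auto
  define n where "n = 2 * card P div s + 1"
  have "2 * card P div s < card L" using * s by (simp add: div_less_iff_less_mult)
  then have "n \<le> card L" by (simp add: n_def)
  then obtain L' where L': "L' \<subseteq> L" "card L' = n" "finite L'"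
    using obtain_subset_with_card_n by metis
  have "2 * n * s + n \<le> 2 * card (\<Union>l\<in>L'. on_line P l) + n * n"
    using card_union_of_rich_lines[of L' P s] L' assms by auto
  moreover have "card (\<Union>l\<in>L'. on_line P l) \<le> card P"
    using assms on_line_subset[of P] by (intro card_mono UN_least) auto
  ultimately have 1: "2 * n * s + n \<le> 2 * card P + n * n" by linarith
  have 2: "2 * card P < n * s" unfolding n_def using dividend_less_div_times[OF s, of "2 * card P"] by simp
  have 3: "(n - 1) * s \<le> 2 * card P" unfolding n_def by simp
  define T where "T = real (card P)"
  have r1: "2 * real n * s + n \<le> 2 * T + real n * n" using of_nat_mono[OF 1, where 'a = real] by (simp add: T_def)
  have r2: "2 * T < n * s" using of_nat_less_iff[where 'a = real, THEN iffD2, OF 2] by (simp add: T_def)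
  have r3: "(real n - 1) * s \<le> 2 * T" using of_nat_mono[OF 3, where 'a = real] by (simp add: T_def n_def)
  have r4: "6 * T < real s ^ 2" using of_nat_less_iff[where 'a = real, THEN iffD2, OF assms(4)] by (simp add: T_def)
  have sp: "real s > 0" using s by simp
  have "(real n * (2 * real s + 1 - real n)) * s \<le> 2 * T * s"
    using r1 sp by (intro mult_right_mono) (auto simp: algebra_simps)
  moreover have "real n * ((2 * real s + 1 - real n) * s) \<ge> real n * (2 * real s ^ 2 - 2 * T)"
    using r3 by (intro mult_left_mono) (auto simp: algebra_simps power2_eq_square)
  moreover have "real n * (2 * real s ^ 2 - 2 * T) \<ge> real n * (5 / 3 * real s ^ 2)"
    using r4 by (intro mult_left_mono) auto
  ultimately have "(real n * s * (5 / 3)) * s \<le> (2 * T) * s" by (simp add: power2_eq_square algebra_simps)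
  then have "real n * s * (5 / 3) \<le> 2 * T" using sp by (rule mult_right_le_imp_le)
  moreover have "0 \<le> real n * real s" "2 * T < real n * real s" using r2 by simp_all
  ultimately show False by linarith
qed

text \<open>Lines through a common point are determined by their slopes;
  \<open>card_heavy_points\<close> needs slopes, as zeros in the variable \<open>m\<close>.\<close>

lemma card_lines_through_point:
  fixes L :: "('a::comm_ring_1 \<times> 'a) set"
  assumes "finite L"
  shows "card {l \<in> L. p \<in> on_line P l} \<le> card (fst ` {l \<in> L. p \<in> on_line P l})"
  by (subst card_image) (auto simp: inj_on_def on_line_def algebra_simps)

text \<open>With \<open>k\<close> about \<open>card P / s^2\<close> and \<open>d\<close> about
  \<open>s k / 2\<close>, the interpolation is solvable and \<open>s\<close> zeros of order
  \<open>k\<close> on a line exceed the degree \<open>2 d\<close>. About \<open>d k\<close>, that is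
  \<open>card P ^ 2 / s ^ 3\<close>, lines are lost on passing to \<open>H\<close>.\<close>

lemma rich_lines_many_points:
  fixes P L :: "('a::field_gcd \<times> 'a) set"
  assumes inf: "infinite (UNIV :: 'a set)" and fin: "finite P" "finite L" and s: "2 \<le> s"
    and rich: "\<And>l. l \<in> L \<Longrightarrow> s \<le> card (on_line P l)"
    and char: "\<And>i. 0 < i \<Longrightarrow> i * s \<le> 12 * card P \<Longrightarrow> of_nat i \<noteq> (0::'a)"
    and few: "s ^ 2 \<le> 6 * card P"
  shows "card L * s ^ 3 \<le> 240 * card P ^ 2"
proof -
  define T where "T = card P"
  \<comment> \<open>\<open>k s^2\<close> lies between \<open>6 T\<close> and \<open>12 T\<close>,
    the upper bound by \<open>few\<close>; \<open>d\<close> is the largest number with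
    \<open>2 d < s k\<close>.\<close>
  define k where "k = 6 * T div s ^ 2 + 1"
  define d where "d = (s * k - 1) div 2"
  have s0: "0 < s" using s by simp
  have k1: "k * s ^ 2 \<le> 12 * T"
  proof -
    have "6 * T div s ^ 2 * s ^ 2 \<le> 6 * T" by simp
    then show ?thesis using few unfolding k_def T_def add_mult_distrib by linarith
  qed
  have k2: "6 * T \<le> k * s ^ 2"
    using dividend_less_div_times[of "s ^ 2" "6 * T"] s0 by (simp add: k_def)
  have k0: "0 < k" by (simp add: k_def)
  have d1: "2 * d < s * k" and d2: "s * k \<le> 2 * (d + 1)"
  proof -
    have "0 < s * k" using s0 k0 by simp
    then show "2 * d < s * k" "s * k \<le> 2 * (d + 1)" unfolding d_def by presburger+
  qed
  have "6 * T * k \<le> (k * s ^ 2) * k" using k2 by simp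
  also have "\<dots> = (s * k) ^ 2" by (simp add: power2_eq_square)
  also have "\<dots> \<le> (2 * (d + 1)) ^ 2" using d2 by (rule power_mono) simp
  also have "\<dots> = 4 * (d + 1) ^ 2" by (simp only: power_mult_distrib) simp
  finally have "3 * T * k \<le> 2 * (d + 1) ^ 2" by linarith
  from exists_interpolant[OF fin(1) k0 this[unfolded T_def]]
  obtain G where G: "G \<noteq> 0" "degree G < k" "inner_degree G \<le> d"
    "\<And>j b. degree (coeff (coeff G j) b) \<le> d"
    and Gdvd: "\<And>x y m. (x, y) \<in> P \<Longrightarrow> [:-x, 1:] ^ k dvd line_eval m (y - m * x) G"
    by blast
  have G0: "line_eval m c G = 0" if l: "(m, c) \<in> L" for m c
  proof (rule ccontr)
    assume nz: "line_eval m c G \<noteq> 0"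
    let ?Xs = "fst ` on_line P (m, c)"
    have finX: "finite ?Xs" using fin by (simp add: finite_on_line)
    have ord: "k \<le> order x (line_eval m c G)" if x: "x \<in> ?Xs" for x
    proof -
      obtain y where y: "(x, y) \<in> P" "c = y - m * x" using x by (auto simp: on_line_def)
      show ?thesis using order_max[OF Gdvd[OF y(1), of m]] nz unfolding y(2) by blast
    qed
    have "card ?Xs * k \<le> (\<Sum>x\<in>?Xs. order x (line_eval m c G))"
      using sum_mono[of ?Xs "\<lambda>_. k", OF ord] by simp
    also have "\<dots> \<le> (\<Sum>x | poly (line_eval m c G) x = 0. order x (line_eval m c G))"
      using ord k0 by (intro sum_mono2 poly_roots_finite[OF nz]) (force simp: order_root nz)+
    also have "\<dots> \<le> degree (line_eval m c G)" by (rule sum_order_le_degree[OF nz])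
    also have "\<dots> \<le> 2 * d" using degree_line_eval_le[OF G(3,4)] by (simp add: mult_2)
    also have "card ?Xs = card (on_line P (m, c))"
      by (rule card_image) (auto simp: inj_on_def on_line_def)
    finally have "card (on_line P (m, c)) * k \<le> 2 * d" .
    moreover have "s * k \<le> card (on_line P (m, c)) * k" using rich[OF l] by simp
    ultimately show False using d1 by linarith
  qed
  obtain H where H: "H dvd G" "flow H = 0"
    and cH: "card {(m, c) \<in> L. line_eval m c G = 0 \<and> line_eval m c H \<noteq> 0} \<le> inner_degree G * (2 * degree G + 1)"
    using flow_invariant_factor[OF inf G(1) fin(2)] by blast
  define L0 where "L0 = {(m, c) \<in> L. line_eval m c H \<noteq> 0}"
  define L1 where "L1 = {(m, c) \<in> L. line_eval m c H = 0}"
  have "L = L0 \<union> L1" "L0 \<inter> L1 = {}" by (auto simp: L0_def L1_def)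
  then have cL: "card L = card L0 + card L1" using fin by (metis card_Un_disjoint finite_Un)
  have finL1: "finite L1" using fin unfolding L1_def by (auto intro: finite_subset)
  have "L0 = {(m, c) \<in> L. line_eval m c G = 0 \<and> line_eval m c H \<noteq> 0}" using G0 by (auto simp: L0_def)
  then have "card L0 \<le> inner_degree G * (2 * degree G + 1)" using cH by simp
  also have "\<dots> \<le> d * (2 * k)" using G by (intro mult_mono) auto
  also have "\<dots> = 2 * d * k" by (simp only: ac_simps)
  also have "\<dots> \<le> s * k * k" using d1 by (intro mult_right_mono) auto
  finally have "card L0 * s ^ 3 \<le> s * k * k * s ^ 3" by simp
  also have "\<dots> = (k * s ^ 2) ^ 2" by (simp add: power2_eq_square power3_eq_cube)
  also have "\<dots> \<le> (12 * T) ^ 2" using k1 by (rule power_mono) simp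
  finally have L0: "card L0 * s ^ 3 \<le> 144 * T ^ 2" by (simp add: power_mult_distrib)

  \<comment> \<open>Points on fewer than \<open>k\<close> lines of \<open>L1\<close> give at most
    \<open>T k\<close> incidences. The others are at most \<open>d\<close> in number, and their
    incidences are bounded through pairs of points.\<close>
  define V where "V = {p \<in> P. k \<le> card {l \<in> L1. p \<in> on_line P l}}"
  have finV: "finite V" using fin by (simp add: V_def)
  have "card V \<le> d"
  proof (rule card_heavy_points[OF inf G H _ finV])
    fix i assume i: "0 < i" "i \<le> 2 * d"
    have "i * s \<le> 2 * d * s" using i by simp
    also have "\<dots> \<le> s * k * s" using d1 by simp
    also have "\<dots> \<le> 12 * card P" using k1 by (simp add: T_def power2_eq_square algebra_simps)
    finally show "of_nat i \<noteq> (0::'a)" using char i by blast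
  next
    fix x y assume V: "(x, y) \<in> V"
    let ?S = "{l \<in> L1. (x, y) \<in> on_line P l}"
    have "k \<le> card ?S" using V by (simp add: V_def)
    also have "\<dots> \<le> card (fst ` ?S)" by (rule card_lines_through_point[OF finL1])
    finally show "\<exists>S. k \<le> card S \<and> (\<forall>m\<in>S. line_eval m (y - m * x) H = 0)"
      by (intro exI[of _ "fst ` ?S"]) (auto simp: L1_def on_line_def)
  qed
  have "card L1 * s \<le> (\<Sum>l\<in>L1. card (on_line P l))"
    using sum_mono[of L1 "\<lambda>_. s" "\<lambda>l. card (on_line P l)"] rich by (auto simp: L1_def)
  also have "\<dots> \<le> (\<Sum>l\<in>L1. card (on_line V l) + card {p \<in> P - V. p \<in> on_line P l})"
  proof (rule sum_mono)
    fix l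
    have "on_line P l \<subseteq> on_line V l \<union> {p \<in> P - V. p \<in> on_line P l}" by (auto simp: on_line_def)
    then show "card (on_line P l) \<le> card (on_line V l) + card {p \<in> P - V. p \<in> on_line P l}"
      using fin finV by (intro order_trans[OF card_mono card_Un_le]) (auto simp: finite_on_line)
  qed
  also have "\<dots> = (\<Sum>l\<in>L1. card (on_line V l)) + (\<Sum>l\<in>L1. card {p \<in> P - V. p \<in> on_line P l})"
    by (rule sum.distrib)
  also have "(\<Sum>l\<in>L1. card {p \<in> P - V. p \<in> on_line P l}) = (\<Sum>p\<in>P - V. card {l \<in> L1. p \<in> on_line P l})"
    using fin finL1 by (intro sum_multicount_gen) auto
  also have "\<dots> \<le> (\<Sum>p\<in>P - V. k)"
    by (rule sum_mono) (auto simp: V_def)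
  also have "\<dots> \<le> T * k" using fin by (simp add: T_def card_mono)
  also have "(\<Sum>l\<in>L1. card (on_line V l)) \<le> card L1 + card V ^ 2"
    by (rule sum_card_on_line_le[OF finL1 finV])
  also have "card V ^ 2 \<le> d ^ 2" using \<open>card V \<le> d\<close> by (rule power_mono) simp
  finally have "card L1 * s \<le> card L1 + d ^ 2 + T * k" by simp
  moreover have "2 * card L1 \<le> card L1 * s" using s by simp
  ultimately have "2 * (card L1 * s) \<le> 2 * card L1 + 2 * d ^ 2 + 2 * (T * k)" "2 * card L1 \<le> card L1 * s" by simp_all
  then have "card L1 * s \<le> 2 * d ^ 2 + 2 * (T * k)" by linarith
  then have "card L1 * s * s ^ 2 \<le> (2 * d ^ 2 + 2 * (T * k)) * s ^ 2" by (rule mult_right_mono) simp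
  then have "2 * (card L1 * s ^ 3) \<le> (2 * d) ^ 2 * s ^ 2 + 4 * T * (k * s ^ 2)"
    by (simp add: power3_eq_cube power2_eq_square algebra_simps)
  moreover have "(2 * d) ^ 2 * s ^ 2 \<le> (s * k) ^ 2 * s ^ 2"
    using d1 by (intro mult_right_mono power_mono) auto
  moreover have "(s * k) ^ 2 * s ^ 2 = (k * s ^ 2) ^ 2" by (simp add: power2_eq_square)
  moreover have "(k * s ^ 2) ^ 2 \<le> 144 * T ^ 2"
    using power_mono[OF k1, of 2] by (simp add: power_mult_distrib)
  moreover have "4 * T * (k * s ^ 2) \<le> 48 * T ^ 2"
    using mult_left_mono[OF k1, of "4 * T"] by (simp add: power2_eq_square)
  ultimately have "card L1 * s ^ 3 \<le> 96 * T ^ 2" by linarith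
  with L0 have "(card L0 + card L1) * s ^ 3 \<le> 240 * T ^ 2" unfolding add_mult_distrib by linarith
  then show ?thesis unfolding cL T_def .
qed

text \<open>The second term covers \<open>s^2 > 6 * card P\<close>, where inclusion-exclusion
  suffices; the first is the polynomial bound over an extension of the field.\<close>

lemma rich_lines:
  fixes P L :: "('a::field \<times> 'a) set"
  assumes fin: "finite P" "finite L" and s: "2 \<le> s"
    and rich: "\<And>l. l \<in> L \<Longrightarrow> s \<le> card (on_line P l)"
    and char: "\<And>i. 0 < i \<Longrightarrow> i * s \<le> 12 * card P \<Longrightarrow> of_nat i \<noteq> (0::'a)"
  shows "card L * s ^ 3 \<le> 240 * card P ^ 2 + 2 * card P * s ^ 2"
proof (cases "s ^ 2 \<le> 6 * card P")
  case False
  then have "card L * s \<le> 2 * card P"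
    using rich_lines_few_points[OF fin(2,1) rich] by simp
  then have "card L * s * s ^ 2 \<le> 2 * card P * s ^ 2" by (rule mult_right_mono) simp
  also have "card L * s * s ^ 2 = card L * s ^ 3" by (simp add: power3_eq_cube power2_eq_square)
  finally show ?thesis by simp
next
  case True
  \<comment> \<open>The larger field is infinite, and it has the class \<open>field_gcd\<close> which polynomial gcds require.\<close>
  define e :: "'a \<Rightarrow> 'a poly fract" where "e x = to_fract [:x:]" for x
  define E where "E = map_prod e e"
  have e_add: "e (x + y) = e x + e y" for x y
    using to_fract_hom.hom_add[of "[:x:]" "[:y:]"] by (simp add: e_def)
  have e_mult: "e (x * y) = e x * e y" for x y
    using to_fract_hom.hom_mult[of "[:x:]" "[:y:]"] by (simp add: e_def mult.commute[of x y])
  have e_of_nat: "e (of_nat n) = of_nat n" for n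
  proof (induction n)
    case 0
    then show ?case by (simp add: e_def)
  next
    case (Suc n)
    have "e 1 = 1" by (simp add: e_def flip: one_pCons)
    then show ?case using Suc by (simp add: e_add)
  qed
  have inj_e: "inj e" by (simp add: e_def inj_on_def)
  have inj_E: "inj E" unfolding E_def using inj_e by (simp add: prod.inj_map)
  have line: "on_line (E ` P) (E l) = E ` on_line P l" for l
  proof -
    have "snd (E p) = fst (E l) * fst (E p) + snd (E l) \<longleftrightarrow> snd p = fst l * fst p + snd l" for p
      using inj_eq[OF inj_e] by (simp add: E_def flip: e_add e_mult)
    then show ?thesis by (auto simp: on_line_def)
  qed
  have "infinite (UNIV :: 'a poly fract set)"
  proof
    assume "finite (UNIV :: 'a poly fract set)"
    then have "finite (range (\<lambda>n. to_fract (monom (1::'a) n)))" by (rule finite_subset[rotated]) simp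
    moreover have "inj (\<lambda>n. to_fract (monom (1::'a) n))"
      by (rule injI) (simp add: monom_eq_iff')
    ultimately show False using finite_imageD by blast
  qed
  moreover have "of_nat i \<noteq> (0::'a poly fract)" if "0 < i" "i * s \<le> 12 * card (E ` P)" for i
  proof -
    have "of_nat i \<noteq> (0::'a)" using char[of i] that inj_E by (simp add: card_image inj_on_subset)
    then show ?thesis using injD[OF inj_e, of "of_nat i" "of_nat 0"] unfolding e_of_nat by auto
  qed
  moreover have "s \<le> card (on_line (E ` P) l)" if "l \<in> E ` L" for l
    using that rich inj_E by (auto simp: line card_image inj_on_subset)
  ultimately have "card (E ` L) * s ^ 3 \<le> 240 * card (E ` P) ^ 2"
    using fin s True inj_E by (intro rich_lines_many_points) (auto simp: card_image inj_on_subset)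
  then show ?thesis using inj_E by (simp add: card_image inj_on_subset)
qed

section \<open>Third-order energies\<close>

lemma weighted_Cauchy_Schwarz:
  fixes u v w :: "'i \<Rightarrow> real"
  assumes "\<And>i. i \<in> I \<Longrightarrow> 0 \<le> w i"
  shows "(\<Sum>i\<in>I. w i * u i * v i)^2 \<le> (\<Sum>i\<in>I. w i * u i ^ 2) * (\<Sum>i\<in>I. w i * v i ^ 2)"
proof -
  have "(\<Sum>i\<in>I. (sqrt (w i) * u i) * (sqrt (w i) * v i)) = (\<Sum>i\<in>I. w i * u i * v i)"
    "(\<Sum>i\<in>I. (sqrt (w i) * u i)\<^sup>2) = (\<Sum>i\<in>I. w i * u i ^ 2)"
    "(\<Sum>i\<in>I. (sqrt (w i) * v i)\<^sup>2) = (\<Sum>i\<in>I. w i * v i ^ 2)"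
    using assms by (auto intro!: sum.cong simp: power_mult_distrib)
  then show ?thesis
    using Cauchy_Schwarz_ineq_sum[of "\<lambda>i. sqrt (w i) * u i" "\<lambda>i. sqrt (w i) * v i" I] by simp
qed

text \<open>Hoelder's inequality with exponents 3, 2 and 6 for
  \<open>f * g = f * g^(1/2) * g^(1/2)\<close>, from three uses of Cauchy-Schwarz.\<close>

lemma sum_product_pow6_le:
  fixes f g :: "'i \<Rightarrow> real"
  assumes "\<And>i. 0 \<le> f i" "\<And>i. 0 \<le> g i"
  shows "(\<Sum>i\<in>I. f i * g i)^6 \<le> (\<Sum>i\<in>I. f i ^ 3)^2 * (\<Sum>i\<in>I. g i)^3 * (\<Sum>i\<in>I. g i ^ 3)"
proof -
  define F G Xs Y where "F = (\<Sum>i\<in>I. f i ^ 3)" and "G = (\<Sum>i\<in>I. g i ^ 3)"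
    and "Xs = (\<Sum>i\<in>I. f i ^ 2 * g i)" and "Y = (\<Sum>i\<in>I. f i * g i ^ 2)"
  have nn: "0 \<le> F" "0 \<le> G" "0 \<le> Xs" "0 \<le> Y"
    unfolding F_def G_def Xs_def Y_def using assms by (auto intro!: sum_nonneg)
  have Xs: "Xs^2 \<le> F * Y"
    using weighted_Cauchy_Schwarz[of I f f g] assms
    by (simp add: F_def Xs_def Y_def power2_eq_square power3_eq_cube mult.assoc)
  have Y: "Y^2 \<le> Xs * G"
    using weighted_Cauchy_Schwarz[of I g f g] assms
    by (simp add: G_def Xs_def Y_def power2_eq_square power3_eq_cube mult_ac)
  have "Xs * Xs^3 = (Xs^2)^2" by (simp add: power2_eq_square power3_eq_cube)
  also have "\<dots> \<le> (F * Y)^2" using Xs by (intro power_mono) auto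
  also have "\<dots> \<le> F^2 * (Xs * G)" using Y by (simp add: power_mult_distrib mult_left_mono)
  finally have "Xs * Xs^3 \<le> Xs * (F^2 * G)" by (simp add: mult_ac)
  then have X3: "Xs^3 \<le> F^2 * G" using nn by (cases "Xs = 0") (auto simp: mult_le_cancel_left)
  have "(\<Sum>i\<in>I. f i * g i)^2 \<le> Xs * (\<Sum>i\<in>I. g i)"
    using weighted_Cauchy_Schwarz[of I g f "\<lambda>_. 1"] assms by (simp add: Xs_def mult_ac)
  then have "((\<Sum>i\<in>I. f i * g i)^2)^3 \<le> (Xs * (\<Sum>i\<in>I. g i))^3" by (intro power_mono) auto
  also have "\<dots> \<le> (F^2 * G) * (\<Sum>i\<in>I. g i)^3"
    unfolding power_mult_distrib using X3 assms by (intro mult_right_mono) (auto intro: sum_nonneg)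
  finally show ?thesis by (simp add: F_def G_def mult_ac flip: power_mult)
qed

section \<open>Level sets and representation counts\<close>

lemma harm_ge_1: "0 < n \<Longrightarrow> 1 \<le> (harm n :: real)"
  using harm_mono[of 1 n, where 'a = real] by (simp add: harm_def)

lemma power_le_sum_powers: "real n ^ q \<le> (\<Sum>t = 1..n. real q * real t ^ (q - 1))" if "0 < q"
proof (induction n)
  case 0
  then show ?case using that by (simp add: power_0_left)
next
  case (Suc n)
  have "(x + 1) ^ q \<le> x ^ q + real q * (x + 1) ^ (q - 1)" if "0 \<le> x" for x :: real
    using \<open>0 < q\<close>
  proof (induction q)
    case (Suc q)
    show ?case
    proof (cases "q = 0")
      case False
      have "(x + 1) ^ Suc q \<le> (x + 1) * (x ^ q + real q * (x + 1) ^ (q - 1))"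
        using Suc False that by (simp add: mult_left_mono)
      also have "\<dots> = x ^ Suc q + x ^ q + real q * (x + 1) ^ q"
        using False by (cases q) (auto simp: algebra_simps)
      also have "x ^ q \<le> (x + 1) ^ q" using that by (intro power_mono) auto
      finally show ?thesis by (simp add: algebra_simps)
    qed simp
  qed simp
  from this[of "real n"] Suc show ?case by (simp add: add.commute)
qed

text \<open>The sum is at most the sum over heights \<open>s\<close> of \<open>q s^(q-1)\<close>
  times the size of the level set, which is \<open>q / s\<close> times \<open>h s\<close>. The
  maximum of \<open>h\<close> comes out, and the rest is a harmonic number, in place of the
  logarithm of a dyadic decomposition.\<close>

lemma layer_cake:
  fixes f :: "'x \<Rightarrow> nat"
  assumes fin: "finite Xs" and M: "\<And>x. x \<in> Xs \<Longrightarrow> f x \<le> M" "0 < M" and q: "0 < q"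
  shows "\<exists>t\<in>{1..M}. (\<Sum>x\<in>Xs. real (f x) ^ q) \<le> real q * harm M * (real t ^ q * real (card {x \<in> Xs. t \<le> f x}))"
proof -
  define h where "h t = real t ^ q * real (card {x \<in> Xs. t \<le> f x})" for t
  define W where "W = Max (h ` {1..M})"
  have "W \<in> h ` {1..M}" unfolding W_def using M by (intro Max_in) auto
  then obtain t where t: "t \<in> {1..M}" "W = h t" by auto
  have W: "h s \<le> W" if "s \<in> {1..M}" for s unfolding W_def using that by simp
  have "(\<Sum>x\<in>Xs. real (f x) ^ q) \<le> (\<Sum>x\<in>Xs. \<Sum>s = 1..f x. real q * real s ^ (q - 1))"
    using q by (intro sum_mono power_le_sum_powers)
  also have "\<dots> = (\<Sum>x\<in>Xs. \<Sum>s = 1..M. if s \<le> f x then real q * real s ^ (q - 1) else 0)"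
    using M by (intro sum.cong refl sum.mono_neutral_cong_left) (auto intro: order_trans)
  also have "\<dots> = (\<Sum>s = 1..M. \<Sum>x\<in>Xs. if s \<le> f x then real q * real s ^ (q - 1) else 0)"
    by (rule sum.swap)
  also have "\<dots> = (\<Sum>s = 1..M. real q * real s ^ (q - 1) * real (card {x \<in> Xs. s \<le> f x}))"
    using fin by (intro sum.cong refl) (simp add: sum.If_cases Int_def)
  also have "\<dots> = (\<Sum>s = 1..M. real q * (1 / real s) * h s)"
    using q by (intro sum.cong refl) (auto simp: h_def power_eq_if)
  also have "\<dots> \<le> (\<Sum>s = 1..M. real q * (1 / real s) * W)"
    using W by (intro sum_mono mult_left_mono) auto
  also have "\<dots> = real q * harm M * W"
    by (simp add: harm_def sum_distrib_left sum_distrib_right inverse_eq_divide)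
  finally show ?thesis using t by (auto simp: h_def)
qed

text \<open>The operation is a parameter, as counts are needed for sums, differences and products,
  and for groups in additive notation.\<close>

definition rep :: "('a \<Rightarrow> 'a \<Rightarrow> 'b) \<Rightarrow> 'a set \<Rightarrow> 'a set \<Rightarrow> 'b \<Rightarrow> nat" where
  "rep f A B x = card {p \<in> A \<times> B. f (fst p) (snd p) = x}"

definition opset :: "('a \<Rightarrow> 'a \<Rightarrow> 'b) \<Rightarrow> 'a set \<Rightarrow> 'a set \<Rightarrow> 'b set" where
  "opset f A B = (\<lambda>p. f (fst p) (snd p)) ` (A \<times> B)"

definition energy3 :: "('a \<Rightarrow> 'a \<Rightarrow> 'b) \<Rightarrow> 'a set \<Rightarrow> 'a set \<Rightarrow> real" where
  "energy3 f A B = (\<Sum>x\<in>opset f A B. real (rep f A B x) ^ 3)"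

lemma opsetI: "a \<in> A \<Longrightarrow> b \<in> B \<Longrightarrow> f a b \<in> opset f A B"
  unfolding opset_def by (rule image_eqI[of _ _ "(a, b)"]) auto

lemma finite_opset: "finite A \<Longrightarrow> finite B \<Longrightarrow> finite (opset f A B)"
  by (simp add: opset_def)

lemma rep_eq_0: "x \<notin> opset f A B \<Longrightarrow> rep f A B x = 0"
  by (auto simp: rep_def opset_def intro!: card_eq_0_iff[THEN iffD2])

lemma sum_rep:
  assumes "finite A" "finite B" "finite Xs"
  shows "(\<Sum>x\<in>Xs. rep f A B x) = card {p \<in> A \<times> B. f (fst p) (snd p) \<in> Xs}"
proof -
  have "{p \<in> A \<times> B. f (fst p) (snd p) \<in> Xs} = (\<Union>x\<in>Xs. {p \<in> A \<times> B. f (fst p) (snd p) = x})" by auto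
  then show ?thesis
    unfolding rep_def using assms by (simp only:) (intro card_UN_disjoint[symmetric]; auto)
qed

lemma sum_rep_total:
  assumes "finite A" "finite B" "finite Xs" "opset f A B \<subseteq> Xs"
  shows "(\<Sum>x\<in>Xs. rep f A B x) = card A * card B"
  using assms(4) by (subst sum_rep[OF assms(1-3)], subst card_cartesian_product[symmetric])
    (auto simp: opset_def intro!: arg_cong[where f = card])

lemma rep_le_left:
  assumes "finite A" "finite B" "inj_on fst {p \<in> A \<times> B. f (fst p) (snd p) = x}"
  shows "rep f A B x \<le> card A"
  unfolding rep_def using assms by (subst card_image[symmetric, of fst]) (auto intro!: card_mono)

lemma rep_le_right:
  assumes "finite A" "finite B" "inj_on snd {p \<in> A \<times> B. f (fst p) (snd p) = x}"
  shows "rep f A B x \<le> card B"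
  unfolding rep_def using assms by (subst card_image[symmetric, of snd]) (auto intro!: card_mono)

lemma energy3_superset:
  assumes "finite Xs" "opset f A B \<subseteq> Xs"
  shows "energy3 f A B = (\<Sum>x\<in>Xs. real (rep f A B x) ^ 3)"
  unfolding energy3_def using assms by (intro sum.mono_neutral_left) (auto simp: rep_eq_0)

lemma sum_fibre_cards_power:
  assumes "finite T" "\<phi> ` T \<subseteq> Y" "finite Y"
  shows "(\<Sum>y\<in>Y. card {t \<in> T. \<phi> t = y}) = card T"
    and "(\<Sum>y\<in>Y. card {t \<in> T. \<phi> t = y} ^ 2) = card {(s, t) \<in> T \<times> T. \<phi> s = \<phi> t}"
    and "(\<Sum>y\<in>Y. card {t \<in> T. \<phi> t = y} ^ 3) = card {(s, t, r) \<in> T \<times> T \<times> T. \<phi> s = \<phi> t \<and> \<phi> t = \<phi> r}"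
proof -
  let ?F = "\<lambda>y. {t \<in> T. \<phi> t = y}"
  have "T = (\<Union>y\<in>Y. ?F y)" using assms by auto
  then show "(\<Sum>y\<in>Y. card (?F y)) = card T"
    using assms by (subst (2) \<open>T = _\<close>) (intro card_UN_disjoint[symmetric]; auto)
  have "{(s, t) \<in> T \<times> T. \<phi> s = \<phi> t} = (\<Union>y\<in>Y. ?F y \<times> ?F y)" using assms by auto
  also have "card \<dots> = (\<Sum>y\<in>Y. card (?F y \<times> ?F y))"
    using assms by (intro card_UN_disjoint) auto
  finally show "(\<Sum>y\<in>Y. card (?F y) ^ 2) = card {(s, t) \<in> T \<times> T. \<phi> s = \<phi> t}"
    by (simp add: card_cartesian_product power2_eq_square)
  have "{(s, t, r) \<in> T \<times> T \<times> T. \<phi> s = \<phi> t \<and> \<phi> t = \<phi> r} = (\<Union>y\<in>Y. ?F y \<times> ?F y \<times> ?F y)"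
    using assms by auto
  also have "card \<dots> = (\<Sum>y\<in>Y. card (?F y \<times> ?F y \<times> ?F y))"
    using assms by (intro card_UN_disjoint) auto
  finally show "(\<Sum>y\<in>Y. card (?F y) ^ 3) = card {(s, t, r) \<in> T \<times> T \<times> T. \<phi> s = \<phi> t \<and> \<phi> t = \<phi> r}"
    by (simp add: card_cartesian_product power3_eq_cube mult.assoc)
qed

lemma card_sq_le_fibre_pairs:
  assumes "finite T" "\<phi> ` T \<subseteq> Y" "finite Y"
  shows "real (card T) ^ 2 \<le> real (card Y) * real (card {(s, t) \<in> T \<times> T. \<phi> s = \<phi> t})"
proof -
  have "real (card T) ^ 2 = (\<Sum>y\<in>Y. real (card {t \<in> T. \<phi> t = y}))^2"
    using sum_fibre_cards_power(1)[OF assms] by (metis of_nat_sum)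
  also have "\<dots> \<le> real (card Y) * (\<Sum>y\<in>Y. real (card {t \<in> T. \<phi> t = y}) ^ 2)"
    using weighted_Cauchy_Schwarz[of Y "\<lambda>_. 1" "\<lambda>_. 1" "\<lambda>y. real (card {t \<in> T. \<phi> t = y})"] by simp
  also have "(\<Sum>y\<in>Y. real (card {t \<in> T. \<phi> t = y}) ^ 2) = real (card {(s, t) \<in> T \<times> T. \<phi> s = \<phi> t})"
    using sum_fibre_cards_power(2)[OF assms] by (metis (no_types, lifting) of_nat_power of_nat_sum sum.cong)
  finally show ?thesis .
qed

text \<open>The origin of 30, 11 and 19. The letters stand for the cardinalities in
  \<open>energy_sumset_bound\<close>. Eliminating \<open>T\<close> and \<open>Q\<close> gives
  \<open>N D^2 \<tau>^2 <= 54 d S U\<close>; the sixth power and the bound for \<open>U\<close> give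
  \<open>D^7 \<tau>^12 <= 54^6 d^9 S^10\<close>; the square of \<open>D \<tau>^3 <= d N^3\<close>
  completes this to a bound for \<open>(D \<tau>^2)^9\<close>, which goes into the ninth power of
  \<open>e\<close>.\<close>

lemma energy_sumset_arithmetic:
  fixes N S D \<tau> d \<Lambda> T Q U :: real
  assumes pos: "0 < N" "0 < S" "0 < D" "0 < \<tau>" "0 \<le> d" "0 \<le> \<Lambda>" "0 \<le> Q" "0 \<le> T" "0 \<le> U"
    and T: "N * D * \<tau> \<le> 3 * T" "T^2 \<le> Q * (d * N^3)"
    and Q: "Q * N^2 \<le> 6 * S * U"
    and U: "U^6 \<le> (d * N * S^2)^2 * (N * D)^3 * (d * N * D^2)"
    and D: "D * \<tau>^3 \<le> d * N^3"
    and e: "N^4 \<le> 64 * \<Lambda> * S * (D * \<tau>^2)"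
  shows "N^30 \<le> 64^9 * 54^6 * \<Lambda>^9 * d^11 * S^19"
proof -
  have "(N * D * \<tau>)^2 \<le> (3 * T)^2" using T(1) pos by (intro power_mono) auto
  then have "(N * D * \<tau>)^2 \<le> 9 * (Q * (d * N^3))" using T(2) by (simp add: power_mult_distrib)
  then have "(N * D * \<tau>)^2 * N^2 \<le> 9 * (Q * (d * N^3)) * N^2" by (intro mult_right_mono) auto
  also have "\<dots> = 9 * (d * N^3) * (Q * N^2)" by simp
  also have "\<dots> \<le> 9 * (d * N^3) * (6 * S * U)" using Q pos by (intro mult_left_mono) auto
  finally have "N^3 * (N * D^2 * \<tau>^2) \<le> N^3 * (54 * d * S * U)"
    by (simp add: power_mult_distrib algebra_simps power2_eq_square power3_eq_cube)
  then have 1: "N * D^2 * \<tau>^2 \<le> 54 * d * S * U" using pos by simp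
  then have "(N * D^2 * \<tau>^2)^6 \<le> (54 * d * S * U)^6" using pos by (intro power_mono) auto
  also have "\<dots> = (54 * d * S)^6 * U^6" by (simp add: power_mult_distrib)
  also have "\<dots> \<le> (54 * d * S)^6 * ((d * N * S^2)^2 * (N * D)^3 * (d * N * D^2))"
    using U pos by (intro mult_left_mono) auto
  also have "\<dots> = (N^6 * D^5) * (54^6 * d^9 * S^10)"
    by (simp add: power_mult_distrib power_mult[symmetric] mult_ac power_add[symmetric]
        power2_eq_square power3_eq_cube power_eq_if[of _ 4] eval_nat_numeral)
  also have "(N * D^2 * \<tau>^2)^6 = (N^6 * D^5) * (D^7 * \<tau>^12)"
    by (simp add: power_mult_distrib flip: power_mult power_add)
  finally have "(N^6 * D^5) * (D^7 * \<tau>^12) \<le> (N^6 * D^5) * (54^6 * d^9 * S^10)" .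
  then have 2: "D^7 * \<tau>^12 \<le> 54^6 * d^9 * S^10"
    by (rule mult_left_le_imp_le) (use pos in simp)
  have "D^9 * \<tau>^18 = (D^7 * \<tau>^12) * (D * \<tau>^3)^2"
    by (simp add: power_mult_distrib mult_ac flip: power_mult power_add)
  also have "\<dots> \<le> (54^6 * d^9 * S^10) * (d * N^3)^2"
    by (rule mult_mono[OF 2 power_mono[OF D]]) (use pos in auto)
  also have "\<dots> = 54^6 * d^11 * S^10 * N^6"
    by (simp add: power_mult_distrib mult_ac flip: power_mult power_add)
  finally have 3: "D^9 * \<tau>^18 \<le> 54^6 * d^11 * S^10 * N^6" .
  have "N^6 * N^30 = (N^4)^9" by (simp flip: power_mult power_add)
  also have "\<dots> \<le> (64 * \<Lambda> * S * (D * \<tau>^2))^9" using e pos by (intro power_mono) auto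
  also have "\<dots> = 64^9 * \<Lambda>^9 * S^9 * (D^9 * \<tau>^18)"
    by (simp add: power_mult_distrib mult_ac flip: power_mult)
  also have "\<dots> \<le> 64^9 * \<Lambda>^9 * S^9 * (54^6 * d^11 * S^10 * N^6)"
    using 3 pos by (intro mult_left_mono) auto
  also have "\<dots> = N^6 * (64^9 * 54^6 * \<Lambda>^9 * d^11 * S^19)"
    by (simp add: mult_ac flip: power_add)
  finally show ?thesis by (rule mult_left_le_imp_le) (use pos in simp)
qed

lemma energy3_triples:
  assumes "finite A" "finite B"
  shows "energy3 f A B = real (card {(s, t, r) \<in> (A \<times> B) \<times> (A \<times> B) \<times> (A \<times> B).
    f (fst s) (snd s) = f (fst t) (snd t) \<and> f (fst t) (snd t) = f (fst r) (snd r)})"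
  using sum_fibre_cards_power(3)[of "A \<times> B" "\<lambda>p. f (fst p) (snd p)" "opset f A B"] assms
  by (simp add: energy3_def rep_def finite_opset flip: of_nat_power of_nat_sum) (simp add: opset_def)

text \<open>\<open>a + b = c + e\<close> is the same as \<open>a - c = e - b\<close>, so sums and
  differences have equal second moments. \<open>S\<close> may be larger than the sumset, so that a
  subset of \<open>A\<close> can be measured against \<open>A + A\<close>.\<close>

lemma additive_energy_ge:
  fixes A :: "'a::ab_group_add set"
  assumes fin: "finite A" and S: "opset (+) A A \<subseteq> S" "finite S"
  shows "real (card A) ^ 4 \<le> real (card S) * (\<Sum>x\<in>opset (+) A (uminus ` A). real (rep (+) A (uminus ` A) x) ^ 2)"
proof -
  let ?s = "\<lambda>p :: 'a \<times> 'a. fst p + snd p"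
  let ?N = "A \<times> uminus ` A"
  have "real (card (A \<times> A)) ^ 2 \<le> real (card S) * real (card {(p, q) \<in> (A \<times> A) \<times> (A \<times> A). ?s p = ?s q})"
    using fin S by (intro card_sq_le_fibre_pairs) (auto simp: opset_def)
  also have "card {(p, q) \<in> (A \<times> A) \<times> (A \<times> A). ?s p = ?s q} = card {(p, q) \<in> ?N \<times> ?N. ?s p = ?s q}"
    by (rule bij_betw_same_card[of "\<lambda>((a, b), (c, e)). ((a, - c), (e, - b))"],
        rule bij_betw_byWitness[where f' = "\<lambda>((a, c), (e, b)). ((a, - b), (- c, e))"])
      (auto simp: algebra_simps)
  also have "\<dots> = (\<Sum>x\<in>opset (+) A (uminus ` A). rep (+) A (uminus ` A) x ^ 2)"
    unfolding rep_def
    by (rule sum_fibre_cards_power(2)[symmetric]) (auto simp: fin opset_def)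
  finally show ?thesis by (simp add: card_cartesian_product power4_eq_xxxx power2_eq_square mult.assoc)
qed

lemma sum_rep_mult_eq_card:
  assumes "finite A" "finite B" "finite C" "finite D" "finite Z" "opset f A B \<subseteq> Z"
  shows "(\<Sum>z\<in>Z. rep f A B z * rep g C D (h z))
    = card {(p, q) \<in> (A \<times> B) \<times> (C \<times> D). g (fst q) (snd q) = h (f (fst p) (snd p))}"
proof -
  let ?P = "\<lambda>z. {p \<in> A \<times> B. f (fst p) (snd p) = z}" and ?Q = "\<lambda>z. {q \<in> C \<times> D. g (fst q) (snd q) = z}"
  have "{(p, q) \<in> (A \<times> B) \<times> (C \<times> D). g (fst q) (snd q) = h (f (fst p) (snd p))} = (\<Union>z\<in>Z. ?P z \<times> ?Q (h z))"
    using assms(6) by (auto simp: opset_def)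
  also have "card \<dots> = (\<Sum>z\<in>Z. card (?P z \<times> ?Q (h z)))"
    using assms by (intro card_UN_disjoint) auto
  finally show ?thesis by (simp add: rep_def card_cartesian_product)
qed

text \<open>
  \<open>P\<close> consists of the popular sums and \<open>D\<close> of differences with at least \<open>\<tau>\<close> representations, chosen to
  carry the additive energy.  The triples \<open>(a, c, b)\<close> with \<open>a - c \<in> D\<close> and \<open>a + b, c + b \<in> P\<close> are
  counted from below by popularity and from above by energies with the sets \<open>A\<close>, \<open>S\<close> and \<open>D\<close>.
\<close>

lemma energy_sumset_bound:
  fixes A :: "'a::ab_group_add set" and d \<Lambda> :: real
  defines "S \<equiv> opset (+) A A"
  assumes fin: "finite A" and ne: "A \<noteq> {}" and \<Lambda>: "harm (card A) \<le> \<Lambda>"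
    and ctl: "\<And>B. finite B \<Longrightarrow> card B \<le> 32 * card S \<Longrightarrow> energy3 (+) A B \<le> d * card A * real (card B) ^ 2"
  shows "real (card A) ^ 30 \<le> 64^9 * 54^6 * \<Lambda>^9 * d^11 * real (card S) ^ 19"
proof -
  define N where "N = real (card A)"
  define s where "s = real (card S)"
  have N: "0 < N" using fin ne by (simp add: N_def card_gt_0_iff)
  have finS: "finite S" unfolding S_def using fin by (intro finite_opset)
  obtain a0 where a0: "a0 \<in> A" using ne by auto
  have "card A = card ((\<lambda>a. a0 + a) ` A)" by (simp add: card_image)
  also have "\<dots> \<le> card S" using finS a0 by (intro card_mono) (auto simp: S_def intro: opsetI)
  finally have NS: "card A \<le> card S" .
  have s: "0 < s" using NS N by (simp add: N_def s_def)
  have \<Lambda>1: "1 \<le> \<Lambda>" using harm_ge_1[of "card A"] \<Lambda> N by (simp add: N_def)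
  have card_neg: "card (uminus ` B) = card B" for B :: "'a set" by (simp add: card_image)
  have E3: "energy3 (+) A (uminus ` A) \<le> d * N ^ 3"
    using ctl[of "uminus ` A"] fin NS
    by (simp add: card_neg N_def power3_eq_cube power2_eq_square mult.assoc)
  moreover have "0 \<le> energy3 (+) A (uminus ` A)" unfolding energy3_def by (intro sum_nonneg) auto
  ultimately have "0 \<le> d * N ^ 3" by linarith
  then have d: "0 \<le> d" using N by (simp add: zero_le_mult_iff)

  \<comment> \<open>Sums outside \<open>P\<close> carry at most \<open>N^2 / 6\<close> pairs, and an
    element outside \<open>A'\<close> is in at least \<open>N / 3\<close> of these, so
    \<open>A'\<close> is at least half of \<open>A\<close>. Two thirds ensure that two elements of
    \<open>A'\<close> share at least \<open>N / 3\<close> popular partners \<open>b\<close>.\<close>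
  define P where "P = {x \<in> S. N^2 \<le> 6 * s * rep (+) A A x}"
  have finP: "finite P" using finS by (simp add: P_def)
  define A' where "A' = {a \<in> A. 2 * N \<le> 3 * real (card {b \<in> A. a + b \<in> P})}"
  have A'A: "A' \<subseteq> A" and finA': "finite A'" using fin by (auto simp: A'_def)
  have card_A': "N \<le> 2 * real (card A')"
  proof -
    have "real (card (A - A')) * N \<le> 3 * real (card {p \<in> A \<times> A. fst p + snd p \<in> S - P})"
    proof -
      have sub: "(SIGMA a:A - A'. {b \<in> A. a + b \<notin> P}) \<subseteq> {p \<in> A \<times> A. fst p + snd p \<in> S - P}"
        by (auto simp: S_def opset_def)
      have "N / 3 \<le> real (card {b \<in> A. a + b \<notin> P})" if "a \<in> A - A'" for a
      proof -
        have "card A = card {b \<in> A. a + b \<in> P} + card {b \<in> A. a + b \<notin> P}"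
          using fin by (subst card_Un_disjoint[symmetric]) (auto intro!: arg_cong[where f = card])
        then have "N = real (card {b \<in> A. a + b \<in> P}) + real (card {b \<in> A. a + b \<notin> P})"
          by (simp add: N_def)
        then show ?thesis using that by (auto simp: A'_def)
      qed
      then have "(\<Sum>a\<in>A - A'. N / 3) \<le> (\<Sum>a\<in>A - A'. real (card {b \<in> A. a + b \<notin> P}))" by (rule sum_mono)
      also have "\<dots> = real (card (SIGMA a:A - A'. {b \<in> A. a + b \<notin> P}))" using fin by simp
      also have "\<dots> \<le> real (card {p \<in> A \<times> A. fst p + snd p \<in> S - P})"
        using fin sub by (intro of_nat_mono card_mono) auto
      finally show ?thesis by simp
    qed
    also have "card {p \<in> A \<times> A. fst p + snd p \<in> S - P} = (\<Sum>x\<in>S - P. rep (+) A A x)"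
      using fin finS by (intro sum_rep[symmetric]) auto
    also have "3 * real (\<Sum>x\<in>S - P. rep (+) A A x) = (\<Sum>x\<in>S - P. 3 * real (rep (+) A A x))"
      by (simp add: sum_distrib_left)
    also have "\<dots> \<le> (\<Sum>x\<in>S - P. N^2 / (2 * s))"
      using s by (intro sum_mono) (auto simp: P_def field_simps)
    also have "\<dots> \<le> s * (N^2 / (2 * s))"
      using finS s unfolding sum_constant s_def
      by (intro mult_right_mono of_nat_mono card_mono) auto
    also have "\<dots> = (N / 2) * N" using s by (simp add: power2_eq_square)
    finally have "real (card (A - A')) \<le> N / 2" using N by simp
    then show ?thesis using fin A'A by (simp add: card_Diff_subset finA' N_def of_nat_diff card_mono)
  qed

  define Xs where "Xs = opset (+) A' (uminus ` A')"
  define r where "r = rep (+) A' (uminus ` A')"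
  have finX: "finite Xs" using finA' by (simp add: Xs_def finite_opset)
  have r_le: "r x \<le> card A" for x
  proof -
    have "r x \<le> card A'"
      unfolding r_def by (rule rep_le_left) (use finA' in \<open>auto simp: inj_on_def algebra_simps\<close>)
    also have "\<dots> \<le> card A" using fin A'A by (rule card_mono)
    finally show ?thesis .
  qed
  have sum_r: "(\<Sum>x\<in>Xs. r x) = card A' * card A'"
    unfolding r_def Xs_def using finA' by (subst sum_rep_total) (auto simp: finite_opset card_neg)
  have sum_r_le: "(\<Sum>x\<in>Xs. real (r x)) \<le> N^2"
  proof -
    have "(\<Sum>x\<in>Xs. real (r x)) = real (card A') * real (card A')" by (simp flip: of_nat_sum of_nat_mult add: sum_r)
    also have "\<dots> \<le> N * N" using card_mono[OF fin A'A] by (intro mult_mono) (auto simp: N_def)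
    finally show ?thesis by (simp add: power2_eq_square)
  qed
  have E2: "N^4 \<le> 16 * s * (\<Sum>x\<in>Xs. real (r x) ^ 2)"
  proof -
    have "N^4 \<le> (2 * real (card A'))^4" using card_A' N by (intro power_mono) auto
    also have "\<dots> = 16 * real (card A') ^ 4" by (simp add: power_mult_distrib)
    also have "real (card A') ^ 4 \<le> s * (\<Sum>x\<in>Xs. real (r x) ^ 2)"
      unfolding s_def Xs_def r_def
      by (rule additive_energy_ge) (use finA' A'A finS in \<open>auto simp: S_def opset_def\<close>)
    finally show ?thesis by simp
  qed
  \<comment> \<open>Counts below \<open>\<theta>\<close> make up at most half of the guaranteed
    energy, since all counts add up to at most \<open>N^2\<close>. Conversely counts above
    \<open>\<theta>\<close> force \<open>card D <= 32 * card S\<close>, whence the 32 in the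
    hypothesis on \<open>B\<close>.\<close>
  define \<theta> where "\<theta> = N^2 / (32 * s)"
  have \<theta>: "0 < \<theta>" using N s by (simp add: \<theta>_def)
  define g where "g x = (if \<theta> \<le> real (r x) then r x else 0)" for x
  have E2g: "N^4 \<le> 32 * s * (\<Sum>x\<in>Xs. real (g x) ^ 2)"
  proof -
    have "(\<Sum>x\<in>Xs. real (r x) ^ 2) \<le> (\<Sum>x\<in>Xs. real (g x) ^ 2 + \<theta> * real (r x))"
      using \<theta> by (intro sum_mono) (auto simp: g_def power2_eq_square mult_right_mono)
    also have "\<dots> = (\<Sum>x\<in>Xs. real (g x) ^ 2) + \<theta> * (\<Sum>x\<in>Xs. real (r x))"
      by (simp add: sum.distrib sum_distrib_left)
    also have "\<theta> * (\<Sum>x\<in>Xs. real (r x)) \<le> \<theta> * N^2" using sum_r_le \<theta> by (intro mult_left_mono) auto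
    finally have "16 * s * (\<Sum>x\<in>Xs. real (r x) ^ 2) \<le> 16 * s * ((\<Sum>x\<in>Xs. real (g x) ^ 2) + \<theta> * N^2)"
      using s by (intro mult_left_mono) auto
    also have "\<dots> = 16 * s * (\<Sum>x\<in>Xs. real (g x) ^ 2) + N^4 / 2"
      using s by (simp add: \<theta>_def algebra_simps power4_eq_xxxx power2_eq_square)
    finally show ?thesis using E2 by simp
  qed
  obtain t where t: "1 \<le> t" and
    t2: "(\<Sum>x\<in>Xs. real (g x) ^ 2) \<le> 2 * harm (card A) * (real t ^ 2 * real (card {x \<in> Xs. t \<le> g x}))"
  proof -
    have "g x \<le> card A" for x using r_le by (simp add: g_def)
    moreover have "0 < card A" using N by (simp add: N_def)
    ultimately show ?thesis using layer_cake[OF finX, of g "card A" 2] that by auto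
  qed
  \<comment> \<open>Raising \<open>t\<close> to \<open>\<theta>\<close> loses nothing, as nonzero
    values of \<open>g\<close> are at least \<open>\<theta>\<close>.\<close>
  define \<tau> where "\<tau> = max t (nat \<lceil>\<theta>\<rceil>)"
  define D where "D = {x \<in> Xs. \<tau> \<le> r x}"
  define \<delta> where "\<delta> = real (card D)"
  have finD: "finite D" using finX by (simp add: D_def)
  have "\<theta> \<le> real (nat \<lceil>\<theta>\<rceil>)" by (rule real_nat_ceiling_ge)
  also have "\<dots> \<le> real \<tau>" by (simp add: \<tau>_def)
  finally have \<tau>: "0 < real \<tau>" "\<theta> \<le> real \<tau>" using \<theta> by simp_all
  have "{x \<in> Xs. t \<le> g x} \<subseteq> D"
    using t \<theta> by (auto simp: D_def \<tau>_def g_def nat_le_iff ceiling_le_iff split: if_splits)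
  then have "real (card {x \<in> Xs. t \<le> g x}) \<le> \<delta>" unfolding \<delta>_def using finD by (intro of_nat_mono card_mono)
  then have level: "real t ^ 2 * real (card {x \<in> Xs. t \<le> g x}) \<le> real \<tau> ^ 2 * \<delta>"
    by (intro mult_mono power_mono) (auto simp: \<tau>_def)
  have "2 * harm (card A) \<le> 2 * \<Lambda>" using \<Lambda> by simp
  then have "(\<Sum>x\<in>Xs. real (g x) ^ 2) \<le> 2 * \<Lambda> * (real \<tau> ^ 2 * \<delta>)"
    by (rule order_trans[OF t2 mult_mono[OF _ level]]) (use \<Lambda>1 in auto)
  then have "32 * s * (\<Sum>x\<in>Xs. real (g x) ^ 2) \<le> 32 * s * (2 * \<Lambda> * (real \<tau> ^ 2 * \<delta>))"
    using s by (intro mult_left_mono) auto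
  with E2g have e: "N^4 \<le> 64 * \<Lambda> * s * (\<delta> * real \<tau> ^ 2)" by (simp add: mult_ac)
  have \<delta>: "0 < \<delta>"
  proof -
    have "0 < N^4" using N by simp
    with e have "\<delta> \<noteq> 0" by auto
    then show ?thesis by (simp add: \<delta>_def)
  qed
  have D\<tau>: "\<delta> * real \<tau> \<le> (\<Sum>x\<in>D. real (r x))"
    unfolding \<delta>_def using sum_mono[of D "\<lambda>_. real \<tau>" "\<lambda>x. real (r x)"] by (auto simp: D_def)
  also have "\<dots> \<le> (\<Sum>x\<in>Xs. real (r x))" using finX by (intro sum_mono2) (auto simp: D_def)
  also note sum_r_le
  finally have "\<delta> * \<theta> \<le> N^2"
    using \<tau>(2) \<delta> by (meson less_eq_real_def mult_left_mono order_trans)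
  then have "\<delta> \<le> 32 * s" using N s by (simp add: \<theta>_def field_simps)
  then have card_D: "card D \<le> 32 * card S" by (simp add: \<delta>_def s_def flip: of_nat_mult[of 32, simplified])

  \<comment> \<open>The solutions of \<open>a + b = v + e\<close> with \<open>a\<close>,
    \<open>b\<close> in \<open>A\<close>, \<open>v\<close> in \<open>S\<close> and \<open>e\<close>
    in \<open>D\<close>, with signs arranged so that the energies of \<open>A\<close> with
    \<open>-S\<close> and \<open>-D\<close> apply.\<close>
  define U where "U = {(p, q) \<in> (A \<times> uminus ` S) \<times> (A \<times> uminus ` D). fst q + snd q = - (fst p + snd p)}"
  have U6: "real (card U) ^ 6 \<le> (d * N * s^2)^2 * (N * \<delta>)^3 * (d * N * \<delta>^2)"
  proof -
    define Z where "Z = opset (+) A (uminus ` S) \<union> uminus ` opset (+) A (uminus ` D)"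
    have finZ: "finite Z" using fin finS finD by (auto simp: Z_def finite_opset)
    have negZ: "finite (uminus ` Z)" "opset (+) A (uminus ` D) \<subseteq> uminus ` Z"
      using finZ fin finD by (simp add: Z_def finite_opset) (auto simp: Z_def image_Un image_image)
    let ?f = "\<lambda>z. real (rep (+) A (uminus ` S) z)" and ?g = "\<lambda>z. real (rep (+) A (uminus ` D) (- z))"
    have "card U = (\<Sum>z\<in>Z. rep (+) A (uminus ` S) z * rep (+) A (uminus ` D) (- z))"
      unfolding U_def using fin finS finD finZ
      by (subst sum_rep_mult_eq_card) (auto simp: Z_def)
    then have "real (card U) = (\<Sum>z\<in>Z. ?f z * ?g z)" by simp
    then have "real (card U) ^ 6 \<le> (\<Sum>z\<in>Z. ?f z ^ 3)^2 * (\<Sum>z\<in>Z. ?g z)^3 * (\<Sum>z\<in>Z. ?g z ^ 3)"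
      using sum_product_pow6_le[of ?f ?g Z] by simp
    also have "(\<Sum>z\<in>Z. ?f z ^ 3) = energy3 (+) A (uminus ` S)"
      using finZ by (intro energy3_superset[symmetric]) (auto simp: Z_def)
    also have "(\<Sum>z\<in>Z. ?g z ^ 3) = (\<Sum>z\<in>uminus ` Z. real (rep (+) A (uminus ` D) z) ^ 3)"
      by (subst sum.reindex) (auto simp: inj_on_def)
    also have "\<dots> = energy3 (+) A (uminus ` D)"
      using negZ by (rule energy3_superset[symmetric])
    also have "(\<Sum>z\<in>Z. ?g z) = (\<Sum>z\<in>uminus ` Z. real (rep (+) A (uminus ` D) z))"
      by (subst sum.reindex) (auto simp: inj_on_def)
    also have "\<dots> = real (card A * card (uminus ` D))"
      unfolding of_nat_sum[symmetric] using fin finD negZ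
      by (subst sum_rep_total) auto
    finally have "real (card U) ^ 6 \<le> energy3 (+) A (uminus ` S) ^ 2 * (N * \<delta>)^3 * energy3 (+) A (uminus ` D)"
      by (simp add: card_neg N_def \<delta>_def)
    also have "\<dots> \<le> (d * N * s^2)^2 * (N * \<delta>)^3 * (d * N * \<delta>^2)"
    proof (intro mult_mono power_mono)
      show "energy3 (+) A (uminus ` S) \<le> d * N * s^2"
        using ctl[of "uminus ` S"] finS by (simp add: card_neg N_def s_def)
      show "energy3 (+) A (uminus ` D) \<le> d * N * \<delta>^2"
        using ctl[of "uminus ` D"] finD card_D by (simp add: card_neg N_def \<delta>_def)
    qed (use N d \<delta> in \<open>auto simp: energy3_def intro!: sum_nonneg mult_nonneg_nonneg\<close>)
    finally show ?thesis .
  qed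

  define Q where "Q = {(u, v) \<in> P \<times> P. u - v \<in> D}"
  have finQ: "finite Q" using finP by (auto simp: Q_def intro: finite_subset[of _ "P \<times> P"])
  \<comment> \<open>Every representation \<open>u = a + b\<close> of the first component of a pair
    \<open>(u, v)\<close> in \<open>Q\<close> gives a solution with \<open>e = u - v\<close>, and
    \<open>u\<close> is popular.\<close>
  have QU: "real (card Q) * N^2 \<le> 6 * s * real (card U)"
  proof -
    have "(\<Sum>(u, v)\<in>Q. N^2) \<le> (\<Sum>(u, v)\<in>Q. 6 * s * real (rep (+) A A u))"
      by (intro sum_mono) (auto simp: Q_def P_def)
    also have "\<dots> = 6 * s * real (card (SIGMA q:Q. {p \<in> A \<times> A. fst p + snd p = fst q}))"
      using finQ fin by (simp add: rep_def sum_distrib_left split_def)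
    also have "card (SIGMA q:Q. {p \<in> A \<times> A. fst p + snd p = fst q}) \<le> card U"
    proof (rule card_inj_on_le)
      let ?h = "\<lambda>((u, v), (a, b)). ((a, - v), (b, - (u - v)))"
      show "inj_on ?h (SIGMA q:Q. {p \<in> A \<times> A. fst p + snd p = fst q})"
        by (auto simp: inj_on_def)
      show "?h ` (SIGMA q:Q. {p \<in> A \<times> A. fst p + snd p = fst q}) \<subseteq> U"
      proof -
        have "v - u \<in> uminus ` D \<longleftrightarrow> u - v \<in> D" for u v
          using inj_image_mem_iff[OF inj_uminus, of "u - v" D] by simp
        then show ?thesis by (auto simp: U_def Q_def P_def algebra_simps)
      qed
      show "finite U" unfolding U_def
        by (rule finite_subset[of _ "(A \<times> uminus ` S) \<times> (A \<times> uminus ` D)"]) (use fin finS finD in auto)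
    qed
    finally show ?thesis using s by simp
  qed

  define T where "T = (SIGMA p:{p \<in> A' \<times> A'. fst p - snd p \<in> D}. {b \<in> A. fst p + b \<in> P \<and> snd p + b \<in> P})"
  have finT: "finite T"
    unfolding T_def using fin finA' by (intro finite_SigmaI) auto
  have T1: "N * \<delta> * real \<tau> \<le> 3 * real (card T)"
  proof -
    have "\<delta> * real \<tau> \<le> real (\<Sum>x\<in>D. r x)" using D\<tau> by simp
    also have "(\<Sum>x\<in>D. r x) = card {p \<in> A' \<times> uminus ` A'. fst p + snd p \<in> D}"
      unfolding r_def using finA' finD by (intro sum_rep) auto
    also have "\<dots> = card {p \<in> A' \<times> A'. fst p - snd p \<in> D}"
      by (rule bij_betw_same_card[of "map_prod id uminus"],
          rule bij_betw_byWitness[where f' = "map_prod id uminus"]) auto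
    finally have "\<delta> * real \<tau> * (N / 3) \<le> (\<Sum>p\<in>{p \<in> A' \<times> A'. fst p - snd p \<in> D}. N / 3)"
      using N by simp
    also have "\<dots> \<le> (\<Sum>p\<in>{p \<in> A' \<times> A'. fst p - snd p \<in> D}. real (card {b \<in> A. fst p + b \<in> P \<and> snd p + b \<in> P}))"
    proof (rule sum_mono)
      fix p assume p: "p \<in> {p \<in> A' \<times> A'. fst p - snd p \<in> D}"
      let ?B = "\<lambda>a. {b \<in> A. a + b \<in> P}"
      have "card (?B (fst p)) + card (?B (snd p)) = card (?B (fst p) \<union> ?B (snd p)) + card (?B (fst p) \<inter> ?B (snd p))"
        using fin by (intro card_Un_Int) auto
      moreover have "card (?B (fst p) \<union> ?B (snd p)) \<le> card A" using fin by (intro card_mono) auto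
      moreover have "?B (fst p) \<inter> ?B (snd p) = {b \<in> A. fst p + b \<in> P \<and> snd p + b \<in> P}" by auto
      moreover have "2 * N \<le> 3 * real (card (?B (fst p)))" "2 * N \<le> 3 * real (card (?B (snd p)))"
        using p by (auto simp: A'_def)
      ultimately show "N / 3 \<le> real (card {b \<in> A. fst p + b \<in> P \<and> snd p + b \<in> P})"
        unfolding N_def by (simp add: algebra_simps)
    qed
    also have "\<dots> = real (card T)" unfolding T_def using fin finA' by simp
    finally show ?thesis by (simp add: mult_ac)
  qed
  have T2: "real (card T) ^ 2 \<le> real (card Q) * (d * N^3)"
  proof -
    \<comment> \<open>Two triples with the same image differ by a common shift,
      \<open>a - a' = b' - b = c - c'\<close>, so these pairs of triples are counted by the third
      energy of \<open>A\<close> and \<open>-A\<close>.\<close>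
    let ?\<phi> = "\<lambda>((a, c), b). (a + b, c + b)"
    let ?R = "{(x, y) \<in> T \<times> T. ?\<phi> x = ?\<phi> y}"
    have "real (card T) ^ 2 \<le> real (card Q) * real (card ?R)"
      using finT finQ by (intro card_sq_le_fibre_pairs) (auto simp: T_def Q_def)
    also have "real (card ?R) \<le> d * N^3"
    proof -
      let ?N = "A \<times> uminus ` A"
      let ?E = "{(x, y, z) \<in> ?N \<times> ?N \<times> ?N. fst x + snd x = fst y + snd y \<and> fst y + snd y = fst z + snd z}"
      have "card ?R \<le> card ?E"
      proof (rule card_inj_on_le)
        let ?h = "\<lambda>(((a, c), b), ((a', c'), b')). ((a, - a'), (b', - b), (c, - c'))"
        show "inj_on ?h ?R" by (auto simp: inj_on_def)
        show "?h ` ?R \<subseteq> ?E" using A'A by (auto simp: T_def algebra_simps)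
        show "finite ?E" by (rule finite_subset[of _ "?N \<times> ?N \<times> ?N"]) (use fin in auto)
      qed
      then show ?thesis using energy3_triples[of A "uminus ` A" "(+)"] fin E3 by simp
    qed
    finally show ?thesis by (simp add: mult_left_mono)
  qed
  have D3: "\<delta> * real \<tau> ^ 3 \<le> d * N ^ 3"
  proof -
    have "\<delta> * real \<tau> ^ 3 = (\<Sum>x\<in>D. real \<tau> ^ 3)" by (simp add: \<delta>_def)
    also have "\<dots> \<le> (\<Sum>x\<in>D. real (rep (+) A (uminus ` A) x) ^ 3)"
    proof (rule sum_mono)
      fix x assume "x \<in> D"
      then have "\<tau> \<le> r x" by (simp add: D_def)
      also have "r x \<le> rep (+) A (uminus ` A) x"
        unfolding r_def rep_def using fin A'A by (intro card_mono) auto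
      finally show "real \<tau> ^ 3 \<le> real (rep (+) A (uminus ` A) x) ^ 3" by (intro power_mono) auto
    qed
    also have "\<dots> \<le> energy3 (+) A (uminus ` A)"
      unfolding energy3_def using A'A fin
      by (intro sum_mono2 finite_opset) (auto simp: D_def Xs_def opset_def)
    finally show ?thesis using E3 by simp
  qed
  have "N^30 \<le> 64^9 * 54^6 * \<Lambda>^9 * d^11 * s^19"
    by (rule energy_sumset_arithmetic[of N s \<delta> "real \<tau>" d \<Lambda> "real (card Q)" "real (card T)" "real (card U)"])
      (use N s \<delta> \<tau> d \<Lambda>1 T1 T2 QU U6 D3 e in auto)
  then show ?thesis by (simp add: N_def s_def)
qed

section \<open>Additive against multiplicative energies\<close>

lemma sum_rep_ge:
  assumes "finite Xs" "finite B" "finite A" "\<And>a. a \<in> A \<Longrightarrow> \<tau> \<le> rep f Xs B a"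
  shows "card A * \<tau> \<le> card Xs * card B"
proof -
  have "card A * \<tau> \<le> (\<Sum>a\<in>A. rep f Xs B a)"
    using sum_mono[of A "\<lambda>_. \<tau>" "rep f Xs B"] assms by simp
  also have "\<dots> \<le> card (Xs \<times> B)"
    unfolding sum_rep[OF assms(1-3)] using assms by (intro card_mono) auto
  finally show ?thesis by (simp add: card_cartesian_product)
qed

text \<open>
  If \<open>z = a c\<close> and \<open>a = x - b\<close>, then \<open>x = z c\<^sup>-\<^sup>1 + b\<close>, that is, the point \<open>(c\<^sup>-\<^sup>1, x)\<close> is on the line
  \<open>(z, b)\<close>: products with many representations yield rich lines.
\<close>

lemma product_level_set_bound:
  fixes A B C Xs :: "'a::field set"
  assumes fin: "finite A" "finite B" "finite C" "finite Xs" and nz: "0 \<notin> A" "0 \<notin> C"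
    and \<tau>: "0 < \<tau>" "\<And>a. a \<in> A \<Longrightarrow> \<tau> \<le> rep (-) Xs B a" and \<sigma>: "0 < \<sigma>"
    and char: "\<And>i. 0 < i \<Longrightarrow> i \<le> 6 * card C * card Xs \<Longrightarrow> of_nat i \<noteq> (0::'a)"
    and \<Lambda>: "harm (card C * card Xs) \<le> \<Lambda>" "1 \<le> \<Lambda>"
  shows "real (card {z \<in> opset (*) A C. \<sigma> \<le> rep (*) A C z}) * (real \<sigma> * real \<tau>) ^ 3
    \<le> 8000 * \<Lambda> * (real (card Xs) * real (card B) * real (card C))^2"
proof -
  define Z where "Z = {z \<in> opset (*) A C. \<sigma> \<le> rep (*) A C z}"
  have finZ: "finite Z" using fin by (simp add: Z_def finite_opset)
  define a b c x z where "a = card A" and "b = card B" and "c = card C" and "x = card Xs" and "z = card Z"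
  define w where "w = \<sigma> * \<tau>"
  have "real z * real w ^ 3 \<le> 8000 * \<Lambda> * (real x * real b * real c)^2"
  proof (cases "Z = {}")
    case True
    then show ?thesis using \<Lambda> by (simp add: z_def)
  next
    case False
    then obtain z0 where z0: "z0 \<in> Z" by auto
    then obtain a0 where a0: "a0 \<in> A" by (auto simp: Z_def opset_def)
    have "\<sigma> \<le> rep (*) A C z0" using z0 by (simp add: Z_def)
    moreover have "rep (*) A C z0 \<le> a" unfolding a_def
      by (rule rep_le_left[OF fin(1,3)]) (use nz in \<open>auto simp: inj_on_def\<close>)
    moreover have "rep (*) A C z0 \<le> c" unfolding c_def
      by (rule rep_le_right[OF fin(1,3)]) (use nz in \<open>auto simp: inj_on_def\<close>)
    ultimately have \<sigma>_le: "\<sigma> \<le> a" "\<sigma> \<le> c" by linarith+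
    have "\<tau> \<le> rep (-) Xs B a0" using \<tau> a0 by simp
    moreover have "rep (-) Xs B a0 \<le> x" unfolding x_def
      by (rule rep_le_left[OF fin(4,2)]) (auto simp: inj_on_def algebra_simps)
    moreover have "rep (-) Xs B a0 \<le> b" unfolding b_def
      by (rule rep_le_right[OF fin(4,2)]) (auto simp: inj_on_def)
    ultimately have \<tau>_le: "\<tau> \<le> x" "\<tau> \<le> b" by linarith+
    have z\<sigma>: "z * \<sigma> \<le> a * c"
      unfolding z_def a_def c_def using fin finZ by (intro sum_rep_ge[of A C Z \<sigma> "(*)"]) (auto simp: Z_def)
    have a\<tau>: "a * \<tau> \<le> x * b"
      unfolding a_def x_def b_def using fin \<tau> by (intro sum_rep_ge[of Xs B A \<tau> "(-)"]) auto
    have w_le: "w \<le> c * x" unfolding w_def using \<sigma>_le \<tau>_le by (intro mult_mono) auto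
    \<comment> \<open>This brings the second term of \<open>rich_lines\<close> below the desired
      bound.\<close>
    have ww: "w * w \<le> (c * x) * (b * b)"
    proof -
      have "w * w = (\<sigma> * \<tau>) * (\<sigma> * \<tau>)" by (simp add: w_def)
      also have "\<dots> \<le> (a * \<tau>) * (c * b)" using \<sigma>_le \<tau>_le by (intro mult_mono) auto
      also have "\<dots> \<le> (x * b) * (c * b)" using a\<tau> by (intro mult_right_mono) auto
      finally show ?thesis by (simp add: ac_simps)
    qed
    \<comment> \<open>If the average \<open>w / b\<close> of points per line is below 4, trivial
      bounds suffice. Otherwise the threshold \<open>s0\<close> is at least 2, as
      \<open>rich_lines\<close> requires.\<close>
    show ?thesis
    proof (cases "w < 4 * b")
      case True
      have "z * w ^ 3 = z * \<sigma> * \<tau> * (w * w)" by (simp add: w_def power3_eq_cube)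
      also have "\<dots> \<le> a * c * \<tau> * (w * (4 * b))"
        by (rule mult_mono[OF mult_right_mono[OF z\<sigma>] mult_left_mono]) (use True in auto)
      also have "\<dots> = (a * \<tau>) * c * w * (4 * b)" by simp
      also have "\<dots> \<le> (x * b) * c * (c * x) * (4 * b)"
        by (rule mult_right_mono[OF mult_mono[OF mult_right_mono[OF a\<tau>] w_le]]) auto
      also have "\<dots> = 4 * (x * b * c)^2" by (simp add: power2_eq_square)
      finally have "z * w ^ 3 \<le> 4 * (x * b * c)^2" .
      from of_nat_mono[OF this, where 'a = real]
      have "real z * real w ^ 3 \<le> 4 * (real x * real b * real c)^2" by simp
      also have "\<dots> \<le> 8000 * \<Lambda> * (real x * real b * real c)^2" using \<Lambda> by (intro mult_right_mono) auto
      finally show ?thesis .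
    next
      case False
      define s0 where "s0 = w div (2 * b)"
      have b0: "0 < b" using \<tau>_le \<tau> by linarith
      have "2 \<le> s0" unfolding s0_def using False b0 by (simp add: less_eq_div_iff_mult_less_eq)
      have s0_le: "s0 * (2 * b) \<le> w" unfolding s0_def by simp
      have "w < s0 * (2 * b) + 2 * b" unfolding s0_def using b0 dividend_less_div_times[of "2 * b" w] by simp
      also have "\<dots> \<le> s0 * (2 * b) + s0 * (2 * b)" using \<open>2 \<le> s0\<close> by simp
      finally have w_s0: "w \<le> 4 * b * s0" by simp
      define P where "P = inverse ` C \<times> Xs"
      have finP: "finite P" using fin by (simp add: P_def)
      define T where "T = card P"
      have T: "T = c * x"
        by (simp add: T_def P_def card_cartesian_product card_image inj_on_def c_def x_def)
      have "0 < T" using T \<sigma> \<tau> \<sigma>_le \<tau>_le by simp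
      define f where "f l = card (on_line P l)" for l
      define g where "g l = (if s0 \<le> f l then f l else 0)" for l
      have gT: "g l \<le> T" for l
        using card_mono[OF finP on_line_subset] by (simp add: g_def f_def T_def)
      \<comment> \<open>Each of at least \<open>\<sigma>\<close> factorisations of \<open>u\<close>,
        with each of at least \<open>\<tau>\<close> representations of its factor in
        \<open>A\<close>, gives its own point on one of the lines \<open>(u, v)\<close>.\<close>
      have points: "w \<le> (\<Sum>v\<in>B. f (u, v))" if u: "u \<in> Z" for u
      proof -
        define Y where "Y = (SIGMA p:{p \<in> A \<times> C. fst p * snd p = u}. {q \<in> Xs \<times> B. fst q - snd q = fst p})"
        have "w \<le> rep (*) A C u * \<tau>" using u by (simp add: w_def Z_def)
        also have "\<dots> = (\<Sum>p\<in>{p \<in> A \<times> C. fst p * snd p = u}. \<tau>)" by (simp add: rep_def)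
        also have "\<dots> \<le> (\<Sum>p\<in>{p \<in> A \<times> C. fst p * snd p = u}. card {q \<in> Xs \<times> B. fst q - snd q = fst p})"
          by (rule sum_mono) (use \<tau> in \<open>auto simp: rep_def\<close>)
        also have "\<dots> = card Y" using fin by (simp add: Y_def)
        also have "\<dots> \<le> card (SIGMA v:B. on_line P (u, v))"
        proof (rule card_inj_on_le)
          let ?h = "\<lambda>((a, c), (x, v)). (v, (inverse c, x))"
          show "inj_on ?h Y" unfolding Y_def by (auto simp: inj_on_def)
          show "?h ` Y \<subseteq> (SIGMA v:B. on_line P (u, v))"
          proof (rule image_subsetI)
            fix y assume "y \<in> Y"
            then obtain a' c' x' b' where y: "y = ((a', c'), (x', b'))"
              and *: "a' \<in> A" "c' \<in> C" "x' \<in> Xs" "b' \<in> B" "a' * c' = u" "x' - b' = a'"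
              by (auto simp: Y_def)
            have "c' \<noteq> 0" using * nz by auto
            then have "x' = u * inverse c' + b'" using *(5,6) by (simp add: field_simps)
            then show "?h y \<in> (SIGMA v:B. on_line P (u, v))"
              using * by (simp add: y on_line_def P_def)
          qed
          show "finite (SIGMA v:B. on_line P (u, v))" using fin finP by (simp add: finite_on_line)
        qed
        also have "\<dots> = (\<Sum>v\<in>B. f (u, v))" using fin finP by (simp add: f_def finite_on_line)
        finally show ?thesis .
      qed
      have finL: "finite (Z \<times> B)" using fin finZ by simp
      have "z * w \<le> (\<Sum>u\<in>Z. \<Sum>v\<in>B. f (u, v))"
        unfolding z_def using sum_mono[of Z "\<lambda>_. w", OF points] by simp
      also have "\<dots> = (\<Sum>l\<in>Z \<times> B. f l)" by (simp add: sum.cartesian_product)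
      also have "\<dots> \<le> (\<Sum>l\<in>Z \<times> B. g l + s0)" by (intro sum_mono) (simp add: g_def)
      also have "\<dots> = (\<Sum>l\<in>Z \<times> B. g l) + z * b * s0"
        by (simp only: sum.distrib) (simp add: card_cartesian_product z_def b_def)
      finally have "2 * (z * w) \<le> 2 * (\<Sum>l\<in>Z \<times> B. g l) + z * (s0 * (2 * b))" by (simp add: algebra_simps)
      also have "z * (s0 * (2 * b)) \<le> z * w" using s0_le by simp
      finally have "z * w \<le> 2 * (\<Sum>l\<in>Z \<times> B. g l)" by linarith
      from of_nat_mono[OF this, where 'a = real]
      have zw: "real z * real w \<le> 2 * (\<Sum>l\<in>Z \<times> B. real (g l))" by simp
      obtain t where t: "1 \<le> t"
        and tg: "(\<Sum>l\<in>Z \<times> B. real (g l)) \<le> harm T * (real t * real (card {l \<in> Z \<times> B. t \<le> g l}))"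
        using layer_cake[OF finL, of g T 1] gT \<open>0 < T\<close> by auto
      define s where "s = max t s0"
      define L where "L = {l \<in> Z \<times> B. s \<le> f l}"
      have finL': "finite L" using finL by (simp add: L_def)
      have s2: "2 \<le> s" "s0 \<le> s" using \<open>2 \<le> s0\<close> by (auto simp: s_def)
      have "{l \<in> Z \<times> B. t \<le> g l} \<subseteq> L" using t by (auto simp: L_def g_def s_def split: if_splits)
      then have "real t * real (card {l \<in> Z \<times> B. t \<le> g l}) \<le> real s * real (card L)"
        using finL' by (intro mult_mono) (auto simp: s_def card_mono)
      then have level: "harm T * (real t * real (card {l \<in> Z \<times> B. t \<le> g l})) \<le> \<Lambda> * (real s * real (card L))"
        by (rule mult_mono[rotated]) (use \<Lambda> T in \<open>auto simp: c_def x_def\<close>)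
      have zw2: "real z * real w \<le> 2 * \<Lambda> * (real s * real (card L))" using zw tg level by linarith
      have "card L * s ^ 3 \<le> 240 * card P ^ 2 + 2 * card P * s ^ 2"
      proof (rule rich_lines[OF finP finL' s2(1)])
        show "s \<le> card (on_line P l)" if "l \<in> L" for l using that by (simp add: L_def f_def)
        fix i assume i: "0 < i" "i * s \<le> 12 * card P"
        have "i * 2 \<le> i * s" using s2 by simp
        then have "2 * i \<le> 12 * T" using i(2) unfolding T_def by linarith
        then have "i \<le> 6 * card C * card Xs" unfolding T c_def x_def by simp
        then show "of_nat i \<noteq> (0::'a)" using char i by blast
      qed
      then have "(s * card L) * s ^ 2 \<le> 240 * T ^ 2 + 2 * T * s ^ 2"
        by (simp add: T_def power3_eq_cube power2_eq_square mult_ac)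
      then have "(s * card L) * s ^ 2 * (w * w) \<le> (240 * T ^ 2 + 2 * T * s ^ 2) * (w * w)" by (rule mult_right_mono) simp
      also have "\<dots> = 240 * T ^ 2 * (w * w) + 2 * T * s ^ 2 * (w * w)" by (simp add: add_mult_distrib)
      finally have 1: "(s * card L) * s ^ 2 * (w * w) \<le> 240 * T ^ 2 * (w * w) + 2 * T * s ^ 2 * (w * w)" .
      have "w \<le> 4 * b * s" using w_s0 mult_le_mono2[OF s2(2), of "4 * b"] by linarith
      then have "240 * T ^ 2 * (w * w) \<le> 240 * T ^ 2 * ((4 * b * s) * (4 * b * s))"
        by (intro mult_le_mono) auto
      also have "\<dots> = 3840 * (T * b)^2 * s ^ 2" by (simp add: power2_eq_square)
      finally have 2: "240 * T ^ 2 * (w * w) \<le> 3840 * (T * b)^2 * s ^ 2" .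
      have "2 * T * s ^ 2 * (w * w) \<le> 2 * T * s ^ 2 * (T * (b * b))"
        using ww T by (intro mult_left_mono) auto
      also have "\<dots> = 2 * (T * b)^2 * s ^ 2" by (simp add: power2_eq_square)
      finally have "(s * card L) * s ^ 2 * (w * w) \<le> 3842 * (T * b)^2 * s ^ 2" using 1 2 by linarith
      then have "(s * card L * (w * w)) * s ^ 2 \<le> (3842 * (T * b)^2) * s ^ 2" by (simp add: ac_simps)
      then have sL: "s * card L * (w * w) \<le> 3842 * (T * b)^2" using s2 by simp
      have "real z * real w ^ 3 = (real z * real w) * real (w * w)" by (simp add: power3_eq_cube)
      also have "\<dots> \<le> (2 * \<Lambda> * (real s * real (card L))) * real (w * w)" using zw2 by (rule mult_right_mono) simp
      also have "\<dots> = 2 * \<Lambda> * real (s * card L * (w * w))" by simp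
      also have "\<dots> \<le> 2 * \<Lambda> * real (3842 * (T * b)^2)" using sL \<Lambda> by (intro mult_left_mono of_nat_mono) auto
      also have "\<dots> = 7684 * \<Lambda> * (real x * real b * real c)^2" by (simp add: T power_mult_distrib)
      also have "\<dots> \<le> 8000 * \<Lambda> * (real x * real b * real c)^2" using \<Lambda> by (intro mult_right_mono) auto
      finally show ?thesis .
    qed
  qed
  then show ?thesis by (simp add: z_def Z_def w_def x_def b_def c_def)
qed

lemma cube_ge_tangent: "u ^ 3 \<ge> v ^ 3 + 3 * v ^ 2 * (u - v)" if "0 \<le> u" "0 \<le> v" for u v :: real
proof -
  have "0 \<le> (u - v)^2 * (u + 2 * v)" using that by simp
  then show ?thesis by (simp add: power2_eq_square power3_eq_cube algebra_simps)
qed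

text \<open>Convexity of the cube with weights \<open>y\<close> and \<open>z\<close>: both cubes lie
  above the tangent at the mean \<open>m\<close>, and the linear terms cancel.\<close>

lemma cube_add_le:
  fixes f g y z :: real
  assumes "0 \<le> f" "0 \<le> g" "0 < y" "0 < z"
  shows "(f + g) ^ 3 \<le> (y + z)^2 * (f ^ 3 / y ^ 2 + g ^ 3 / z ^ 2)"
proof -
  define m where "m = (f + g) / (y + z)"
  have m: "0 \<le> m" "f + g = m * (y + z)" using assms by (simp_all add: m_def)
  have "y * (m ^ 3 + 3 * m ^ 2 * (f / y - m)) \<le> y * (f / y) ^ 3"
    "z * (m ^ 3 + 3 * m ^ 2 * (g / z - m)) \<le> z * (g / z) ^ 3"
    using assms m cube_ge_tangent[of "f / y" m] cube_ge_tangent[of "g / z" m] by (auto intro!: mult_left_mono)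
  moreover have "y * (f / y) ^ 3 = f ^ 3 / y ^ 2" "z * (g / z) ^ 3 = g ^ 3 / z ^ 2"
    using assms by (simp_all add: power2_eq_square power3_eq_cube)
  moreover have "y * (m ^ 3 + 3 * m ^ 2 * (f / y - m)) + z * (m ^ 3 + 3 * m ^ 2 * (g / z - m))
    = (y + z) * m ^ 3 + 3 * m ^ 2 * ((f + g) - m * (y + z))"
    using assms by (simp add: algebra_simps)
  ultimately have "(y + z) * m ^ 3 \<le> f ^ 3 / y ^ 2 + g ^ 3 / z ^ 2" using m by simp
  then have "(y + z)^2 * ((y + z) * m ^ 3) \<le> (y + z)^2 * (f ^ 3 / y ^ 2 + g ^ 3 / z ^ 2)"
    by (rule mult_left_mono) simp
  moreover have "(f + g) ^ 3 = (y + z)^2 * ((y + z) * m ^ 3)"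
    by (simp add: m power_mult_distrib power2_eq_square power3_eq_cube)
  ultimately show ?thesis by simp
qed

text \<open>The cube root of the energy is subadditive in the first set. Measured against the cube
  of the cardinality, a bound passes to disjoint unions with the same constant, however many are
  taken.\<close>

lemma energy3_union_le:
  assumes fin: "finite Y" "finite Z" "finite C" and disj: "Y \<inter> Z = {}"
    and Y: "energy3 f Y C \<le> \<kappa> * real (card Y) ^ 3" and Z: "energy3 f Z C \<le> \<kappa> * real (card Z) ^ 3"
  shows "energy3 f (Y \<union> Z) C \<le> \<kappa> * real (card (Y \<union> Z)) ^ 3"
proof (cases "Y = {} \<or> Z = {}")
  case True
  then show ?thesis using Y Z by auto
next
  case False
  define y z where "y = real (card Y)" and "z = real (card Z)"
  have yz: "0 < y" "0 < z" using False fin by (auto simp: y_def z_def card_gt_0_iff)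
  let ?Xs = "opset f (Y \<union> Z) C"
  have Xs: "finite ?Xs" "opset f Y C \<subseteq> ?Xs" "opset f Z C \<subseteq> ?Xs"
    using fin by (auto simp: finite_opset) (auto simp: opset_def)
  have rep: "rep f (Y \<union> Z) C x = rep f Y C x + rep f Z C x" for x
    unfolding rep_def using fin disj by (subst card_Un_disjoint[symmetric]) (auto intro!: arg_cong[where f = card])
  have "energy3 f (Y \<union> Z) C = (\<Sum>x\<in>?Xs. (real (rep f Y C x) + real (rep f Z C x)) ^ 3)"
    by (simp add: energy3_def rep)
  also have "\<dots> \<le> (\<Sum>x\<in>?Xs. (y + z)^2 * (real (rep f Y C x) ^ 3 / y ^ 2 + real (rep f Z C x) ^ 3 / z ^ 2))"
    using yz by (intro sum_mono cube_add_le) auto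
  also have "\<dots> = (y + z)^2 * (energy3 f Y C / y ^ 2 + energy3 f Z C / z ^ 2)"
    by (simp add: energy3_superset[OF Xs(1,2)] energy3_superset[OF Xs(1,3)]
        sum_distrib_left sum_divide_distrib sum.distrib distrib_left)
  also have "\<dots> \<le> (y + z)^2 * (\<kappa> * y ^ 3 / y ^ 2 + \<kappa> * z ^ 3 / z ^ 2)"
    using Y Z by (intro mult_left_mono add_mono divide_right_mono) (auto simp: y_def z_def)
  also have "\<dots> = \<kappa> * (y + z) ^ 3"
    using yz by (simp add: power2_eq_square power3_eq_cube field_simps)
  finally show ?thesis using fin disj by (simp add: card_Un_disjoint y_def z_def)
qed

text \<open>A level set \<open>Xs\<close> of popular sums carries the energy, and up to a logarithm
  its mass sits on the elements \<open>A'\<close> with many representations \<open>x - b\<close>.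
  \<open>product_level_set_bound\<close> turns these into rich lines, for every \<open>C\<close>
  with the same \<open>A'\<close>.\<close>

lemma product_energy_of_sum_energy:
  fixes A B :: "'a::field set" and N \<beta> :: nat
  assumes fin: "finite A" "finite B" and nz: "0 \<notin> A" and N: "card A \<le> N" "card B \<le> \<beta>"
    and \<Delta>: "1 \<le> \<Delta>" and E: "\<Delta> * real (card A) * real (card B) ^ 2 < energy3 (+) A B"
    and \<Lambda>: "harm (N * \<beta> * \<beta>) \<le> \<Lambda>"
    and char: "\<And>i. 0 < i \<Longrightarrow> real i ^ 2 \<le> 108 * \<Lambda> * real N ^ 2 * real \<beta> ^ 3 \<Longrightarrow> of_nat i \<noteq> (0::'a)"
  shows "\<exists>A'\<subseteq>A. A' \<noteq> {} \<and> (\<forall>C. finite C \<longrightarrow> 0 \<notin> C \<longrightarrow> card C \<le> \<beta> \<longrightarrow>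
    energy3 (*) A' C \<le> 72000 * \<Lambda> ^ 6 / (\<Delta> * real (card A)) * real (card C) ^ 2 * real (card A') ^ 3)"
proof -
  define a b where "a = real (card A)" and "b = real (card B)"
  have ne: "A \<noteq> {}" "B \<noteq> {}"
    using E by (auto simp: energy3_def opset_def)
  then have ab: "0 < a" "0 < b" using fin by (auto simp: a_def b_def card_gt_0_iff)
  have N0: "0 < N" "0 < \<beta>" using ab N by (auto simp: a_def b_def)
  have harm: "harm n \<le> \<Lambda>" if "n \<le> N * \<beta> * \<beta>" for n
    using harm_mono[OF that, where 'a = real] \<Lambda> by linarith
  have \<Lambda>1: "1 \<le> \<Lambda>" using harm_ge_1[of "N * \<beta> * \<beta>"] N0 \<Lambda> by simp
  have NN: "N \<le> N * \<beta> * \<beta>" "\<beta> \<le> N * \<beta> * \<beta>" using N0 by auto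

  have finS: "finite (opset (+) A B)" using fin by (rule finite_opset)
  have "rep (+) A B x \<le> card A" for x
    by (rule rep_le_left[OF fin]) (auto simp: inj_on_def algebra_simps)
  moreover have "0 < card A" using ne fin by (simp add: card_gt_0_iff)
  ultimately obtain t where t: "1 \<le> t"
    and Et: "energy3 (+) A B \<le> 3 * harm (card A) * (real t ^ 3 * real (card {x \<in> opset (+) A B. t \<le> rep (+) A B x}))"
    using layer_cake[OF finS, of "rep (+) A B" "card A" 3] unfolding energy3_def by auto
  define Xs where "Xs = {x \<in> opset (+) A B. t \<le> rep (+) A B x}"
  define x where "x = real (card Xs)"
  have finX: "finite Xs" using finS by (simp add: Xs_def)
  have "energy3 (+) A B \<le> 3 * \<Lambda> * (real t ^ 3 * x)"
    using Et harm[of "card A"] N NN unfolding Xs_def[symmetric] x_def[symmetric]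
    by (intro order_trans[OF Et[folded Xs_def, folded x_def]] mult_right_mono) (auto simp: x_def)
  then have viol: "\<Delta> * a * b ^ 2 < 3 * \<Lambda> * (real t ^ 3 * x)" using E by (simp add: a_def b_def)
  have "0 \<le> \<Delta> * a * b ^ 2" using \<Delta> ab by simp
  then have "0 < 3 * \<Lambda> * (real t ^ 3 * x)" using viol by linarith
  then have "x \<noteq> 0" by auto
  then have x0: "0 < x" by (simp add: x_def)
  have "card Xs * t \<le> card A * card B"
    using fin finX by (intro sum_rep_ge) (auto simp: Xs_def)
  from of_nat_mono[OF this, where 'a = real] have xt: "x * real t \<le> a * b" by (simp add: x_def a_def b_def)
  \<comment> \<open>Keeps \<open>card C * card Xs\<close> small against the characteristic; the
    square of 6 times this 3 is the 108 in \<open>char\<close>.\<close>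
  have x_bound: "x ^ 2 \<le> 3 * \<Lambda> * a ^ 2 * b"
  proof -
    have "1 * (a * b ^ 2) \<le> \<Delta> * (a * b ^ 2)" using \<Delta> ab by (intro mult_right_mono) auto
    then have "a * b ^ 2 \<le> 3 * \<Lambda> * real t ^ 2 * (x * real t)"
      using viol by (simp add: power2_eq_square power3_eq_cube mult_ac)
    also have "\<dots> \<le> 3 * \<Lambda> * real t ^ 2 * (a * b)" using xt \<Lambda>1 by (intro mult_left_mono) auto
    finally have "(a * b) * b \<le> (a * b) * (3 * \<Lambda> * real t ^ 2)" by (simp add: power2_eq_square mult_ac)
    then have b_le: "b \<le> 3 * \<Lambda> * real t ^ 2" by (rule mult_left_le_imp_le) (use ab in simp)
    have "b * x ^ 2 \<le> 3 * \<Lambda> * real t ^ 2 * x ^ 2" using b_le by (rule mult_right_mono) simp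
    also have "\<dots> = 3 * \<Lambda> * (x * real t) ^ 2" by (simp add: power_mult_distrib)
    also have "\<dots> \<le> 3 * \<Lambda> * (a * b) ^ 2" using xt \<Lambda>1 x0 by (intro mult_left_mono power_mono) auto
    finally have "b * x ^ 2 \<le> b * (3 * \<Lambda> * a ^ 2 * b)" by (simp add: power_mult_distrib power2_eq_square mult_ac)
    then show ?thesis by (rule mult_left_le_imp_le) (use ab in simp)
  qed

  have "(\<Sum>u\<in>A. rep (-) Xs B u) = (\<Sum>v\<in>Xs. rep (+) A B v)"
    unfolding sum_rep[OF finX fin(2,1)] sum_rep[OF fin finX]
    by (rule bij_betw_same_card[of "\<lambda>(u, v). (u - v, v)"],
        rule bij_betw_byWitness[where f' = "\<lambda>(u, v). (u + v, v)"]) auto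
  also have "\<dots> \<ge> card Xs * t"
    using sum_mono[of Xs "\<lambda>_. t" "rep (+) A B"] by (simp add: Xs_def)
  finally have sumX: "card Xs * t \<le> (\<Sum>u\<in>A. rep (-) Xs B u)" .
  have "rep (-) Xs B u \<le> card B" for u
    by (rule rep_le_right[OF finX fin(2)]) (auto simp: inj_on_def)
  moreover have "0 < card B" using ne fin by (simp add: card_gt_0_iff)
  ultimately obtain \<tau> where \<tau>: "1 \<le> \<tau>"
    and E\<tau>: "(\<Sum>u\<in>A. real (rep (-) Xs B u)) \<le> harm (card B) * (real \<tau> * real (card {u \<in> A. \<tau> \<le> rep (-) Xs B u}))"
    using layer_cake[OF fin(1), of "rep (-) Xs B" "card B" 1] by auto
  define A' where "A' = {u \<in> A. \<tau> \<le> rep (-) Xs B u}"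
  define a' where "a' = real (card A')"
  have finA': "finite A'" using fin by (simp add: A'_def)
  have "x * real t \<le> (\<Sum>u\<in>A. real (rep (-) Xs B u))"
    using of_nat_mono[OF sumX, where 'a = real] by (simp add: x_def)
  also have "\<dots> \<le> harm (card B) * (real \<tau> * a')" using E\<tau> by (simp add: A'_def a'_def)
  also have "\<dots> \<le> \<Lambda> * (real \<tau> * a')"
    using harm[of "card B"] N NN by (intro mult_right_mono) (auto simp: a'_def)
  finally have xt_le: "x * real t \<le> \<Lambda> * (real \<tau> * a')" .
  have "0 < x * real t" using x0 t by simp
  then have "0 < \<Lambda> * (real \<tau> * a')" using xt_le by linarith
  then have "a' \<noteq> 0" by auto
  then have a'0: "0 < a'" by (simp add: a'_def)

  have "energy3 (*) A' C \<le> 72000 * \<Lambda> ^ 6 / (\<Delta> * a) * real (card C) ^ 2 * a' ^ 3"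
    if C: "finite C" "0 \<notin> C" "card C \<le> \<beta>" for C
  proof (cases "C = {}")
    case True
    then show ?thesis by (simp add: energy3_def opset_def)
  next
    case False
    define c where "c = real (card C)"
    have "c \<le> real \<beta>" using C by (simp add: c_def)
    have cx: "card C * card Xs \<le> N * \<beta> * \<beta>"
    proof -
      have "card Xs * 1 \<le> card Xs * t" using t by simp
      also have "\<dots> \<le> card A * card B" by fact
      finally have "card C * card Xs \<le> \<beta> * (card A * card B)" using C by (intro mult_le_mono) auto
      also have "\<dots> \<le> \<beta> * (N * \<beta>)" using N by (intro mult_le_mono) auto
      finally show ?thesis by (simp add: ac_simps)
    qed
    have char': "of_nat i \<noteq> (0::'a)" if i: "0 < i" "i \<le> 6 * card C * card Xs" for i
    proof (rule char[OF i(1)])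
      have "real i \<le> 6 * c * x" using of_nat_mono[OF i(2), where 'a = real] by (simp add: c_def x_def)
      then have "real i ^ 2 \<le> (6 * c * x) ^ 2" by (rule power_mono) simp
      also have "\<dots> = 36 * c ^ 2 * x ^ 2" by (simp add: power_mult_distrib)
      also have "\<dots> \<le> 36 * real \<beta> ^ 2 * (3 * \<Lambda> * a ^ 2 * b)"
        using \<open>c \<le> real \<beta>\<close> x_bound by (intro mult_mono power_mono) (auto simp: c_def)
      also have "\<dots> \<le> 36 * real \<beta> ^ 2 * (3 * \<Lambda> * real N ^ 2 * real \<beta>)"
        using N ab \<Lambda>1 by (intro mult_left_mono mult_mono power_mono) (auto simp: a_def b_def)
      also have "\<dots> = 108 * \<Lambda> * real N ^ 2 * real \<beta> ^ 3" by (simp add: power2_eq_square power3_eq_cube)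
      finally show "real i ^ 2 \<le> 108 * \<Lambda> * real N ^ 2 * real \<beta> ^ 3" .
    qed
    have nzA': "0 \<notin> A'" using nz by (simp add: A'_def)
    have finZ: "finite (opset (*) A' C)" using finA' C by (simp add: finite_opset)
    have "rep (*) A' C z \<le> card C" for z
      by (rule rep_le_right[OF finA' C(1)]) (use nzA' C in \<open>auto simp: inj_on_def\<close>)
    moreover have "0 < card C" using False C by (simp add: card_gt_0_iff)
    ultimately obtain \<sigma> where \<sigma>: "1 \<le> \<sigma>"
      and E\<sigma>: "energy3 (*) A' C \<le> 3 * harm (card C) * (real \<sigma> ^ 3 * real (card {z \<in> opset (*) A' C. \<sigma> \<le> rep (*) A' C z}))"
      using layer_cake[OF finZ, of "rep (*) A' C" "card C" 3] unfolding energy3_def by auto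
    define z where "z = real (card {z \<in> opset (*) A' C. \<sigma> \<le> rep (*) A' C z})"
    have zb: "z * (real \<sigma> * real \<tau>) ^ 3 \<le> 8000 * \<Lambda> * (x * b * c)^2"
      unfolding z_def x_def b_def c_def
      by (rule product_level_set_bound[OF finA' fin(2) C(1) finX nzA' C(2)])
        (use \<tau> \<sigma> char' harm[OF cx] \<Lambda>1 in \<open>auto simp: A'_def\<close>)
    have E1: "energy3 (*) A' C \<le> 3 * \<Lambda> * (real \<sigma> ^ 3 * z)"
      using harm[of "card C"] C NN
      by (intro order_trans[OF E\<sigma>[folded z_def]] mult_right_mono) (auto simp: z_def)
    \<comment> \<open>In the product of the three inequalities \<open>t\<close>, \<open>x\<close>,
      \<open>\<sigma>\<close> and \<open>\<tau>\<close> cancel, and 72000 is 9 times the 8000 of the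
      level set bound.\<close>
    have "energy3 (*) A' C * (\<Delta> * a * b ^ 2) * (x * real t) ^ 3
       \<le> (3 * \<Lambda> * (real \<sigma> ^ 3 * z)) * (3 * \<Lambda> * (real t ^ 3 * x)) * (\<Lambda> * (real \<tau> * a')) ^ 3"
      by (rule mult_mono[OF mult_mono[OF E1 less_imp_le[OF viol]] power_mono[OF xt_le]])
        (use x0 \<Lambda>1 \<Delta> ab in \<open>auto simp: z_def energy3_def intro!: sum_nonneg mult_nonneg_nonneg\<close>)
    also have "\<dots> = (9 * \<Lambda> ^ 5 * a' ^ 3 * (real t ^ 3 * x)) * (z * (real \<sigma> * real \<tau>) ^ 3)"
      by (simp add: power_mult_distrib eval_nat_numeral)
    also have "\<dots> \<le> (9 * \<Lambda> ^ 5 * a' ^ 3 * (real t ^ 3 * x)) * (8000 * \<Lambda> * (x * b * c)^2)"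
      using zb \<Lambda>1 x0 a'0 by (intro mult_left_mono) auto
    also have "\<dots> = (72000 * \<Lambda> ^ 6 * c ^ 2 * a' ^ 3) * (b ^ 2 * (x * real t) ^ 3)"
      by (simp add: power_mult_distrib eval_nat_numeral)
    finally have "(energy3 (*) A' C * (\<Delta> * a)) * (b ^ 2 * (x * real t) ^ 3)
      \<le> (72000 * \<Lambda> ^ 6 * c ^ 2 * a' ^ 3) * (b ^ 2 * (x * real t) ^ 3)" by (simp only: mult_ac)
    then have "energy3 (*) A' C * (\<Delta> * a) \<le> 72000 * \<Lambda> ^ 6 * c ^ 2 * a' ^ 3"
      by (rule mult_right_le_imp_le) (use ab x0 t in simp)
    then show ?thesis using \<Delta> ab by (simp add: field_simps c_def)
  qed
  moreover have "A' \<noteq> {}" using a'0 by (auto simp: a'_def)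
  moreover have "A' \<subseteq> A" by (auto simp: A'_def)
  ultimately show ?thesis unfolding a_def a'_def by blast
qed

text \<open>
  A maximal \<open>Y\<close> with small multiplicative energies contains at least half of \<open>A\<close>, since otherwise
  \<open>A - Y\<close> would contain another such set, and by \<open>energy3_union_le\<close> it could be added to \<open>Y\<close>.
\<close>

lemma additive_or_multiplicative_control:
  fixes A :: "'a::field set" and N \<beta> :: nat
  assumes fin: "finite A" and nz: "0 \<notin> A" and N: "card A \<le> N" and ne: "A \<noteq> {}" and \<Delta>: "1 \<le> \<Delta>"
    and \<Lambda>: "harm (N * \<beta> * \<beta>) \<le> \<Lambda>"
    and char: "\<And>i. 0 < i \<Longrightarrow> real i ^ 2 \<le> 108 * \<Lambda> * real N ^ 2 * real \<beta> ^ 3 \<Longrightarrow> of_nat i \<noteq> (0::'a)"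
    and viol: "\<And>A1. A1 \<subseteq> A \<Longrightarrow> card A \<le> 2 * card A1 \<Longrightarrow>
      \<exists>B. finite B \<and> card B \<le> \<beta> \<and> \<Delta> * real (card A1) * real (card B) ^ 2 < energy3 (+) A1 B"
  shows "\<exists>Y\<subseteq>A. card A \<le> 2 * card Y \<and> (\<forall>C. finite C \<longrightarrow> 0 \<notin> C \<longrightarrow> card C \<le> \<beta> \<longrightarrow>
    energy3 (*) Y C \<le> 144000 * \<Lambda> ^ 6 / (\<Delta> * real (card A)) * real (card C) ^ 2 * real (card Y) ^ 3)"
proof -
  define \<kappa> where "\<kappa> = 144000 * \<Lambda> ^ 6 / (\<Delta> * real (card A))"
  define good where "good Y \<longleftrightarrow> (\<forall>C. finite C \<longrightarrow> 0 \<notin> C \<longrightarrow> card C \<le> \<beta> \<longrightarrow>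
    energy3 (*) Y C \<le> \<kappa> * real (card C) ^ 2 * real (card Y) ^ 3)" for Y :: "'a set"
  have "good {}" by (simp add: good_def energy3_def opset_def)
  define F where "F = {Y \<in> Pow A. good Y}"
  have F: "finite F" "F \<noteq> {}" unfolding F_def using fin \<open>good {}\<close> by auto
  then have "Max (card ` F) \<in> card ` F" by (intro Max_in) auto
  then obtain Y where "Y \<in> F" and "card Y = Max (card ` F)" by auto
  then have max: "card Y' \<le> card Y" if "Y' \<in> F" for Y' using that F by simp
  from \<open>Y \<in> F\<close>
  have Y: "Y \<subseteq> A" "good Y" by (auto simp: F_def)
  have "card A \<le> 2 * card Y"
  proof (rule ccontr)
    assume less: "\<not> card A \<le> 2 * card Y"
    have "card (A - Y) = card A - card Y" using fin Y by (simp add: card_Diff_subset finite_subset)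
    then have half: "card A \<le> 2 * card (A - Y)" using less by linarith
    obtain B where B: "finite B" "card B \<le> \<beta>"
      "\<Delta> * real (card (A - Y)) * real (card B) ^ 2 < energy3 (+) (A - Y) B"
      using viol[OF _ half] by blast
    have "card (A - Y) \<le> N" using N fin by (meson Diff_subset card_mono le_trans)
    from product_energy_of_sum_energy[OF _ B(1) _ this B(2) \<Delta> B(3) \<Lambda> char] fin nz
    obtain A' where A': "A' \<subseteq> A - Y" "A' \<noteq> {}" and EA': "\<And>C. finite C \<Longrightarrow> 0 \<notin> C \<Longrightarrow> card C \<le> \<beta> \<Longrightarrow>
       energy3 (*) A' C \<le> 72000 * \<Lambda> ^ 6 / (\<Delta> * real (card (A - Y))) * real (card C) ^ 2 * real (card A') ^ 3"
      by auto
    have finA': "finite A'" "finite Y" using fin A' Y by (auto intro: finite_subset)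
    \<comment> \<open>The new set was found inside \<open>A - Y\<close>, which has at least half of
      the elements of \<open>A\<close>; this doubles 72000.\<close>
    have \<kappa>_le: "72000 * \<Lambda> ^ 6 / (\<Delta> * real (card (A - Y))) \<le> \<kappa>"
    proof -
      have "0 < card A" using fin ne by (simp add: card_gt_0_iff)
      moreover from this have "0 < card (A - Y)" using half by linarith
      moreover have "\<Delta> * real (card A) \<le> \<Delta> * (2 * real (card (A - Y)))" using half \<Delta> by (intro mult_left_mono) auto
      moreover have "0 \<le> \<Lambda> ^ 6" by (rule zero_le_even_power) simp
      ultimately have "144000 * \<Lambda> ^ 6 / (\<Delta> * (2 * real (card (A - Y)))) \<le> \<kappa>"
        unfolding \<kappa>_def using \<Delta> by (intro divide_left_mono) auto
      then show ?thesis by simp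
    qed
    have "good (Y \<union> A')"
      unfolding good_def
    proof (intro allI impI)
      fix C :: "'a set" assume C: "finite C" "0 \<notin> C" "card C \<le> \<beta>"
      show "energy3 (*) (Y \<union> A') C \<le> \<kappa> * real (card C) ^ 2 * real (card (Y \<union> A')) ^ 3"
      proof (rule energy3_union_le)
        show "energy3 (*) Y C \<le> \<kappa> * real (card C) ^ 2 * real (card Y) ^ 3"
          using Y C by (simp add: good_def)
        show "energy3 (*) A' C \<le> \<kappa> * real (card C) ^ 2 * real (card A') ^ 3"
          using \<kappa>_le by (intro order_trans[OF EA'[OF C]] mult_right_mono) auto
      qed (use finA' C A' in auto)
    qed
    then have "card (Y \<union> A') \<le> card Y" using max[of "Y \<union> A'"] Y A' by (auto simp: F_def)
    moreover have "card (Y \<union> A') = card Y + card A'" using finA' A' by (intro card_Un_disjoint) auto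
    moreover have "0 < card A'" using finA' A' by (simp add: card_gt_0_iff)
    ultimately show False by linarith
  qed
  with Y show ?thesis unfolding good_def \<kappa>_def by blast
qed

section \<open>The sum-product estimate\<close>

lemma harm_le_ln: "0 < n \<Longrightarrow> harm n \<le> 1 + ln (real n)"
  using euler_mascheroni_sequence_decreasing[of 1 n] by (simp add: harm_expand)

lemma energy3_inj_hom:
  assumes h: "inj h" "\<And>u v. h (f u v) = g (h u) (h v)"
  shows "opset g (h ` U) (h ` V) = h ` opset f U V"
    and "energy3 g (h ` U) (h ` V) = energy3 f U V"
proof -
  show op: "opset g (h ` U) (h ` V) = h ` opset f U V"
    by (force simp: opset_def h(2))
  have "rep g (h ` U) (h ` V) (h x) = rep f U V x" for x
  proof -
    have "{p \<in> h ` U \<times> h ` V. g (fst p) (snd p) = h x} = map_prod h h ` {p \<in> U \<times> V. f (fst p) (snd p) = x}"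
      using h(1) by (auto simp flip: h(2) simp: inj_eq)
    then show ?thesis
      unfolding rep_def using h(1) by (simp add: card_image inj_on_subset[OF prod.inj_map])
  qed
  then show "energy3 g (h ` U) (h ` V) = energy3 f U V"
    unfolding energy3_def op using h(1) by (subst sum.reindex) (auto intro: inj_on_subset)
qed

text \<open>The multiplicative group in additive notation, with 1 as its zero, so that
  \<open>energy_sumset_bound\<close>, stated for \<open>ab_group_add\<close>, applies to product
  sets.\<close>

typedef (overloaded) ('a::field) nonzero = "{x :: 'a. x \<noteq> 0}"
  by (rule exI[of _ 1]) simp

setup_lifting type_definition_nonzero

instantiation nonzero :: (field) ab_group_add
begin

lift_definition zero_nonzero :: "'a nonzero" is 1 by simp
lift_definition plus_nonzero :: "'a nonzero \<Rightarrow> 'a nonzero \<Rightarrow> 'a nonzero" is "(*)" by simp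
lift_definition uminus_nonzero :: "'a nonzero \<Rightarrow> 'a nonzero" is inverse by simp
lift_definition minus_nonzero :: "'a nonzero \<Rightarrow> 'a nonzero \<Rightarrow> 'a nonzero" is "(/)" by simp

instance
  by standard (transfer; simp add: field_simps)+

end

lemma energy_productset_bound:
  fixes Y :: "'a::field set" and d \<Lambda> :: real
  assumes fin: "finite Y" and ne: "Y \<noteq> {}" and nz: "0 \<notin> Y" and \<Lambda>: "harm (card Y) \<le> \<Lambda>"
    and ctl: "\<And>C. finite C \<Longrightarrow> 0 \<notin> C \<Longrightarrow> card C \<le> 32 * card (opset (*) Y Y) \<Longrightarrow>
      energy3 (*) Y C \<le> d * card Y * real (card C) ^ 2"
  shows "real (card Y) ^ 30 \<le> 64^9 * 54^6 * \<Lambda>^9 * d^11 * real (card (opset (*) Y Y)) ^ 19"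
proof -
  let ?R = "Rep_nonzero :: 'a nonzero \<Rightarrow> 'a"
  define U where "U = Abs_nonzero ` Y"
  have inj: "inj ?R" by (simp add: inj_def Rep_nonzero_inject)
  have card_R: "card (?R ` B) = card B" for B by (rule card_image) (rule inj_on_subset[OF inj], simp)
  have Y: "Y = ?R ` U"
  proof -
    have "?R ` U = (\<lambda>x. x) ` Y"
      unfolding U_def image_image using nz by (intro image_cong) (auto intro: Abs_nonzero_inverse)
    then show ?thesis by simp
  qed
  have R0: "?R x \<noteq> 0" for x using Rep_nonzero[of x] by simp
  have hom: "?R (u + v) = ?R u * ?R v" for u v by (rule plus_nonzero.rep_eq)
  note tr = energy3_inj_hom[where h = ?R and f = "(+)" and g = "(*)", OF inj hom]
  have "real (card U) ^ 30 \<le> 64^9 * 54^6 * \<Lambda>^9 * d^11 * real (card (opset (+) U U)) ^ 19"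
  proof (rule energy_sumset_bound)
    fix B :: "'a nonzero set" assume B: "finite B" "card B \<le> 32 * card (opset (+) U U)"
    have "energy3 (*) Y (?R ` B) \<le> d * card Y * real (card (?R ` B)) ^ 2"
      using B R0 by (intro ctl) (auto simp: card_R Y tr)
    then show "energy3 (+) U B \<le> d * card U * real (card B) ^ 2" by (simp add: Y tr card_R)
  next
    have "card U = card Y" using card_R[of U] Y by simp
    then show "harm (card U) \<le> \<Lambda>" using \<Lambda> by simp
  qed (use fin ne in \<open>auto simp: U_def\<close>)
  then show ?thesis by (simp add: Y tr card_R)
qed

text \<open>Additive control on half of \<open>A - {0}\<close> would contradict \<open>add\<close>
  through \<open>energy_sumset_bound\<close>. So there is multiplicative control on some half, which
  gives the same inequality with \<open>n / \<Delta>\<close> for \<open>\<Delta>\<close>. The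
  quarter comes from halving twice, once for removing zero and once for the subset.\<close>

lemma sum_product_dichotomy:
  fixes A :: "'a::field set"
  assumes fin: "finite A" and n: "2 \<le> card A" and W: "card (opset (+) A A) \<le> W" "card (opset (*) A A) \<le> W"
    and \<Lambda>: "harm (card A * (32 * W) * (32 * W)) \<le> \<Lambda>" and \<Delta>: "1 \<le> \<Delta>"
    and char: "\<And>i. 0 < i \<Longrightarrow> real i ^ 2 \<le> 108 * \<Lambda> * real (card A) ^ 2 * real (32 * W) ^ 3 \<Longrightarrow> of_nat i \<noteq> (0::'a)"
    and add: "64^9 * 54^6 * \<Lambda>^9 * \<Delta>^11 * real W ^ 19 < (real (card A) / 4) ^ 30"
  shows "(real (card A) / 4) ^ 30 \<le> 64^9 * 54^6 * \<Lambda>^9 * (288000 * \<Lambda>^6 * real (card A) / \<Delta>)^11 * real W ^ 19"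
proof -
  define A0 where "A0 = A - {0}"
  have A0: "finite A0" "0 \<notin> A0" "A0 \<subseteq> A" using fin by (auto simp: A0_def)
  have card_A0: "card A \<le> 2 * card A0" "card A0 \<le> card A"
    using fin n by (auto simp: A0_def card_Diff_singleton_if)
  have ne: "A0 \<noteq> {}" using card_A0 n by auto
  have "opset (+) A A \<noteq> {}" using n by (auto simp: opset_def)
  then have "0 < W" using W fin by (metis card_gt_0_iff finite_opset le_zero_eq not_gr_zero)
  have harm: "harm m \<le> \<Lambda>" if "m \<le> card A" for m
  proof -
    have "m \<le> card A * (32 * W) * (32 * W)" using that \<open>0 < W\<close> by (intro order_trans[OF that]) auto
    then show ?thesis using harm_mono[of m "card A * (32 * W) * (32 * W)", where 'a = real] \<Lambda> by linarith
  qed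
  have \<Lambda>1: "1 \<le> \<Lambda>" using harm_ge_1[of 1] harm[of 1] n by simp
  have card_op: "card (opset f B B) \<le> card (opset f A A)" if "B \<subseteq> A" for f :: "'a \<Rightarrow> 'a \<Rightarrow> 'a" and B
    using that fin by (intro card_mono finite_opset) (auto simp: opset_def)
  have "\<exists>B. finite B \<and> card B \<le> 32 * W \<and> \<Delta> * real (card A1) * real (card B) ^ 2 < energy3 (+) A1 B"
    if A1: "A1 \<subseteq> A0" "card A0 \<le> 2 * card A1" for A1
  proof (rule ccontr)
    assume no: "\<nexists>B. finite B \<and> card B \<le> 32 * W \<and> \<Delta> * real (card A1) * real (card B) ^ 2 < energy3 (+) A1 B"
    have sub: "A1 \<subseteq> A" using A1 A0 by auto
    have "card A1 \<le> card A" using sub fin by (rule card_mono[rotated])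
    have "real (card A1) ^ 30 \<le> 64^9 * 54^6 * \<Lambda>^9 * \<Delta>^11 * real (card (opset (+) A1 A1)) ^ 19"
    proof (rule energy_sumset_bound)
      show "finite A1" using sub fin by (rule finite_subset)
      show "A1 \<noteq> {}" using A1 card_A0 n by auto
      show "harm (card A1) \<le> \<Lambda>" by (rule harm) fact
      show "energy3 (+) A1 B \<le> \<Delta> * card A1 * real (card B) ^ 2"
        if "finite B" "card B \<le> 32 * card (opset (+) A1 A1)" for B
        using no that card_op[OF sub, of "(+)"] W(1) by (meson le_trans mult_le_mono2 not_le)
    qed
    also have "\<dots> \<le> 64^9 * 54^6 * \<Lambda>^9 * \<Delta>^11 * real W ^ 19"
      using card_op[OF sub, of "(+)"] W(1) \<Lambda>1 \<Delta> by (intro mult_left_mono power_mono) auto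
    also note add
    finally have "real (card A1) ^ 30 < (real (card A) / 4) ^ 30" .
    then have "real (card A1) < real (card A) / 4" by (rule power_less_imp_less_base) simp
    then show False using A1 card_A0 by linarith
  qed
  from additive_or_multiplicative_control[OF A0(1,2) card_A0(2) ne \<Delta> \<Lambda> char this]
  obtain Y where Y: "Y \<subseteq> A0" "card A0 \<le> 2 * card Y"
    and EY: "\<And>C. finite C \<Longrightarrow> 0 \<notin> C \<Longrightarrow> card C \<le> 32 * W \<Longrightarrow>
      energy3 (*) Y C \<le> 144000 * \<Lambda> ^ 6 / (\<Delta> * real (card A0)) * real (card C) ^ 2 * real (card Y) ^ 3"
    by blast
  have subY: "Y \<subseteq> A" using Y A0 by auto
  have cardY: "card Y \<le> card A" using subY fin by (rule card_mono[rotated])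
  \<comment> \<open>The control is cubic in \<open>card Y\<close>; two of the three factors go into
    the parameter.\<close>
  define d where "d = 144000 * \<Lambda> ^ 6 / (\<Delta> * real (card A0)) * real (card Y) ^ 2"
  have A0_pos: "0 < real (card A0)" using ne A0 by (simp add: card_gt_0_iff)
  have "0 \<le> d" unfolding d_def using \<Lambda>1 \<Delta> A0_pos by simp
  have "real (card A0) * d = 144000 * \<Lambda> ^ 6 / \<Delta> * real (card Y) ^ 2" using A0_pos by (simp add: d_def)
  also have "\<dots> \<le> 144000 * \<Lambda> ^ 6 / \<Delta> * real (card A) ^ 2"
    using cardY \<Lambda>1 \<Delta> by (intro mult_left_mono power_mono) auto
  also have "\<dots> = 144000 * \<Lambda> ^ 6 / \<Delta> * real (card A) * real (card A)" by (simp add: power2_eq_square)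
  also have "\<dots> \<le> 144000 * \<Lambda> ^ 6 / \<Delta> * real (card A) * (2 * real (card A0))"
    using card_A0 \<Lambda>1 \<Delta> by (intro mult_left_mono) auto
  also have "\<dots> = real (card A0) * (288000 * \<Lambda>^6 * real (card A) / \<Delta>)" by simp
  finally have d: "d \<le> 288000 * \<Lambda>^6 * real (card A) / \<Delta>"
    by (rule mult_left_le_imp_le) fact
  have "(real (card A) / 4) ^ 30 \<le> real (card Y) ^ 30" using Y card_A0 by (intro power_mono) auto
  also have "\<dots> \<le> 64^9 * 54^6 * \<Lambda>^9 * d^11 * real (card (opset (*) Y Y)) ^ 19"
  proof (rule energy_productset_bound)
    show "finite Y" using subY fin by (rule finite_subset)
    show "Y \<noteq> {}" using Y card_A0 n by auto
    show "0 \<notin> Y" using Y A0 by auto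
    show "harm (card Y) \<le> \<Lambda>" by (rule harm) fact
    show "energy3 (*) Y C \<le> d * card Y * real (card C) ^ 2"
      if "finite C" "0 \<notin> C" "card C \<le> 32 * card (opset (*) Y Y)" for C
    proof -
      have "card C \<le> 32 * W" using that card_op[OF subY, of "(*)"] W(2) by linarith
      from EY[OF that(1,2) this] show ?thesis by (simp add: d_def power2_eq_square power3_eq_cube mult_ac)
    qed
  qed
  also have "\<dots> \<le> 64^9 * 54^6 * \<Lambda>^9 * (288000 * \<Lambda>^6 * real (card A) / \<Delta>)^11 * real W ^ 19"
    using card_op[OF subY, of "(*)"] W(2) \<Lambda>1 \<Delta> d \<open>0 \<le> d\<close>
    by (intro mult_mono mult_left_mono power_mono) auto
  finally show ?thesis .
qed

text \<open>\<open>11 + 4 * ln x\<close> bounds the harmonic numbers. For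
  \<open>\<Delta> = x^(1/2 + \<epsilon>)\<close> and \<open>W < x^(49/38 - \<epsilon>)\<close> the
  additive and the multiplicative case leave the spare factors \<open>x^(8 \<epsilon>)\<close> and
  \<open>x^(30 \<epsilon>)\<close>; 75 is 9 + 6 * 11. The last line serves the characteristic, with
  \<open>5/38 = 6 - 2 - 3 * 49/38\<close>.\<close>

definition large_enough :: "real \<Rightarrow> real \<Rightarrow> bool" where
  "large_enough \<epsilon> x \<longleftrightarrow> 2 \<le> x \<and>
    4^30 * (64^9 * 54^6 * (11 + 4 * ln x)^9) < x powr (8 * \<epsilon>) \<and>
    4^30 * (64^9 * 54^6 * 288000^11 * (11 + 4 * ln x)^75) < x powr (30 * \<epsilon>) \<and>
    108 * 32^3 * (11 + 4 * ln x) < x powr (5 / 38)"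

lemma eventually_large_enough:
  assumes "0 < \<epsilon>"
  shows "eventually (large_enough \<epsilon>) at_top"
proof -
  have "eventually (\<lambda>x. 4^30 * (64^9 * 54^6 * (11 + 4 * ln x)^9) < x powr (8 * \<epsilon>)) at_top"
    using assms by real_asymp
  moreover have "eventually (\<lambda>x. 4^30 * (64^9 * 54^6 * 288000^11 * (11 + 4 * ln x)^75) < x powr (30 * \<epsilon>)) at_top"
    using assms by real_asymp
  moreover have "eventually (\<lambda>x::real. 108 * 32^3 * (11 + 4 * ln x) < x powr (5 / 38)) at_top"
    by real_asymp
  ultimately show ?thesis
    unfolding large_enough_def by (intro eventually_conj eventually_ge_at_top)
qed

lemma sum_product_large:
  fixes A :: "'a::field set"
  assumes \<epsilon>: "0 < \<epsilon>" and fin: "finite A" and large: "large_enough \<epsilon> (real (card A))"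
    and char: "\<And>i. 0 < i \<Longrightarrow> i < card A ^ 3 \<Longrightarrow> of_nat i \<noteq> (0::'a)"
  shows "real (card A) powr (49 / 38 - \<epsilon>) \<le> real (max (card (opset (+) A A)) (card (opset (*) A A)))"
proof (rule ccontr)
  define W where "W = max (card (opset (+) A A)) (card (opset (*) A A))"
  define x where "x = real (card A)"
  define w where "w = x powr (49 / 38 - \<epsilon>)"
  define \<Lambda> where "\<Lambda> = 11 + 4 * ln x"
  define \<Delta> where "\<Delta> = x powr (1 / 2 + \<epsilon>)"
  assume "\<not> real (card A) powr (49 / 38 - \<epsilon>) \<le> real (max (card (opset (+) A A)) (card (opset (*) A A)))"
  then have W: "real W < w" by (simp add: W_def w_def x_def)
  have x: "2 \<le> x" and
    L1: "4^30 * (64^9 * 54^6 * \<Lambda>^9) < x powr (8 * \<epsilon>)" and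
    L2: "4^30 * (64^9 * 54^6 * 288000^11 * \<Lambda>^75) < x powr (30 * \<epsilon>)" and
    L3: "108 * 32^3 * \<Lambda> < x powr (5 / 38)"
    using large by (simp_all add: large_enough_def x_def \<Lambda>_def)
  have \<Lambda>: "1 \<le> \<Lambda>" using x by (simp add: \<Lambda>_def)
  have pw: "(x powr a) ^ m = x powr (a * real m)" for a m
    using x by (simp add: powr_powr flip: powr_realpow)
  have xn: "x ^ m = x powr real m" for m using x by (simp add: powr_realpow)
  have "A \<noteq> {}" using x by (auto simp: x_def)
  then have W0: "0 < W" using fin by (simp add: W_def opset_def card_gt_0_iff less_max_iff_disj)
  have wn: "w ^ m \<le> x powr (49 / 38 * real m)" for m
    unfolding w_def pw using x \<epsilon> by (intro powr_mono mult_right_mono) auto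
  have "harm (card A * (32 * W) * (32 * W)) \<le> 1 + ln (real (card A * (32 * W) * (32 * W)))"
    using W0 x by (intro harm_le_ln) (auto simp: x_def)
  also have "real (card A * (32 * W) * (32 * W)) = 1024 * (x * real W ^ 2)"
    by (simp add: x_def power2_eq_square)
  \<comment> \<open>As \<open>2 * 49/38 < 3\<close>, the argument is at most
    \<open>2^10 x^4\<close>, with logarithm at most \<open>10 + 4 ln x\<close>; the 1 of
    \<open>harm_le_ln\<close> makes it 11.\<close>
  also have "ln (1024 * (x * real W ^ 2)) \<le> ln (2 ^ 10 * x ^ 4)"
  proof (subst ln_le_cancel_iff)
    have "real W ^ 2 \<le> w ^ 2" using W by (intro power_mono) auto
    also have "\<dots> \<le> x powr (49 / 38 * real 2)" by (rule wn)
    also have "\<dots> \<le> x powr 3" using x by (intro powr_mono) auto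
    also have "\<dots> = x ^ 3" using x by (simp add: powr_numeral)
    finally have "x * real W ^ 2 \<le> x * x ^ 3" using x by (intro mult_left_mono) auto
    then show "1024 * (x * real W ^ 2) \<le> 2 ^ 10 * x ^ 4" by (simp add: eval_nat_numeral)
  qed (use x W0 in auto)
  also have "ln (2 ^ 10 * x ^ 4) = 10 * ln 2 + 4 * ln x"
  proof -
    have "ln (2 ^ 10 * x ^ 4) = ln ((2::real) ^ 10) + ln (x ^ 4)" using x by (subst ln_mult) auto
    also have "ln ((2::real) ^ 10) = real 10 * ln 2" by (rule ln_realpow)
    also have "ln (x ^ 4) = real 4 * ln x" using x by (intro ln_realpow)
    finally show ?thesis by simp
  qed
  also have "1 + (10 * ln 2 + 4 * ln x) \<le> \<Lambda>" using ln_2_less_1 by (simp add: \<Lambda>_def)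
  finally have harm: "harm (card A * (32 * W) * (32 * W)) \<le> \<Lambda>" by simp
  have \<Delta>: "1 \<le> \<Delta>" unfolding \<Delta>_def using x \<epsilon> by (intro ge_one_powr_ge_zero) auto
  have \<Delta>11: "\<Delta> ^ 11 = x powr (11 / 2 + 11 * \<epsilon>)" unfolding \<Delta>_def pw by (simp add: algebra_simps)
  have "real W ^ 19 \<le> w ^ 19" using W by (intro power_mono) auto
  also have "\<dots> = x powr (49 / 2 - 19 * \<epsilon>)" unfolding w_def pw by (simp add: algebra_simps)
  finally have W19: "real W ^ 19 \<le> x powr (49 / 2 - 19 * \<epsilon>)" .
  have x30: "x ^ 30 = x powr 30" using x by (simp add: powr_numeral)

  have "(real (card A) / 4) ^ 30 \<le> 64^9 * 54^6 * \<Lambda>^9 * (288000 * \<Lambda>^6 * real (card A) / \<Delta>)^11 * real W ^ 19"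
  proof (rule sum_product_dichotomy[OF fin _ _ _ harm \<Delta>])
    show "2 \<le> card A" using x by (simp add: x_def)
    show "card (opset (+) A A) \<le> W" "card (opset (*) A A) \<le> W" by (simp_all add: W_def)
    show "of_nat i \<noteq> (0::'a)"
      if i: "0 < i" "real i ^ 2 \<le> 108 * \<Lambda> * real (card A) ^ 2 * real (32 * W) ^ 3" for i
    proof (rule char[OF i(1)])
      have "real i ^ 2 \<le> 108 * 32 ^ 3 * \<Lambda> * (x ^ 2 * real W ^ 3)"
        using i(2) by (simp add: x_def power_mult_distrib)
      also have "\<dots> \<le> 108 * 32 ^ 3 * \<Lambda> * (x ^ 2 * w ^ 3)"
        using W \<Lambda> by (intro mult_left_mono power_mono) auto
      also have "\<dots> \<le> 108 * 32 ^ 3 * \<Lambda> * (x ^ 2 * x powr (49 / 38 * real 3))"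
        using wn[of 3] \<Lambda> by (intro mult_left_mono) auto
      also have "\<dots> < x powr (5 / 38) * (x ^ 2 * x powr (49 / 38 * real 3))"
        using L3 x by (intro mult_strict_right_mono) auto
      also have "\<dots> = x powr (5 / 38 + (real 2 + 49 / 38 * real 3))"
        unfolding xn[of 2] by (simp only: powr_add)
      also have "\<dots> = x powr 6" by simp
      also have "\<dots> = (x ^ 3) ^ 2" using x by (simp add: powr_numeral flip: power_mult)
      finally have "real i < x ^ 3" using x by (intro power_less_imp_less_base[of "real i" 2]) auto
      then show "i < card A ^ 3" by (simp add: x_def flip: of_nat_power)
    qed
    have "64^9 * 54^6 * \<Lambda>^9 * \<Delta>^11 * real W ^ 19 * 4 ^ 30
      \<le> 64^9 * 54^6 * \<Lambda>^9 * \<Delta>^11 * x powr (49 / 2 - 19 * \<epsilon>) * 4 ^ 30"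
      using W19 \<Lambda> \<Delta> by (intro mult_left_mono mult_right_mono) auto
    also have "\<dots> = (4^30 * (64^9 * 54^6 * \<Lambda>^9)) * (x powr (11 / 2 + 11 * \<epsilon>) * x powr (49 / 2 - 19 * \<epsilon>))"
      by (simp add: \<Delta>11)
    also have "x powr (11 / 2 + 11 * \<epsilon>) * x powr (49 / 2 - 19 * \<epsilon>) = x powr (30 - 8 * \<epsilon>)"
      by (simp add: algebra_simps flip: powr_add)
    also have "(4^30 * (64^9 * 54^6 * \<Lambda>^9)) * x powr (30 - 8 * \<epsilon>) < x powr (8 * \<epsilon>) * x powr (30 - 8 * \<epsilon>)"
      using L1 x by (intro mult_strict_right_mono) auto
    also have "\<dots> = x ^ 30" by (simp add: x30 flip: powr_add)
    finally show "64^9 * 54^6 * \<Lambda>^9 * \<Delta>^11 * real W ^ 19 < (real (card A) / 4) ^ 30"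
      by (simp add: power_divide x_def field_simps)
  qed
  then have "x ^ 30 \<le> 4 ^ 30 * (64^9 * 54^6 * \<Lambda>^9 * (288000 * \<Lambda>^6 * x / \<Delta>)^11 * real W ^ 19)"
    by (simp add: x_def power_divide field_simps)
  also have "\<dots> \<le> 4 ^ 30 * (64^9 * 54^6 * \<Lambda>^9 * (288000 * \<Lambda>^6 * x / \<Delta>)^11 * x powr (49 / 2 - 19 * \<epsilon>))"
    using W19 \<Lambda> \<Delta> x by (intro mult_left_mono) auto
  also have "\<dots> = (4^30 * (64^9 * 54^6 * 288000^11 * \<Lambda>^75)) * ((x / \<Delta>) ^ 11 * x powr (49 / 2 - 19 * \<epsilon>))"
  proof -
    have "(288000 * \<Lambda>^6 * x / \<Delta>)^11 = 288000^11 * \<Lambda>^66 * (x / \<Delta>) ^ 11"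
      unfolding times_divide_eq_right[symmetric] power_mult_distrib power_mult[symmetric] by simp
    moreover have "\<Lambda>^75 = \<Lambda>^9 * \<Lambda>^66" by (simp flip: power_add)
    ultimately show ?thesis by (simp only: mult_ac)
  qed
  also have "(x / \<Delta>) ^ 11 = x powr (11 / 2 - 11 * \<epsilon>)"
  proof -
    have "x / \<Delta> = x powr (1 / 2 - \<epsilon>)"
      using x powr_diff[of x 1 "1 / 2 + \<epsilon>"] by (simp add: \<Delta>_def)
    then show ?thesis by (simp add: pw algebra_simps)
  qed
  also have "x powr (11 / 2 - 11 * \<epsilon>) * x powr (49 / 2 - 19 * \<epsilon>) = x powr (30 - 30 * \<epsilon>)"
    by (simp add: algebra_simps flip: powr_add)
  also have "(4^30 * (64^9 * 54^6 * 288000^11 * \<Lambda>^75)) * x powr (30 - 30 * \<epsilon>)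
      < x powr (30 * \<epsilon>) * x powr (30 - 30 * \<epsilon>)"
    using L2 x by (intro mult_strict_right_mono) auto
  also have "\<dots> = x ^ 30" by (simp add: x30 flip: powr_add)
  finally show False by simp
qed

lemma large_enough_beyond:
  assumes "0 < \<epsilon>"
  shows "\<exists>N0 \<ge> 1. \<forall>x \<ge> N0. large_enough \<epsilon> x"
proof -
  obtain N where "\<forall>x\<ge>N. large_enough \<epsilon> x"
    using eventually_large_enough[OF assms] unfolding eventually_at_top_linorder by blast
  then show ?thesis by (intro exI[of _ "max N 1"]) auto
qed

text \<open>Small sets are absorbed by the constant: for \<open>card A < N0\<close> the power is at
  most \<open>card A ^ 2 <= N0 * card A\<close>, and there are at least \<open>card A\<close> sums.
  The conditions on \<open>N0\<close> mention only \<open>\<epsilon>\<close>, which makes the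
  constant uniform over all fields.\<close>

lemma sum_product_type_class:
  fixes A :: "'a::field set"
  assumes \<epsilon>: "0 < \<epsilon>" and fin: "finite A" "A \<noteq> {}" and N0: "1 \<le> N0" "\<And>x. N0 \<le> x \<Longrightarrow> large_enough \<epsilon> x"
    and char: "\<And>i. 0 < i \<Longrightarrow> i < card A ^ 3 \<Longrightarrow> of_nat i \<noteq> (0::'a)"
  shows "1 / N0 * real (card A) powr (49 / 38 - \<epsilon>) \<le> real (max (card (opset (+) A A)) (card (opset (*) A A)))"
proof (cases "N0 \<le> real (card A)")
  case True
  have "1 / N0 * real (card A) powr (49 / 38 - \<epsilon>) \<le> 1 * real (card A) powr (49 / 38 - \<epsilon>)"
    using N0 by (intro mult_right_mono) auto
  also have "1 * real (card A) powr (49 / 38 - \<epsilon>) \<le> real (max (card (opset (+) A A)) (card (opset (*) A A)))"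
    using sum_product_large[OF \<epsilon> fin(1) N0(2)[OF True] char] by simp
  finally show ?thesis .
next
  case False
  define x where "x = real (card A)"
  have x: "1 \<le> x" using fin by (simp add: x_def Suc_le_eq card_gt_0_iff)
  have "x powr (49 / 38 - \<epsilon>) \<le> x powr 2" using x \<epsilon> by (intro powr_mono) auto
  also have "\<dots> = x * x" using x by (simp add: powr_numeral power2_eq_square)
  also have "\<dots> \<le> N0 * x" using False x by (intro mult_right_mono) (auto simp: x_def)
  finally have "1 / N0 * x powr (49 / 38 - \<epsilon>) \<le> x" using N0 by (simp add: field_simps)
  also have "x \<le> real (card (opset (+) A A))"
  proof -
    obtain a where a: "a \<in> A" using fin by auto
    have "card A = card ((+) a ` A)" by (simp add: card_image)
    also have "\<dots> \<le> card (opset (+) A A)"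
      using fin a by (intro card_mono finite_opset) (auto intro: opsetI)
    finally show ?thesis by (simp add: x_def)
  qed
  finally show ?thesis by (simp add: x_def)
qed

section \<open>Transfer to arbitrary fields\<close>

lemma opset_UN: "opset f A B = (\<Union>a\<in>A. \<Union>b\<in>B. {f a b})"
proof -
  have "z \<in> opset f A B \<longleftrightarrow> (\<exists>a\<in>A. \<exists>b\<in>B. z = f a b)" for z
    by (auto simp: opset_def image_iff)
  then show ?thesis by blast
qed

lemma set_add_eq_opset: "A <+>\<^bsub>k\<^esub> A = opset (\<oplus>\<^bsub>k\<^esub>) A A"
  by (simp add: set_add_def' opset_UN)

lemma set_mult_eq_opset: "A <#>\<^bsub>k\<^esub> A = opset (\<otimes>\<^bsub>k\<^esub>) A A"
  by (simp add: set_mult_def opset_UN)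

lemma ring_char_le:
  fixes n :: nat
  assumes "0 < n" "[n] \<cdot>\<^bsub>R\<^esub> \<one>\<^bsub>R\<^esub> = \<zero>\<^bsub>R\<^esub>"
  shows "0 < ring_char R" "ring_char R \<le> n"
proof -
  let ?P = "\<lambda>n::nat. n > 0 \<and> [n] \<cdot>\<^bsub>R\<^esub> \<one>\<^bsub>R\<^esub> = \<zero>\<^bsub>R\<^esub>"
  have "\<exists>n. ?P n" using assms by blast
  then have eq: "ring_char R = Least ?P" unfolding ring_char_def by (rule if_P)
  show "0 < ring_char R" unfolding eq using LeastI[of ?P n] assms by auto
  show "ring_char R \<le> n" unfolding eq using assms by (intro Least_le) auto
qed

lemma ring_char_cong:
  assumes "\<And>n::nat. [n] \<cdot>\<^bsub>R\<^esub> \<one>\<^bsub>R\<^esub> = \<zero>\<^bsub>R\<^esub> \<longleftrightarrow> [n] \<cdot>\<^bsub>S\<^esub> \<one>\<^bsub>S\<^esub> = \<zero>\<^bsub>S\<^esub>"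
  shows "ring_char R = ring_char S"
  by (simp only: ring_char_def assms)

text \<open>Provides some field on \<open>nat\<close>, so that \<open>worst_field\<close> is a field
  even if no counterexample exists.\<close>

definition two_element_field :: "nat ring" where
  "two_element_field = \<lparr>carrier = {0, 1}, monoid.mult = (*), monoid.one = 1,
    ring.zero = 0, ring.add = (\<lambda>x y. (x + y) mod 2)\<rparr>"

lemma field_two_element_field: "field two_element_field"
proof (rule cring.cring_fieldI2)
  have "abelian_group two_element_field"
    by (rule abelian_groupI) (auto simp: two_element_field_def)
  moreover have "comm_monoid two_element_field"
    by (rule comm_monoidI) (auto simp: two_element_field_def)
  ultimately show "cring two_element_field"
    by (rule cringI) (auto simp: two_element_field_def)
qed (auto simp: two_element_field_def)

text \<open>
  The estimate proved so far is about types of class \<open>field\<close>, but a type cannot be made from a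
  record \<open>k\<close> that is a variable.  It can be made from a constant: \<open>worst_field\<close> is a counterexample
  among the fields with elements in \<open>nat\<close>, if there is one.
\<close>

definition satisfies_bounds :: "('a, 'm) ring_scheme \<Rightarrow> bool" where
  "satisfies_bounds k \<longleftrightarrow> (\<forall>\<epsilon> N0. 0 < \<epsilon> \<longrightarrow> 1 \<le> N0 \<longrightarrow> (\<forall>x\<ge>N0. large_enough \<epsilon> x) \<longrightarrow>
    sum_product_bound k \<epsilon> (1 / N0))"

definition worst_field :: "nat ring" where
  "worst_field = (SOME k. field k \<and>
    ((\<exists>k' :: nat ring. field k' \<and> \<not> satisfies_bounds k') \<longrightarrow> \<not> satisfies_bounds k))"

text \<open>The bounds for this one field imply them for all fields on \<open>nat\<close>.
  \<open>satisfies_bounds\<close> quantifies over \<open>\<epsilon>\<close> and \<open>N0\<close>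
  because the constant, and the type made from it, cannot have parameters.\<close>

lemma worst_field: "field worst_field"
  "satisfies_bounds worst_field \<Longrightarrow> field k \<Longrightarrow> satisfies_bounds k" for k :: "nat ring"
proof -
  let ?Q = "\<lambda>k :: nat ring. field k \<and>
    ((\<exists>k' :: nat ring. field k' \<and> \<not> satisfies_bounds k') \<longrightarrow> \<not> satisfies_bounds k)"
  have "\<exists>k. ?Q k" using field_two_element_field by blast
  then have "?Q worst_field" unfolding worst_field_def by (rule someI_ex)
  then show "field worst_field" "satisfies_bounds worst_field \<Longrightarrow> field k \<Longrightarrow> satisfies_bounds k"
    by blast+
qed

interpretation worst: cring worst_field
  using worst_field(1) by (rule fieldE)

lemma worst_field_Units: "Units worst_field = carrier worst_field - {\<zero>\<^bsub>worst_field\<^esub>}"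
  using worst_field(1) by (rule fieldE)

lemma worst_field_one_not_zero: "\<one>\<^bsub>worst_field\<^esub> \<noteq> \<zero>\<^bsub>worst_field\<^esub>"
  using worst_field(1) by (rule fieldE)

typedef worst = "carrier worst_field"
  by (rule exI[of _ "\<zero>\<^bsub>worst_field\<^esub>"]) simp

setup_lifting type_definition_worst

instantiation worst :: field
begin

lift_definition zero_worst :: worst is "\<zero>\<^bsub>worst_field\<^esub>" by simp
lift_definition one_worst :: worst is "\<one>\<^bsub>worst_field\<^esub>" by simp
lift_definition plus_worst :: "worst \<Rightarrow> worst \<Rightarrow> worst" is "(\<oplus>\<^bsub>worst_field\<^esub>)" by simp
lift_definition times_worst :: "worst \<Rightarrow> worst \<Rightarrow> worst" is "(\<otimes>\<^bsub>worst_field\<^esub>)" by simp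
lift_definition uminus_worst :: "worst \<Rightarrow> worst" is "a_inv worst_field" by simp
definition minus_worst :: "worst \<Rightarrow> worst \<Rightarrow> worst" where "minus_worst x y = x + - y"
lift_definition inverse_worst :: "worst \<Rightarrow> worst" is
  "\<lambda>x. if x = \<zero>\<^bsub>worst_field\<^esub> then \<zero>\<^bsub>worst_field\<^esub> else inv\<^bsub>worst_field\<^esub> x"
  by (auto simp: worst_field_Units)
definition divide_worst :: "worst \<Rightarrow> worst \<Rightarrow> worst" where "divide_worst x y = x * inverse y"

instance
proof
  fix a b c :: worst
  show "a * b * c = a * (b * c)" by transfer (simp add: worst.m_assoc)
  show "a * b = b * a" by transfer (simp add: worst.m_comm)
  show "1 * a = a" by transfer simp
  show "a + b + c = a + (b + c)" by transfer (simp add: worst.a_assoc)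
  show "a + b = b + a" by transfer (simp add: worst.a_comm)
  show "0 + a = a" by transfer simp
  show "- a + a = 0" by transfer (simp add: worst.l_neg)
  show "a - b = a + - b" by (simp add: minus_worst_def)
  show "(a + b) * c = a * c + b * c" by transfer (simp add: worst.l_distr)
  show "(0::worst) \<noteq> 1" by transfer (use worst_field_one_not_zero in auto)
  show "a \<noteq> 0 \<Longrightarrow> inverse a * a = 1" by transfer (simp add: worst_field_Units)
  show "a div b = a * inverse b" by (simp add: divide_worst_def)
  show "inverse (0::worst) = 0" by transfer simp
qed

end

lemma Rep_of_nat_worst: "Rep_worst (of_nat n) = [n] \<cdot>\<^bsub>worst_field\<^esub> \<one>\<^bsub>worst_field\<^esub>"
  by (induction n) (simp_all add: zero_worst.rep_eq plus_worst.rep_eq one_worst.rep_eq worst.a_comm add.commute)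

lemma satisfies_bounds_worst_field: "satisfies_bounds worst_field"
  unfolding satisfies_bounds_def sum_product_bound_def
proof (intro allI impI)
  fix \<epsilon> N0 :: real and A
  assume \<epsilon>: "0 < \<epsilon>" and N0: "1 \<le> N0" "\<forall>x\<ge>N0. large_enough \<epsilon> x"
    and A: "A \<subseteq> carrier worst_field" "finite A" "A \<noteq> {}"
    and p: "ring_char worst_field = 0 \<or> real (card A) \<le> real (ring_char worst_field) powr (1 / 3)"
  define U where "U = Abs_worst ` A"
  have inj: "inj Rep_worst" by (simp add: inj_def Rep_worst_inject)
  have card_R: "card (Rep_worst ` B) = card B" for B by (rule card_image) (rule inj_on_subset[OF inj], simp)
  have U: "Rep_worst ` U = A"
  proof -
    have "Rep_worst ` U = (\<lambda>x. x) ` A"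
      unfolding U_def image_image using A by (intro image_cong) (auto intro: Abs_worst_inverse)
    then show ?thesis by simp
  qed
  have add: "opset (\<oplus>\<^bsub>worst_field\<^esub>) A A = Rep_worst ` opset (+) U U"
    using energy3_inj_hom(1)[where h = Rep_worst and f = "(+)" and U = U and V = U, OF inj plus_worst.rep_eq]
    by (simp add: U)
  have mult: "opset (\<otimes>\<^bsub>worst_field\<^esub>) A A = Rep_worst ` opset (*) U U"
    using energy3_inj_hom(1)[where h = Rep_worst and f = "(*)" and U = U and V = U, OF inj times_worst.rep_eq]
    by (simp add: U)
  have cA: "card A = card U" using card_R[of U] by (simp add: U)
  have char: "of_nat i \<noteq> (0::worst)" if i: "0 < i" "i < card U ^ 3" for i
  proof
    assume "of_nat i = (0::worst)"
    then have "[i] \<cdot>\<^bsub>worst_field\<^esub> \<one>\<^bsub>worst_field\<^esub> = \<zero>\<^bsub>worst_field\<^esub>"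
      by (simp add: zero_worst.rep_eq flip: Rep_of_nat_worst)
    from ring_char_le[OF i(1) this] have r: "0 < ring_char worst_field" "ring_char worst_field \<le> i" by auto
    with p have "real (card A) \<le> real (ring_char worst_field) powr (1 / 3)" by auto
    then have "real (card A) ^ 3 \<le> (real (ring_char worst_field) powr (1 / 3)) ^ 3" by (intro power_mono) auto
    also have "\<dots> = real (ring_char worst_field)" using r(1) by (simp add: powr_powr flip: powr_realpow)
    also have "\<dots> \<le> real i" using r by simp
    finally have "card U ^ 3 \<le> i" unfolding cA by (simp flip: of_nat_power)
    with i show False by simp
  qed
  have "1 / N0 * real (card U) powr (49 / 38 - \<epsilon>) \<le> real (max (card (opset (+) U U)) (card (opset (*) U U)))"
    by (rule sum_product_type_class) (use \<epsilon> N0 A char in \<open>auto simp: U_def\<close>)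
  then show "1 / N0 * real (card A) powr (49 / 38 - \<epsilon>)
      \<le> real (max (card (A <+>\<^bsub>worst_field\<^esub> A)) (card (A <#>\<^bsub>worst_field\<^esub> A)))"
    by (simp add: set_add_eq_opset set_mult_eq_opset add mult card_R cA)
qed

text \<open>The generated field lies in the union of increasing countable stages \<open>E n\<close>,
  the elements reached in \<open>n\<close> rounds of operations.\<close>

lemma countable_generate_field:
  fixes k :: "('a, 'm) ring_scheme"
  assumes "countable A" shows "countable (generate_field k A)"
proof -
  define step where "step E = E \<union> (\<lambda>x. \<ominus>\<^bsub>k\<^esub> x) ` E \<union> (\<lambda>x. inv\<^bsub>k\<^esub> x) ` E \<union>
    (\<lambda>(x, y). x \<oplus>\<^bsub>k\<^esub> y) ` (E \<times> E) \<union> (\<lambda>(x, y). x \<otimes>\<^bsub>k\<^esub> y) ` (E \<times> E)" for E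
  define E where "E n = (step ^^ n) (insert \<one>\<^bsub>k\<^esub> A)" for n
  have ESuc: "E (Suc n) = step (E n)" for n by (simp add: E_def)
  have "countable (E n)" for n
    by (induction n) (use assms in \<open>auto simp: ESuc step_def E_def[of 0]\<close>)
  then have "countable (\<Union>n. E n)" by simp
  moreover have mono: "E m \<subseteq> E n" if "m \<le> n" for m n
    using that by (induction n rule: dec_induct) (auto simp: ESuc step_def)
  have "x \<in> (\<Union>n. E n)" if "x \<in> generate_field k A" for x
    using that
  proof induction
    case one
    then show ?case by (auto simp: E_def intro: exI[of _ 0])
  next
    case (incl h)
    then show ?case by (auto simp: E_def intro: exI[of _ 0])
  next
    case (a_inv h)
    then obtain n where "h \<in> E n" by auto
    then have "\<ominus>\<^bsub>k\<^esub> h \<in> E (Suc n)" by (auto simp: ESuc step_def)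
    then show ?case by blast
  next
    case (m_inv h)
    then obtain n where "h \<in> E n" by auto
    then have "inv\<^bsub>k\<^esub> h \<in> E (Suc n)" by (auto simp: ESuc step_def)
    then show ?case by blast
  next
    case (eng_add x y)
    then obtain i j where "x \<in> E i" "y \<in> E j" by auto
    then have "x \<in> E (max i j)" "y \<in> E (max i j)" using mono[of i "max i j"] mono[of j "max i j"] by auto
    then have "x \<oplus>\<^bsub>k\<^esub> y \<in> E (Suc (max i j))" by (auto simp: ESuc step_def)
    then show ?case by blast
  next
    case (eng_mult x y)
    then obtain i j where "x \<in> E i" "y \<in> E j" by auto
    then have "x \<in> E (max i j)" "y \<in> E (max i j)" using mono[of i "max i j"] mono[of j "max i j"] by auto
    then have "x \<otimes>\<^bsub>k\<^esub> y \<in> E (Suc (max i j))" by (auto simp: ESuc step_def)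
    then show ?case by blast
  qed
  ultimately show ?thesis by (meson countable_subset subsetI)
qed

text \<open>Sums, products and the characteristic are the same in the subfield generated by
  \<open>A\<close>, which is countable and can be copied to \<open>nat\<close>. So a constant chosen
  for fields on \<open>nat\<close> serves all fields.\<close>

lemma sum_product_bound_of_countable:
  fixes k :: "('a, 'm) ring_scheme"
  assumes k: "field k" and c: "\<And>q :: nat ring. field q \<Longrightarrow> sum_product_bound q \<epsilon> c"
  shows "sum_product_bound k \<epsilon> c"
  unfolding sum_product_bound_def
proof (intro allI impI)
  fix A assume A: "A \<subseteq> carrier k" "finite A" "A \<noteq> {}"
    and p: "ring_char k = 0 \<or> real (card A) \<le> real (ring_char k) powr (1 / 3)"
  interpret k: cring k using k by (rule fieldE)
  define F where "F = generate_field k A"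
  have AF: "A \<subseteq> F" by (auto simp: F_def intro: generate_field.incl)
  have sub: "subfield F k" unfolding F_def by (rule field.generate_field_is_subfield[OF k A(1)])
  have F: "field (k\<lparr>carrier := F\<rparr>)" by (rule k.subfield_iff(2)[OF sub])
  interpret F: cring "k\<lparr>carrier := F\<rparr>" using F by (rule fieldE)
  have cl: "\<zero>\<^bsub>k\<^esub> \<in> F" "\<one>\<^bsub>k\<^esub> \<in> F" "x \<in> F \<Longrightarrow> y \<in> F \<Longrightarrow> x \<oplus>\<^bsub>k\<^esub> y \<in> F"
    "x \<in> F \<Longrightarrow> y \<in> F \<Longrightarrow> x \<otimes>\<^bsub>k\<^esub> y \<in> F" for x y
    using F.zero_closed F.one_closed F.a_closed[of x y] F.m_closed[of x y] by simp_all
  define f where "f = to_nat_on F"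
  define g where "g = inv_into F f"
  have inj: "inj_on f F"
    unfolding f_def F_def using A by (intro inj_on_to_nat_on countable_generate_field) (simp add: countable_finite)
  have gf: "g (f x) = x" if "x \<in> F" for x unfolding g_def using inj that by (rule inv_into_f_f)
  define q :: "nat ring" where
    "q = \<lparr>carrier = f ` F, monoid.mult = (\<lambda>x y. f (g x \<otimes>\<^bsub>k\<^esub> g y)),
      monoid.one = f \<one>\<^bsub>k\<^esub>,
    ring.zero = f \<zero>\<^bsub>k\<^esub>, ring.add = (\<lambda>x y. f (g x \<oplus>\<^bsub>k\<^esub> g y))\<rparr>"
  have "f \<in> ring_iso (k\<lparr>carrier := F\<rparr>) q"
    by (rule ring_iso_memI) (auto simp: q_def gf cl bij_betw_def inj)
  from field.ring_iso_imp_img_field[OF F this] have q: "field q" by (simp add: q_def)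
  interpret q: cring q using q by (rule fieldE)
  have pow: "[n] \<cdot>\<^bsub>k\<^esub> \<one>\<^bsub>k\<^esub> \<in> F \<and> [n] \<cdot>\<^bsub>q\<^esub> \<one>\<^bsub>q\<^esub> = f ([n] \<cdot>\<^bsub>k\<^esub> \<one>\<^bsub>k\<^esub>)" for n :: nat
    by (induction n) (auto simp: cl, auto simp: q_def gf cl)
  have "ring_char q = ring_char k"
  proof (rule ring_char_cong)
    fix n :: nat
    have "f ([n] \<cdot>\<^bsub>k\<^esub> \<one>\<^bsub>k\<^esub>) = f \<zero>\<^bsub>k\<^esub> \<longleftrightarrow> [n] \<cdot>\<^bsub>k\<^esub> \<one>\<^bsub>k\<^esub> = \<zero>\<^bsub>k\<^esub>"
      using pow cl(1) by (intro inj_on_eq_iff[OF inj]) auto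
    then show "[n] \<cdot>\<^bsub>q\<^esub> \<one>\<^bsub>q\<^esub> = \<zero>\<^bsub>q\<^esub> \<longleftrightarrow> [n] \<cdot>\<^bsub>k\<^esub> \<one>\<^bsub>k\<^esub> = \<zero>\<^bsub>k\<^esub>"
      using pow[of n] by (simp add: q_def)
  qed
  have card_f: "card (f ` B) = card B" if "B \<subseteq> F" for B using inj that by (intro card_image) (rule inj_on_subset)
  have add: "f ` A <+>\<^bsub>q\<^esub> f ` A = f ` (A <+>\<^bsub>k\<^esub> A)"
    using AF by (force simp: set_add_def' q_def gf subset_iff)
  have mult: "f ` A <#>\<^bsub>q\<^esub> f ` A = f ` (A <#>\<^bsub>k\<^esub> A)"
    using AF by (force simp: set_mult_def q_def gf subset_iff)
  have "A <+>\<^bsub>k\<^esub> A \<subseteq> F" "A <#>\<^bsub>k\<^esub> A \<subseteq> F"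
    using AF cl by (auto simp: set_add_def' set_mult_def subset_iff)
  moreover have "c * real (card (f ` A)) powr (49 / 38 - \<epsilon>)
      \<le> real (max (card (f ` A <+>\<^bsub>q\<^esub> f ` A)) (card (f ` A <#>\<^bsub>q\<^esub> f ` A)))"
  proof (rule c[OF q, unfolded sum_product_bound_def, rule_format])
    show "f ` A \<subseteq> carrier q" using AF by (auto simp: q_def)
    show "ring_char q = 0 \<or> real (card (f ` A)) \<le> real (ring_char q) powr (1 / 3)"
      unfolding card_f[OF AF] \<open>ring_char q = ring_char k\<close> by (rule p)
  qed (use A in auto)
  ultimately show "c * real (card A) powr (49 / 38 - \<epsilon>) \<le> real (max (card (A <+>\<^bsub>k\<^esub> A)) (card (A <#>\<^bsub>k\<^esub> A)))"
    using AF by (simp add: add mult card_f)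
qed

theorem corollary10:
  fixes \<epsilon> :: real
  assumes "\<epsilon> > 0"
  shows "sum_product_const \<epsilon> > 0 \<and>
    (\<forall>k :: ('a, 'm) ring_scheme. field k \<longrightarrow>
      (\<forall>A. A \<subseteq> carrier k \<longrightarrow> finite A \<longrightarrow> A \<noteq> {} \<longrightarrow>
        ring_char k = 0 \<or> real (card A) \<le> real (ring_char k) powr (1 / 3) \<longrightarrow>
        real (max (card (A <+>\<^bsub>k\<^esub> A)) (card (A <#>\<^bsub>k\<^esub> A)))
          \<ge> sum_product_const \<epsilon> * real (card A) powr (49 / 38 - \<epsilon>)))"
proof -
  let ?Q = "\<lambda>c. 0 < c \<and> (\<forall>k :: nat ring. field k \<longrightarrow> sum_product_bound k \<epsilon> c)"
  obtain N0 where N0: "1 \<le> N0" "\<forall>x\<ge>N0. large_enough \<epsilon> x"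
    using large_enough_beyond[OF assms] by blast
  have "satisfies_bounds k" if "field k" for k :: "nat ring"
    using worst_field(2)[OF satisfies_bounds_worst_field that] .
  then have "?Q (1 / N0)"
    using N0 assms unfolding satisfies_bounds_def by auto
  \<comment> \<open>\<open>1 / N0\<close> shows that the choice has a candidate; the chosen value
    may differ from it but shares its property.\<close>
  then have "?Q (sum_product_const \<epsilon>)"
    unfolding sum_product_const_def by (rule someI[of ?Q])
  then have pos: "0 < sum_product_const \<epsilon>"
    and nat: "\<forall>k :: nat ring. field k \<longrightarrow> sum_product_bound k \<epsilon> (sum_product_const \<epsilon>)"
    by (rule conjunct1, rule conjunct2)
  have bound: "sum_product_bound k \<epsilon> (sum_product_const \<epsilon>)" if "field k" for k :: "('a, 'm) ring_scheme"
    using that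
  proof (rule sum_product_bound_of_countable)
    show "sum_product_bound q \<epsilon> (sum_product_const \<epsilon>)" if "field q" for q :: "nat ring"
      using nat[rule_format, OF that] .
  qed
  show ?thesis
  proof (intro conjI pos allI impI)
    fix k :: "('a, 'm) ring_scheme" and A
    assume "field k" and A: "A \<subseteq> carrier k" "finite A" "A \<noteq> {}"
      "ring_char k = 0 \<or> real (card A) \<le> real (ring_char k) powr (1 / 3)"
    show "sum_product_const \<epsilon> * real (card A) powr (49 / 38 - \<epsilon>)
        \<le> real (max (card (A <+>\<^bsub>k\<^esub> A)) (card (A <#>\<^bsub>k\<^esub> A)))"
      by (rule bound[OF \<open>field k\<close>, unfolded sum_product_bound_def, rule_format, OF A])
  qed
qed

end
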